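(* Let $n\ge 3$. The space $\mathcal{E}_n$ of supersymmetric Hill's equations, i.e. of supersymmetric discrete Sturm-Liouville equations with coefficients $a_{i+n}=a_i$, $\beta_{i+n}=-\beta_i$ all of whose solutions satisfy $V_{i+n}=-V_i$, $W_{i+n}=W_i$ for all $i\in\mathbb{Z}$, is an algebraic supervariety of dimension $(n-3)\,|\,(n-2)$.
   Context: The ground field is $\mathbb{K}=\mathbb{R}$ or $\mathbb{C}$. Let $a_1,\dots,a_n$ be even (commuting) variables and $\beta_1,\dots,\beta_n$ odd (anticommuting, square-zero) variables, extended to all $i\in\mathbb{Z}$ by $a_{i+n}=a_i$, $\beta_{i+n}=-\beta_i$. The supersymmetric discrete Sturm-Liouville equation with this potential is the system $$V_i=a_iV_{i-1}-V_{i-2}-\beta_iW_{i-1},\qquad W_i=W_{i-1}+\beta_iV_{i-1}\qquad(i\in\mathbb{Z}),$$ that is, $(V_{i-1},V_i,W_i)^T=A_i\,(V_{i-2},V_{i-1},W_{i-1})^T$ with $$A_i=\begin{pmatrix}0&1&0\\-1&a_i&-\beta_i\\0&\beta_i&1\end{pmatrix}.$$ The (anti)periodicity condition $V_{i+n}=-V_i$, $W_{i+n}=W_i$ on all solutions is equivalent to the polynomial condition $M_i=\mathrm{diag}(-1,-1,1)$ on the monodromy matrix $M_i=A_{i+n-1}A_{i+n-2}\cdots A_i$; $\mathcal{E}_n$ is the supervariety in the variables $(a_1,\dots,a_n,\beta_1,\dots,\beta_n)$ (a subvariety of the $n|n$-dimensional affine superspace) defined by this condition. Dimension $p|q$ means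 even dimension $p$ and odd dimension $q$. *)

theory Defs
  imports
    "HOL-Analysis.Cartesian_Space"
    "HOL-Algebra.QuotRing"
    "HOL-Algebra.Subrings"
    "HOL-Library.Poly_Mapping"
begin

section \<open>Superpolynomials\<close>

text \<open>
  The Grassmann algebra over \<open>'c\<close> on odd generators \<open>\<theta>\<^sub>i\<close> indexed by the natural numbers.
  The basis monomial of a finite set \<open>S = {i\<^sub>1 < ... < i\<^sub>k}\<close> is \<open>\<theta>\<^bsub>i\<^sub>1\<^esub> ... \<theta>\<^bsub>i\<^sub>k\<^esub>\<close>, in this order.
\<close>

typedef (overloaded) 'c grassmann =
  "{f :: nat set \<Rightarrow> 'c::zero. finite {S. f S \<noteq> 0} \<and> (\<forall>S. f S \<noteq> 0 \<longrightarrow> finite S)}"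
  morphisms gcoeff Abs_grassmann
  by (rule exI[of _ "\<lambda>_. 0"]) simp

setup_lifting type_definition_grassmann

text \<open>
  The sign by which the product of the monomials of two disjoint sets \<open>S\<close> and \<open>T\<close>
  differs from the monomial of \<open>S \<union> T\<close>.
\<close>

definition shuffle_sign :: "nat set \<Rightarrow> nat set \<Rightarrow> 'c::comm_ring_1" where
  "shuffle_sign S T = (-1) ^ card {(i, j). i \<in> S \<and> j \<in> T \<and> j < i}"

lemma shuffle_sign_empty [simp]: "shuffle_sign {} T = 1" "shuffle_sign S {} = 1"
  by (simp_all add: shuffle_sign_def)

lemma shuffle_sign_Un_left:
  assumes "finite S" "finite T" "finite U" "S \<inter> T = {}"
  shows "shuffle_sign (S \<union> T) U = shuffle_sign S U * shuffle_sign T U"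
proof -
  have fin: "finite {(i, j). i \<in> V \<and> j \<in> U \<and> j < i}" if "finite V" for V :: "nat set"
    by (rule finite_subset[of _ "V \<times> U"]) (use that assms in auto)
  have eq: "{(i, j). i \<in> S \<union> T \<and> j \<in> U \<and> j < i}
      = {(i, j). i \<in> S \<and> j \<in> U \<and> j < i} \<union> {(i, j). i \<in> T \<and> j \<in> U \<and> j < i}"
    by auto
  show ?thesis
    unfolding shuffle_sign_def eq
    by (subst card_Un_disjoint) (use fin assms in \<open>auto simp: power_add\<close>)
qed

lemma shuffle_sign_Un_right:
  assumes "finite S" "finite T" "finite U" "T \<inter> U = {}"
  shows "shuffle_sign S (T \<union> U) = shuffle_sign S T * shuffle_sign S U"
proof -
  have fin: "finite {(i, j). i \<in> S \<and> j \<in> V \<and> j < i}" if "finite V" for V :: "nat set"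
    by (rule finite_subset[of _ "S \<times> V"]) (use that assms in auto)
  have eq: "{(i, j). i \<in> S \<and> j \<in> T \<union> U \<and> j < i}
      = {(i, j). i \<in> S \<and> j \<in> T \<and> j < i} \<union> {(i, j). i \<in> S \<and> j \<in> U \<and> j < i}"
    by auto
  show ?thesis
    unfolding shuffle_sign_def eq
    by (subst card_Un_disjoint) (use fin assms in \<open>auto simp: power_add\<close>)
qed

instantiation grassmann :: (comm_ring_1) ring_1
begin

lift_definition zero_grassmann :: "'a grassmann" is "\<lambda>_. 0"
  by simp

lift_definition one_grassmann :: "'a grassmann" is "\<lambda>S. if S = {} then 1 else 0"
  by simp

lift_definition uminus_grassmann :: "'a grassmann \<Rightarrow> 'a grassmann" is "\<lambda>f S. - f S"
  by simp

lift_definition plus_grassmann :: "'a grassmann \<Rightarrow> 'a grassmann \<Rightarrow> 'a grassmann"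
  is "\<lambda>f g S. f S + g S"
proof -
  fix f g :: "nat set \<Rightarrow> 'a"
  assume f: "finite {S. f S \<noteq> 0} \<and> (\<forall>S. f S \<noteq> 0 \<longrightarrow> finite S)"
    and g: "finite {S. g S \<noteq> 0} \<and> (\<forall>S. g S \<noteq> 0 \<longrightarrow> finite S)"
  have "finite {S. f S + g S \<noteq> 0}"
    by (rule finite_subset[of _ "{S. f S \<noteq> 0} \<union> {S. g S \<noteq> 0}"]) (use f g in auto)
  then show "finite {S. f S + g S \<noteq> 0} \<and> (\<forall>S. f S + g S \<noteq> 0 \<longrightarrow> finite S)"
    using f g by (metis add.right_neutral)
qed

lift_definition minus_grassmann :: "'a grassmann \<Rightarrow> 'a grassmann \<Rightarrow> 'a grassmann"
  is "\<lambda>f g S. f S - g S"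
proof -
  fix f g :: "nat set \<Rightarrow> 'a"
  assume f: "finite {S. f S \<noteq> 0} \<and> (\<forall>S. f S \<noteq> 0 \<longrightarrow> finite S)"
    and g: "finite {S. g S \<noteq> 0} \<and> (\<forall>S. g S \<noteq> 0 \<longrightarrow> finite S)"
  have "finite {S. f S - g S \<noteq> 0}"
    by (rule finite_subset[of _ "{S. f S \<noteq> 0} \<union> {S. g S \<noteq> 0}"]) (use f g in auto)
  then show "finite {S. f S - g S \<noteq> 0} \<and> (\<forall>S. f S - g S \<noteq> 0 \<longrightarrow> finite S)"
    using f g by (metis diff_zero)
qed

lift_definition times_grassmann :: "'a grassmann \<Rightarrow> 'a grassmann \<Rightarrow> 'a grassmann"
  is "\<lambda>f g S. \<Sum>T\<in>Pow S. shuffle_sign T (S - T) * f T * g (S - T)"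
proof -
  fix f g :: "nat set \<Rightarrow> 'a"
  assume f: "finite {S. f S \<noteq> 0} \<and> (\<forall>S. f S \<noteq> 0 \<longrightarrow> finite S)"
    and g: "finite {S. g S \<noteq> 0} \<and> (\<forall>S. g S \<noteq> 0 \<longrightarrow> finite S)"
  let ?h = "\<lambda>S. \<Sum>T\<in>Pow S. shuffle_sign T (S - T) * f T * g (S - T)"
  have *: "\<exists>T\<in>Pow S. f T \<noteq> 0 \<and> g (S - T) \<noteq> 0" if "?h S \<noteq> 0" for S
  proof (rule ccontr)
    assume "\<not> ?thesis"
    then have "shuffle_sign T (S - T) * f T * g (S - T) = 0" if "T \<in> Pow S" for T
      using that by (metis mult_zero_left mult_zero_right)
    then have "?h S = 0"
      by (intro sum.neutral) blast
    with that show False by simp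
  qed
  have "{S. ?h S \<noteq> 0} \<subseteq> (\<lambda>(T, U). T \<union> U) ` ({S. f S \<noteq> 0} \<times> {S. g S \<noteq> 0})"
  proof
    fix S assume "S \<in> {S. ?h S \<noteq> 0}"
    then obtain T where T: "T \<subseteq> S" "f T \<noteq> 0" "g (S - T) \<noteq> 0"
      using * by blast
    then have "S = (\<lambda>(T, U). T \<union> U) (T, S - T)" by auto
    with T show "S \<in> (\<lambda>(T, U). T \<union> U) ` ({S. f S \<noteq> 0} \<times> {S. g S \<noteq> 0})" by blast
  qed
  then have "finite {S. ?h S \<noteq> 0}"
    by (rule finite_subset) (use f g in blast)
  moreover have "finite S" if "?h S \<noteq> 0" for S
    using that by (metis (mono_tags, lifting) finite_Pow_iff sum.infinite)
  ultimately show "finite {S. ?h S \<noteq> 0} \<and> (\<forall>S. ?h S \<noteq> 0 \<longrightarrow> finite S)"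
    by blast
qed

instance
proof
  fix a b c :: "'a grassmann"
  show "a + b + c = a + (b + c)" by transfer (simp add: add.assoc)
  show "a + b = b + a" by transfer (simp add: add.commute)
  show "0 + a = a" by transfer simp
  show "- a + a = 0" by transfer simp
  show "a - b = a + - b" by transfer simp
  show "(0::'a grassmann) \<noteq> 1" by transfer (metis zero_neq_one)
  show "(a + b) * c = a * c + b * c"
    by transfer (simp add: algebra_simps sum.distrib)
  show "a * (b + c) = a * b + a * c"
    by transfer (simp add: algebra_simps sum.distrib)
  show "1 * a = a"
  proof (transfer, rule ext)
    fix f :: "nat set \<Rightarrow> 'a" and S
    assume f: "finite {S. f S \<noteq> 0} \<and> (\<forall>S. f S \<noteq> 0 \<longrightarrow> finite S)"
    show "(\<Sum>T\<in>Pow S. shuffle_sign T (S - T) * (if T = {} then 1 else 0) * f (S - T)) = f S"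
    proof (cases "finite S")
      case True
      have "(\<Sum>T\<in>Pow S. shuffle_sign T (S - T) * (if T = {} then 1 else 0) * f (S - T))
          = (\<Sum>T\<in>{{}}. shuffle_sign T (S - T) * (if T = {} then 1 else 0) * f (S - T))"
        by (rule sum.mono_neutral_right) (use True in auto)
      then show ?thesis by simp
    next
      case False
      then have "f S = 0" using f by blast
      with False show ?thesis by simp
    qed
  qed
  show "a * 1 = a"
  proof (transfer, rule ext)
    fix f :: "nat set \<Rightarrow> 'a" and S
    assume f: "finite {S. f S \<noteq> 0} \<and> (\<forall>S. f S \<noteq> 0 \<longrightarrow> finite S)"
    show "(\<Sum>T\<in>Pow S. shuffle_sign T (S - T) * f T * (if S - T = {} then 1 else 0)) = f S"
    proof (cases "finite S")
      case True
      have "(\<Sum>T\<in>Pow S. shuffle_sign T (S - T) * f T * (if S - T = {} then 1 else 0))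
          = (\<Sum>T\<in>{S}. shuffle_sign T (S - T) * f T * (if S - T = {} then 1 else 0))"
        by (rule sum.mono_neutral_right) (use True in auto)
      then show ?thesis by simp
    next
      case False
      then have "f S = 0" using f by blast
      with False show ?thesis by simp
    qed
  qed
  show "a * b * c = a * (b * c)"
  proof (transfer, rule ext)
    fix f g h :: "nat set \<Rightarrow> 'a" and S
    let ?s = "shuffle_sign :: nat set \<Rightarrow> nat set \<Rightarrow> 'a"
    show "(\<Sum>T\<in>Pow S. ?s T (S - T) * (\<Sum>U\<in>Pow T. ?s U (T - U) * f U * g (T - U)) * h (S - T))
      = (\<Sum>T\<in>Pow S. ?s T (S - T) * f T *
          (\<Sum>U\<in>Pow (S - T). ?s U (S - T - U) * g U * h (S - T - U)))"
    proof (cases "finite S")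
      case True
      have "(\<Sum>T\<in>Pow S. ?s T (S - T) * (\<Sum>U\<in>Pow T. ?s U (T - U) * f U * g (T - U)) * h (S - T))
          = (\<Sum>T\<in>Pow S. \<Sum>U\<in>Pow T. ?s T (S - T) * ?s U (T - U) * f U * g (T - U) * h (S - T))"
        by (simp add: sum_distrib_left sum_distrib_right mult.assoc)
      also have "\<dots> = (\<Sum>(T, U)\<in>Sigma (Pow S) Pow.
          ?s T (S - T) * ?s U (T - U) * f U * g (T - U) * h (S - T))"
        by (rule sum.Sigma) (use True in \<open>auto intro: finite_subset\<close>)
      also have "\<dots> = (\<Sum>(T, U)\<in>Sigma (Pow S) (\<lambda>T. Pow (S - T)).
          ?s T (S - T) * ?s U (S - T - U) * f T * g U * h (S - T - U))"
      proof (rule sum.reindex_bij_witness[where i = "\<lambda>(T, U). (T \<union> U, T)"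
            and j = "\<lambda>(T, U). (U, T - U)"])
        fix x assume "x \<in> Sigma (Pow S) Pow"
        then obtain T U where x: "x = (T, U)" "T \<subseteq> S" "U \<subseteq> T" by auto
        show "(case case x of (T, U) \<Rightarrow> (U, T - U) of (T, U) \<Rightarrow> (T \<union> U, T)) = x"
          using x by auto
        show "(case x of (T, U) \<Rightarrow> (U, T - U)) \<in> Sigma (Pow S) (\<lambda>T. Pow (S - T))"
          using x by auto
        have fin: "finite T" "finite U"
          using x True by (auto intro: finite_subset)
        have 1: "?s T (S - T) = ?s U (S - T) * ?s (T - U) (S - T)"
          using shuffle_sign_Un_left[of U "T - U" "S - T"] fin True x
          by (simp add: Un_absorb1)
        have 2: "?s U (S - U) = ?s U (T - U) * ?s U (S - T)"
        proof -
          have "S - U = (T - U) \<union> (S - T)" using x by auto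
          then show ?thesis
            using shuffle_sign_Un_right[of U "T - U" "S - T"] fin True by auto
        qed
        have 3: "S - U - (T - U) = S - T" using x by auto
        show "(case case x of (T, U) \<Rightarrow> (U, T - U) of (T, U) \<Rightarrow>
              ?s T (S - T) * ?s U (S - T - U) * f T * g U * h (S - T - U))
            = (case x of (T, U) \<Rightarrow> ?s T (S - T) * ?s U (T - U) * f U * g (T - U) * h (S - T))"
          by (simp add: x 1 2 3 mult_ac)
      next
        fix y assume "y \<in> Sigma (Pow S) (\<lambda>T. Pow (S - T))"
        then obtain T U where y: "y = (T, U)" "T \<subseteq> S" "U \<subseteq> S - T" by auto
        show "(case case y of (T, U) \<Rightarrow> (T \<union> U, T) of (T, U) \<Rightarrow> (U, T - U)) = y"
          using y by auto
        show "(case y of (T, U) \<Rightarrow> (T \<union> U, T)) \<in> Sigma (Pow S) Pow"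
          using y by auto
      qed
      also have "\<dots> = (\<Sum>T\<in>Pow S. \<Sum>U\<in>Pow (S - T).
          ?s T (S - T) * ?s U (S - T - U) * f T * g U * h (S - T - U))"
        by (rule sum.Sigma[symmetric]) (use True in auto)
      also have "\<dots> = (\<Sum>T\<in>Pow S. ?s T (S - T) * f T *
          (\<Sum>U\<in>Pow (S - T). ?s U (S - T - U) * g U * h (S - T - U)))"
        by (simp add: sum_distrib_left mult_ac)
      finally show ?thesis .
    qed simp
  qed
qed

end

lift_definition gconst :: "'c::zero \<Rightarrow> 'c grassmann" is "\<lambda>c S. if S = {} then c else 0"
  by simp

lift_definition gvar :: "nat \<Rightarrow> 'c::zero_neq_one grassmann" is "\<lambda>i S. if S = {i} then 1 else 0"
  by simp

lemma gvar_square: "gvar i * gvar i = (0 :: 'c::comm_ring_1 grassmann)"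
proof (transfer, rule ext)
  fix i :: nat and S :: "nat set"
  show "(\<Sum>T\<in>Pow S. shuffle_sign T (S - T) * (if T = {i} then 1 else 0) *
      (if S - T = {i} then 1 else 0)) = (0 :: 'c)"
    by (rule sum.neutral) auto
qed

lemma gvar_anticommute:
  "gvar i * gvar j = - (gvar j * gvar i :: 'c::comm_ring_1 grassmann)"
proof (cases "i = j")
  case True
  then show ?thesis by (simp add: gvar_square)
next
  case False
  have prod: "gcoeff (gvar k * gvar l :: 'c grassmann) S
      = (if S = {k, l} then shuffle_sign {k} {l} else 0)" if "k \<noteq> l" for k l S
  proof (cases "S = {k, l}")
    case True
    have "(\<Sum>T\<in>Pow S. shuffle_sign T (S - T) * (if T = {k} then 1 else 0) *
        (if S - T = {l} then 1 else 0))
      = (\<Sum>T\<in>{{k}}. shuffle_sign T (S - T) * (if T = {k} then 1 else 0) *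
        (if S - T = {l} then 1 else (0 :: 'c)))"
      by (rule sum.mono_neutral_right) (use True in auto)
    moreover have "S - {k} = {l}" using True that by auto
    ultimately show ?thesis using True by (simp add: times_grassmann.rep_eq gvar.rep_eq)
  next
    case ne: False
    have "(\<Sum>T\<in>Pow S. shuffle_sign T (S - T) * (if T = {k} then 1 else 0) *
        (if S - T = {l} then 1 else (0 :: 'c))) = 0"
      by (rule sum.neutral) (use ne in auto)
    then show ?thesis using ne by (simp add: times_grassmann.rep_eq gvar.rep_eq)
  qed
  have sign: "(shuffle_sign {i} {j} :: 'c) = - shuffle_sign {j} {i}"
  proof -
    have "{(a, b). a \<in> {k} \<and> b \<in> {l} \<and> b < a} = (if l < k then {(k, l)} else {})"
      for k l :: nat by auto
    then show ?thesis using False by (auto simp: shuffle_sign_def)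
  qed
  show ?thesis
    unfolding gcoeff_inject[symmetric]
    by (rule ext) (use False in \<open>auto simp: prod sign uminus_grassmann.rep_eq insert_commute\<close>)
qed

type_synonym 'k superpoly = "((nat \<Rightarrow>\<^sub>0 nat) \<Rightarrow>\<^sub>0 'k) grassmann"

definition even_var :: "nat \<Rightarrow> 'k::comm_ring_1 superpoly" where
  "even_var i = gconst (Poly_Mapping.single (Poly_Mapping.single i 1) 1)"

definition odd_var :: "nat \<Rightarrow> 'k::comm_ring_1 superpoly" where
  "odd_var i = gvar i"


section \<open>Superalgebras\<close>

record ('k, 'a) superalg = "'a ring" +
  even_part :: "'a set"
  odd_part :: "'a set"
  scalar :: "'k \<Rightarrow> 'a"

locale supercommutative_superalgebra = ring A
  for A :: "('k::field, 'a) superalg" (structure) +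
  assumes even_subgroup: "subgroup (even_part A) (add_monoid A)"
    and odd_subgroup: "subgroup (odd_part A) (add_monoid A)"
    and even_odd_sum: "carrier A = even_part A <+>\<^bsub>A\<^esub> odd_part A"
    and even_odd_inter: "even_part A \<inter> odd_part A = {\<zero>}"
    and even_even: "\<lbrakk>x \<in> even_part A; y \<in> even_part A\<rbrakk> \<Longrightarrow> x \<otimes> y \<in> even_part A"
    and even_odd: "\<lbrakk>x \<in> even_part A; y \<in> odd_part A\<rbrakk> \<Longrightarrow> x \<otimes> y \<in> odd_part A"
    and odd_odd: "\<lbrakk>x \<in> odd_part A; y \<in> odd_part A\<rbrakk> \<Longrightarrow> x \<otimes> y \<in> even_part A"
    and even_central: "\<lbrakk>x \<in> even_part A; y \<in> carrier A\<rbrakk> \<Longrightarrow> x \<otimes> y = y \<otimes> x"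
    and odd_anticommute: "\<lbrakk>x \<in> odd_part A; y \<in> odd_part A\<rbrakk> \<Longrightarrow> x \<otimes> y = \<ominus> (y \<otimes> x)"
    and odd_square: "x \<in> odd_part A \<Longrightarrow> x \<otimes> x = \<zero>"
    and scalar_even: "scalar A c \<in> even_part A"
    and scalar_one: "scalar A 1 = \<one>"
    and scalar_add: "scalar A (c + d) = scalar A c \<oplus> scalar A d"
    and scalar_mult: "scalar A (c * d) = scalar A c \<otimes> scalar A d"

definition superalg_homs ::
  "('k, 'a) superalg \<Rightarrow> ('k, 'b) superalg \<Rightarrow> ('a \<Rightarrow> 'b) set" where
  "superalg_homs A B = {\<phi> \<in> ring_hom A B. \<phi> \<in> extensional (carrier A)
      \<and> \<phi> ` even_part A \<subseteq> even_part B \<and> \<phi> ` odd_part A \<subseteq> odd_part B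
      \<and> (\<forall>c. \<phi> (scalar A c) = scalar B c)}"

text \<open>
  The coordinate superalgebras of affine algebraic supervarieties: supercommutative and of finite
  type over the ground field.
\<close>

definition affine_superalgebra :: "('k::field, 'a) superalg \<Rightarrow> bool" where
  "affine_superalgebra A \<longleftrightarrow> supercommutative_superalgebra A
      \<and> (\<exists>F. finite F \<and> F \<subseteq> carrier A
          \<and> (\<forall>H. subring H A \<and> F \<subseteq> H \<and> range (scalar A) \<subseteq> H \<longrightarrow> H = carrier A))"

definition quotient_superalg :: "('k, 'a) superalg \<Rightarrow> 'a set \<Rightarrow> ('k, 'a set) superalg" where
  "quotient_superalg A I = ring.extend (A Quot I)
      (superalg.fields ((\<lambda>f. I +>\<^bsub>A\<^esub> f) ` even_part A) ((\<lambda>f. I +>\<^bsub>A\<^esub> f) ` odd_part A)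
        (\<lambda>c. I +>\<^bsub>A\<^esub> scalar A c))"

text \<open>
  The coordinate superalgebra of the affine superspace of dimension \<open>n|n\<close>: superpolynomials in the
  variables with indices in \<open>{1..n}\<close>.
\<close>

definition affine_superspace :: "nat \<Rightarrow> ('k::comm_ring_1, 'k superpoly) superalg" where
  "affine_superspace n =
    (let P = {f :: 'k superpoly. \<forall>S. gcoeff f S \<noteq> 0 \<longrightarrow>
           S \<subseteq> {1..n} \<and> (\<forall>m\<in>Poly_Mapping.keys (gcoeff f S). Poly_Mapping.keys m \<subseteq> {1..n})}
     in \<lparr>carrier = P, monoid.mult = (*), one = 1, zero = 0, add = (+),
         even_part = {f \<in> P. \<forall>S. gcoeff f S \<noteq> 0 \<longrightarrow> even (card S)},
         odd_part = {f \<in> P. \<forall>S. gcoeff f S \<noteq> 0 \<longrightarrow> odd (card S)},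
         scalar = (\<lambda>c. gconst (Poly_Mapping.single 0 c))\<rparr>)"


section \<open>Superdimension\<close>

text \<open>The zero ring has no prime ideals and hence no Krull dimension in this sense.\<close>

definition prime_chain :: "('a, 'b) ring_scheme \<Rightarrow> nat \<Rightarrow> (nat \<Rightarrow> 'a set) \<Rightarrow> bool" where
  "prime_chain R d P \<longleftrightarrow> (\<forall>i\<le>d. primeideal (P i) R) \<and> (\<forall>i<d. P i \<subset> P (Suc i))"

definition has_krull_dim :: "('a, 'b) ring_scheme \<Rightarrow> nat \<Rightarrow> bool" where
  "has_krull_dim R d \<longleftrightarrow> (\<exists>P. prime_chain R d P) \<and> (\<forall>e P. prime_chain R e P \<longrightarrow> e \<le> d)"

definition even_ring :: "('k, 'a) superalg \<Rightarrow> 'a ring" where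
  "even_ring A = \<lparr>carrier = even_part A, monoid.mult = monoid.mult A, one = one A, zero = zero A, add = add A\<rparr>"

text \<open>
  The Krull superdimension of Masuoka and Zubkov.  The even dimension is the Krull dimension of the
  even part \<open>A\<^sub>0\<close>; equivalently, of the quotient by the ideal generated by the odd elements,
  which is nilpotent for superalgebras of finite type.  Odd elements \<open>y\<^sub>1, ..., y\<^sub>l\<close> form a system of
  odd parameters if the quotient of \<open>A\<^sub>0\<close> by the annihilator of \<open>y\<^sub>1 ... y\<^sub>l\<close> in \<open>A\<^sub>0\<close> has the same
  Krull dimension as \<open>A\<^sub>0\<close>, and the odd dimension is the maximal length of such a system.
\<close>

definition even_annihilator :: "('k, 'a) superalg \<Rightarrow> 'a \<Rightarrow> 'a set" where
  "even_annihilator A y = {x \<in> even_part A. x \<otimes>\<^bsub>A\<^esub> y = \<zero>\<^bsub>A\<^esub>}"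

definition odd_parameters :: "('k, 'a) superalg \<Rightarrow> nat \<Rightarrow> 'a list \<Rightarrow> bool" where
  "odd_parameters A p ys \<longleftrightarrow> set ys \<subseteq> odd_part A
      \<and> has_krull_dim (even_ring A Quot even_annihilator A (foldr (monoid.mult A) ys \<one>\<^bsub>A\<^esub>)) p"

definition has_superdim :: "('k, 'a) superalg \<Rightarrow> nat \<Rightarrow> nat \<Rightarrow> bool" where
  "has_superdim A p q \<longleftrightarrow> has_krull_dim (even_ring A) p
      \<and> (\<exists>ys. odd_parameters A p ys \<and> length ys = q)
      \<and> (\<forall>ys. odd_parameters A p ys \<longrightarrow> length ys \<le> q)"


section \<open>Supersymmetric Hill's equations\<close>

text \<open>
  Solutions with values in a superalgebra \<open>R\<close>; no parity is imposed on \<open>V\<close> and \<open>W\<close>, so that all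
  initial values in \<open>R\<close> are allowed.
\<close>

definition sturm_liouville_solution ::
  "('k, 'r) superalg \<Rightarrow> (int \<Rightarrow> 'r) \<Rightarrow> (int \<Rightarrow> 'r) \<Rightarrow> (int \<Rightarrow> 'r) \<Rightarrow> (int \<Rightarrow> 'r) \<Rightarrow> bool" where
  "sturm_liouville_solution R a b V W \<longleftrightarrow> range V \<subseteq> carrier R \<and> range W \<subseteq> carrier R
    \<and> (\<forall>i. V i = a i \<otimes>\<^bsub>R\<^esub> V (i - 1) \<ominus>\<^bsub>R\<^esub> V (i - 2) \<ominus>\<^bsub>R\<^esub> b i \<otimes>\<^bsub>R\<^esub> W (i - 1)
         \<and> W i = W (i - 1) \<oplus>\<^bsub>R\<^esub> b i \<otimes>\<^bsub>R\<^esub> V (i - 1))"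

definition hill_equations :: "nat \<Rightarrow> ('k, 'r) superalg \<Rightarrow> ((int \<Rightarrow> 'r) \<times> (int \<Rightarrow> 'r)) set" where
  "hill_equations n R = {(a, b). range a \<subseteq> even_part R \<and> range b \<subseteq> odd_part R
    \<and> (\<forall>i. a (i + int n) = a i \<and> b (i + int n) = \<ominus>\<^bsub>R\<^esub> b i)
    \<and> (\<forall>V W. sturm_liouville_solution R a b V W \<longrightarrow>
         (\<forall>i. V (i + int n) = \<ominus>\<^bsub>R\<^esub> V i \<and> W (i + int n) = W i))}"

definition step_matrix :: "'r::ring_1 \<Rightarrow> 'r \<Rightarrow> 'r ^ 3 ^ 3" where
  "step_matrix a b = vector [vector [0, 1, 0], vector [-1, a, -b], vector [0, b, 1]]"

text \<open>The product \<open>A\<^bsub>i+m-1\<^esub> ... A\<^bsub>i+1\<^esub> A\<^bsub>i\<^esub>\<close>.\<close>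

primrec monodromy :: "(int \<Rightarrow> 'r::ring_1) \<Rightarrow> (int \<Rightarrow> 'r) \<Rightarrow> int \<Rightarrow> nat \<Rightarrow> 'r ^ 3 ^ 3" where
  "monodromy a b i 0 = mat 1"
| "monodromy a b i (Suc m) = step_matrix (a (i + int m)) (b (i + int m)) ** monodromy a b i m"

definition hill_monodromy :: "'r::ring_1 ^ 3 ^ 3" where
  "hill_monodromy = vector [vector [-1, 0, 0], vector [0, -1, 0], vector [0, 0, 1]]"

text \<open>
  The variables \<open>a\<^sub>1, ..., a\<^sub>n\<close> and \<open>\<beta>\<^sub>1, ..., \<beta>\<^sub>n\<close>, extended to all integer indices by
  \<open>a\<^bsub>i+n\<^esub> = a\<^sub>i\<close> and \<open>\<beta>\<^bsub>i+n\<^esub> = - \<beta>\<^sub>i\<close>.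
\<close>

definition hill_a :: "nat \<Rightarrow> int \<Rightarrow> 'k::comm_ring_1 superpoly" where
  "hill_a n i = even_var (nat (1 + (i - 1) mod int n))"

definition hill_b :: "nat \<Rightarrow> int \<Rightarrow> 'k::comm_ring_1 superpoly" where
  "hill_b n i = (if even ((i - 1) div int n) then 1 else -1) * odd_var (nat (1 + (i - 1) mod int n))"

definition hill_ideal :: "nat \<Rightarrow> 'k::comm_ring_1 superpoly set" where
  "hill_ideal n = Idl\<^bsub>affine_superspace n\<^esub>
     {(monodromy (hill_a n) (hill_b n) i n - hill_monodromy) $ r $ s | i r s. True}"

definition hill_superalg :: "nat \<Rightarrow> ('k::comm_ring_1, 'k superpoly set) superalg" where
  "hill_superalg n = quotient_superalg (affine_superspace n) (hill_ideal n)"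

text \<open>
  An \<open>R\<close>-point of the supervariety, i.e. a morphism from its coordinate superalgebra to \<open>R\<close>, gives
  the potential consisting of the images of the coordinates.
\<close>

definition hill_potential ::
  "nat \<Rightarrow> ('k::comm_ring_1 superpoly set \<Rightarrow> 'r) \<Rightarrow> (int \<Rightarrow> 'r) \<times> (int \<Rightarrow> 'r)" where
  "hill_potential n \<phi> =
     (\<lambda>i. \<phi> (hill_ideal n +>\<^bsub>affine_superspace n\<^esub> hill_a n i),
      \<lambda>i. \<phi> (hill_ideal n +>\<^bsub>affine_superspace n\<^esub> hill_b n i))"

end

theory Submission
  imports Defs "HOL-Computational_Algebra.Polynomial"
begin

text \<open>
  Put \<open>m = n - 2\<close>. The matrices \<open>A\<^sub>i\<close> are orthosymplectic, so the entries of
  \<open>C = A\<^sub>m ... A\<^sub>1\<close> satisfy the relations of \<open>OSp(1|2)\<close>. The condition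
  \<open>A\<^sub>n A\<^bsub>n-1\<^esub> C = diag(-1, -1, 1)\<close> therefore means that \<open>C\<^sub>2\<^sub>2 = 1\<close> and that
  \<open>a\<^bsub>n-1\<^esub>, a\<^sub>n, \<beta>\<^bsub>n-1\<^esub>, \<beta>\<^sub>n\<close> are, up to sign, the entries
  \<open>C\<^sub>1\<^sub>2, C\<^sub>2\<^sub>1, C\<^sub>3\<^sub>2, C\<^sub>2\<^sub>3\<close>: the supervariety is the hypersurface \<open>C\<^sub>2\<^sub>2 = 1\<close> in the affine
  superspace of dimension \<open>m|m\<close>. Since \<open>C\<^sub>2\<^sub>2\<close> is linear in \<open>a\<^sub>m\<close>, its points over a Grassmann
  algebra over the ground field are parametrized by \<open>a\<^sub>1, ..., a\<^bsub>m-1\<^esub>, \<beta>\<^sub>1, ..., \<beta>\<^sub>m\<close> wherever a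
  continuant does not vanish. These points give a chain of \<open>m\<close> primes of the even part and show
  that the annihilator of \<open>\<beta>\<^sub>1 ... \<beta>\<^sub>m\<close> lies in the smallest of them. Longer chains of primes are excluded
  because \<open>m + 1\<close> polynomials in \<open>m\<close> variables are algebraically dependent, and longer products of
  odd elements vanish.
\<close>

section \<open>The Grassmann algebra\<close>

text \<open>The equation \<open>C\<^sub>2\<^sub>2 = 1\<close> costs one of the \<open>m\<close> even
  parameters, whereas all \<open>m\<close> odd ones survive. The odd count shapes the proof: a point
  with values in the ground field sends every odd element to zero and cannot see the annihilator of
  \<open>\<beta>\<^sub>1 ... \<beta>\<^sub>m\<close>. At a Grassmann-valued point that sends each
  \<open>\<beta>\<^sub>i\<close> to a generator of its own, the coefficient of the product of these
  generators in the value of \<open>f \<beta>\<^sub>1 ... \<beta>\<^sub>m\<close> is the body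
  (constant term) of the value of \<open>f\<close>; so an annihilator has body zero at every such
  point. The smallest prime consists of the even elements whose body vanishes at all these points.
  Irreducibility of the hypersurface is not established; primality comes from restricting to lines
  in parameter space. The larger primes prescribe \<open>a\<^sub>1 = 2\<close>,
  \<open>a\<^sub>2 = 2\<close> and so on: continuants of integers at least 2 are positive, which
  keeps the points defined. The defining ideal imposes the condition at every starting index. One
  index suffices for points, since antiperiodicity of \<open>\<beta>\<close> amounts to conjugating
  the step matrix by \<open>diag(-1, -1, 1)\<close>.\<close>

lemma gcoeff_eqI: "(\<And>S. gcoeff f S = gcoeff g S) \<Longrightarrow> f = g"
  by (metis gcoeff_inject ext)

lemma finite_gcoeff: "gcoeff f S \<noteq> 0 \<Longrightarrow> finite S"
  using gcoeff[of f] by blast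

lemma finite_gcoeff_support: "finite {S. gcoeff f S \<noteq> 0}"
  using gcoeff[of f] by blast

lemma gcoeff_zero [simp]: "gcoeff 0 S = 0"
  and gcoeff_one: "gcoeff 1 S = (if S = {} then 1 else 0)"
  and gcoeff_add [simp]: "gcoeff (f + g) S = gcoeff f S + gcoeff g S"
  and gcoeff_diff [simp]: "gcoeff (f - g) S = gcoeff f S - gcoeff g S"
  and gcoeff_uminus [simp]: "gcoeff (- f) S = - gcoeff f S"
  for f g :: "'c::comm_ring_1 grassmann"
  by (simp_all add: zero_grassmann.rep_eq one_grassmann.rep_eq plus_grassmann.rep_eq
      minus_grassmann.rep_eq uminus_grassmann.rep_eq)

lemma gcoeff_sum: "gcoeff (\<Sum>i\<in>I. f i) S = (\<Sum>i\<in>I. gcoeff (f i :: 'c::comm_ring_1 grassmann) S)"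
  by (induction I rule: infinite_finite_induct) auto

lemma gcoeff_times:
  "gcoeff (f * g) S = (\<Sum>T\<in>Pow S. shuffle_sign T (S - T) * gcoeff f T * gcoeff g (S - T))"
  by (simp add: times_grassmann.rep_eq)

lemma gcoeff_times_nonzero:
  assumes "gcoeff (f * g) S \<noteq> 0"
  obtains T where "T \<subseteq> S" "gcoeff f T \<noteq> 0" "gcoeff g (S - T) \<noteq> 0" "finite S"
proof -
  have "\<exists>T\<in>Pow S. shuffle_sign T (S - T) * gcoeff f T * gcoeff g (S - T) \<noteq> 0"
    using assms unfolding gcoeff_times by (meson sum.neutral)
  then obtain T where "T \<subseteq> S" "shuffle_sign T (S - T) * gcoeff f T * gcoeff g (S - T) \<noteq> 0"
    by blast
  with that finite_gcoeff[OF assms] show ?thesis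
    by (metis mult_zero_left mult_zero_right)
qed

lemma gcoeff_times_empty [simp]: "gcoeff (f * g) {} = gcoeff f {} * gcoeff g {}"
  by (simp add: gcoeff_times)

lemma gcoeff_power_empty [simp]: "gcoeff (f ^ k) {} = gcoeff f {} ^ k"
  by (induction k) (simp_all add: gcoeff_one)

lemma gcoeff_gconst_times: "gcoeff (gconst c * f) S = c * gcoeff f S"
proof (cases "finite S")
  case True
  have "gcoeff (gconst c * f) S
      = (\<Sum>T\<in>{{}}. shuffle_sign T (S - T) * gcoeff (gconst c) T * gcoeff f (S - T))"
    unfolding gcoeff_times by (rule sum.mono_neutral_right) (use True in \<open>auto simp: gconst.rep_eq\<close>)
  then show ?thesis by (simp add: gconst.rep_eq)
next
  case False
  then show ?thesis by (metis finite_gcoeff mult_zero_right)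
qed

lemma gconst_add: "gconst (c + d) = gconst c + (gconst d :: 'c::comm_ring_1 grassmann)"
  and gconst_mult: "gconst (c * d) = gconst c * (gconst d :: 'c::comm_ring_1 grassmann)"
  and gconst_0 [simp]: "gconst 0 = (0 :: 'c::comm_ring_1 grassmann)"
  and gconst_1 [simp]: "gconst 1 = (1 :: 'c::comm_ring_1 grassmann)"
  by (auto intro!: gcoeff_eqI simp: gcoeff_gconst_times gcoeff_one gconst.rep_eq)

text \<open>An infinite set indexes no monomial; the guard \<open>finite S\<close> makes the value
  zero there.\<close>

lift_definition gmono :: "nat set \<Rightarrow> 'c \<Rightarrow> 'c::zero grassmann"
  is "\<lambda>S c T. if T = S \<and> finite S then c else 0"
  by (auto intro: finite_subset[of _ "{_}"])

lemma gmono_empty: "gmono {} c = gconst c"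
  by (rule gcoeff_eqI) (auto simp: gmono.rep_eq gconst.rep_eq)

lemma gmono_singleton: "gmono {i} 1 = gvar i"
  by (rule gcoeff_eqI) (auto simp: gmono.rep_eq gvar.rep_eq)

lemma gmono_times:
  assumes "finite S" "finite T"
  shows "gmono S c * gmono T d
    = (if S \<inter> T = {} then gmono (S \<union> T) (shuffle_sign S T * c * d) else 0)"
proof (rule gcoeff_eqI)
  fix U
  show "gcoeff (gmono S c * gmono T d) U
    = gcoeff (if S \<inter> T = {} then gmono (S \<union> T) (shuffle_sign S T * c * d) else 0) U"
  proof (cases "S \<inter> T = {} \<and> U = S \<union> T")
    case True
    have "gcoeff (gmono S c * gmono T d) U
      = (\<Sum>V\<in>{S}. shuffle_sign V (U - V) * gcoeff (gmono S c) V * gcoeff (gmono T d) (U - V))"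
      unfolding gcoeff_times
      by (rule sum.mono_neutral_right) (use True assms in \<open>auto simp: gmono.rep_eq\<close>)
    moreover have "U - S = T" using True by auto
    ultimately show ?thesis using True assms by (simp add: gmono.rep_eq)
  next
    case False
    have "gcoeff (gmono S c * gmono T d) U = 0"
      unfolding gcoeff_times by (rule sum.neutral) (use False assms in \<open>auto simp: gmono.rep_eq\<close>)
    then show ?thesis using False by (auto simp: gmono.rep_eq)
  qed
qed

lemma grassmann_expansion:
  "f = (\<Sum>S | gcoeff f S \<noteq> 0. gmono S (gcoeff f S))" for f :: "'c::comm_ring_1 grassmann"
proof (rule gcoeff_eqI)
  fix S
  have "gcoeff (\<Sum>S | gcoeff f S \<noteq> 0. gmono S (gcoeff f S)) S
      = (\<Sum>T | gcoeff f T \<noteq> 0. if T = S then gcoeff f S else 0)"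
    unfolding gcoeff_sum by (rule sum.cong) (auto simp: gmono.rep_eq dest: finite_gcoeff)
  then show "gcoeff f S = gcoeff (\<Sum>S | gcoeff f S \<noteq> 0. gmono S (gcoeff f S)) S"
    by (simp add: finite_gcoeff_support)
qed

text \<open>A pair in \<open>S \<times> T\<close> is an inversion for exactly one of the two orders
  of the factors, so the two exponents add up to \<open>card S * card T\<close>.\<close>

lemma shuffle_sign_swap:
  assumes "finite S" "finite T" "S \<inter> T = {}"
  shows "shuffle_sign S T = (-1) ^ (card S * card T) * (shuffle_sign T S :: 'c::comm_ring_1)"
proof -
  let ?A = "{(i, j). i \<in> S \<and> j \<in> T \<and> j < i}" and ?B = "{(i, j). i \<in> T \<and> j \<in> S \<and> j < i}"
  let ?B' = "{(i, j). i \<in> S \<and> j \<in> T \<and> i < j}"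
  have fin: "finite ?A" "finite ?B'"
    by (rule finite_subset[of _ "S \<times> T"]; use assms in auto)+
  have "S \<times> T = ?A \<union> ?B'" using assms(3) by (auto simp: neq_iff)
  then have "card S * card T = card (?A \<union> ?B')" by (metis card_cartesian_product)
  also have "\<dots> = card ?A + card ?B'" by (rule card_Un_disjoint) (use fin in auto)
  also have "card ?B' = card ?B"
    by (rule bij_betw_same_card[of "\<lambda>(i, j). (j, i)"], rule bij_betwI[of _ _ _ "\<lambda>(i, j). (j, i)"]) auto
  finally have *: "card S * card T = card ?A + card ?B" .
  have "(-1) ^ card ?B * (-1) ^ card ?B = (1 :: 'c)"
    by (simp flip: power_mult_distrib)
  then show ?thesis
    unfolding shuffle_sign_def * power_add by (simp add: mult.assoc)
qed

text \<open>Parity is coded by a truth value, \<open>True\<close> for even, so that the parity of a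
  product is the equation \<open>e = e'\<close> and one statement covers all combinations.\<close>

definition grassmann_part :: "bool \<Rightarrow> 'c::comm_ring_1 grassmann set" where
  "grassmann_part e = {f. \<forall>S. gcoeff f S \<noteq> 0 \<longrightarrow> even (card S) = e}"

lemma grassmann_part_times:
  assumes "f \<in> grassmann_part e" "g \<in> grassmann_part e'"
  shows "f * g \<in> grassmann_part (e = e')"
proof -
  have "even (card S) = (e = e')" if "gcoeff (f * g) S \<noteq> 0" for S
    using that
  proof (rule gcoeff_times_nonzero)
  fix T assume T: "T \<subseteq> S" "gcoeff f T \<noteq> 0" "gcoeff g (S - T) \<noteq> 0" "finite S"
  have "card S = card T + card (S - T)"
    using T by (metis Diff_disjoint Un_Diff_cancel card_Un_disjoint finite_Diff finite_subset sup.absorb2)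
  moreover have "even (card T) = e" "even (card (S - T)) = e'"
    using T assms by (auto simp: grassmann_part_def)
  ultimately show "even (card S) = (e = e')"
    by auto
  qed
  then show ?thesis by (auto simp: grassmann_part_def)
qed

lemma grassmann_part_commute:
  assumes "f \<in> grassmann_part e" "g \<in> grassmann_part e'"
  shows "f * g = (if e \<or> e' then g * f else - (g * f))"
proof (rule gcoeff_eqI)
  fix S
  let ?s = "if e \<or> e' then 1 else -1 :: 'a"
  have "gcoeff (f * g) S = ?s * gcoeff (g * f) S"
  proof (cases "finite S")
    case True
    have "gcoeff (f * g) S
      = (\<Sum>T\<in>Pow S. shuffle_sign T (S - T) * gcoeff f T * gcoeff g (S - T))"
      by (rule gcoeff_times)
    also have "\<dots> = (\<Sum>T\<in>Pow S. ?s * (shuffle_sign T (S - T) * gcoeff g T * gcoeff f (S - T)))"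
    proof (rule sum.reindex_bij_witness[where i = "\<lambda>T. S - T" and j = "\<lambda>T. S - T"])
      fix T assume T: "T \<in> Pow S"
      have eq: "S - (S - T) = T" using T by auto
      show "?s * (shuffle_sign (S - T) (S - (S - T)) * gcoeff g (S - T) * gcoeff f (S - (S - T)))
        = shuffle_sign T (S - T) * gcoeff f T * gcoeff g (S - T)"
      proof (cases "gcoeff f T = 0 \<or> gcoeff g (S - T) = 0")
        case False
        then have "even (card T) = e" "even (card (S - T)) = e'"
          using assms by (auto simp: grassmann_part_def)
        then have "(-1) ^ (card T * card (S - T)) = ?s" by auto
        then show ?thesis
          using shuffle_sign_swap[of T "S - T", where 'c = 'a] True T
          by (auto simp: eq mult_ac dest: finite_subset)
      qed (auto simp: eq)
    qed auto
    finally show ?thesis by (simp add: gcoeff_times sum_distrib_left)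
  next
    case False
    then show ?thesis by (metis finite_gcoeff mult_zero_right)
  qed
  then show "gcoeff (f * g) S = gcoeff (if e \<or> e' then g * f else - (g * f)) S"
    by simp
qed

text \<open>Anticommuting \<open>u\<close> with itself gives \<open>u * u = - (u * u)\<close>, which
  forces zero in characteristic zero. The second form is meant for rewriting right-nested
  products.\<close>

lemma odd_square_zero:
  fixes u w :: "'c::{idom, ring_char_0} grassmann"
  assumes "u \<in> grassmann_part False"
  shows "u * u = 0" "u * (u * w) = 0"
proof -
  show "u * u = 0"
  proof (rule gcoeff_eqI)
    fix S
    have "gcoeff (u * u) S = - gcoeff (u * u) S"
      using grassmann_part_commute[OF assms assms] by (metis gcoeff_uminus)
    then show "gcoeff (u * u) S = gcoeff 0 S" by simp
  qed
  then show "u * (u * w) = 0" by (simp flip: mult.assoc)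
qed

lemma grassmann_part_0 [simp]: "0 \<in> grassmann_part e"
  and grassmann_part_uminus: "f \<in> grassmann_part e \<Longrightarrow> - f \<in> grassmann_part e"
  by (simp_all add: grassmann_part_def)

lemma grassmann_part_add:
  assumes "f \<in> grassmann_part e" "g \<in> grassmann_part e"
  shows "f + g \<in> grassmann_part e"
  using assms unfolding grassmann_part_def by (auto, force+)

lemma grassmann_part_diff:
  "f \<in> grassmann_part e \<Longrightarrow> g \<in> grassmann_part e \<Longrightarrow> f - g \<in> grassmann_part e"
  using grassmann_part_add[of f e "- g"] grassmann_part_uminus[of g e] by simp

lemma gconst_even: "gconst c \<in> grassmann_part True"
  by (simp add: grassmann_part_def gconst.rep_eq)

lemma one_even: "1 \<in> grassmann_part True"
  by (simp add: grassmann_part_def gcoeff_one)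

lemma gvar_odd: "gvar i \<in> grassmann_part False"
  by (simp add: grassmann_part_def gvar.rep_eq)

lemma gconst_commute: "gconst c * f = f * gconst c"
proof (rule gcoeff_eqI)
  fix S
  have "gcoeff (f * gconst c) S = c * gcoeff f S"
  proof (cases "finite S")
    case True
    have "gcoeff (f * gconst c) S
        = (\<Sum>T\<in>{S}. shuffle_sign T (S - T) * gcoeff f T * gcoeff (gconst c) (S - T))"
      unfolding gcoeff_times by (rule sum.mono_neutral_right) (use True in \<open>auto simp: gconst.rep_eq\<close>)
    then show ?thesis by (simp add: gconst.rep_eq)
  next
    case False
    then show ?thesis by (metis finite_gcoeff mult_zero_right)
  qed
  then show "gcoeff (gconst c * f) S = gcoeff (f * gconst c) S"
    by (simp add: gcoeff_gconst_times)
qed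

section \<open>Decomposition into parity components\<close>

lift_definition parity_proj :: "bool \<Rightarrow> 'c grassmann \<Rightarrow> 'c::zero grassmann"
  is "\<lambda>e f S. if even (card S) = e then f S else 0"
  by (auto elim: rev_finite_subset)

lemma parity_proj_part: "parity_proj e f \<in> grassmann_part e"
  by (auto simp: grassmann_part_def parity_proj.rep_eq)

lemma parity_proj_sum: "parity_proj True f + parity_proj False f = f"
  by (rule gcoeff_eqI) (simp add: parity_proj.rep_eq)

lemma parity_proj_add: "parity_proj e (f + g) = parity_proj e f + parity_proj e g"
  for f g :: "'c::comm_ring_1 grassmann"
  by (rule gcoeff_eqI) (simp add: parity_proj.rep_eq)

lemma parity_proj_uminus: "parity_proj e (- f) = - parity_proj e f"
  for f :: "'c::comm_ring_1 grassmann"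
  by (rule gcoeff_eqI) (simp add: parity_proj.rep_eq)

lemma parity_proj_same: "f \<in> grassmann_part e \<Longrightarrow> parity_proj e f = f"
  by (rule gcoeff_eqI) (auto simp: parity_proj.rep_eq grassmann_part_def)

lemma parity_proj_other: "f \<in> grassmann_part e' \<Longrightarrow> e' \<noteq> e \<Longrightarrow> parity_proj e f = 0"
  by (rule gcoeff_eqI) (auto simp: parity_proj.rep_eq grassmann_part_def)

lemma parity_proj_times:
  "parity_proj e (f * g)
    = parity_proj True f * parity_proj e g + parity_proj False f * parity_proj (\<not> e) g"
  for f g :: "'c::comm_ring_1 grassmann"
proof -
  let ?p = "parity_proj"
  have "?p e (f * g) = ?p e ((?p True f + ?p False f) * (?p e g + ?p (\<not> e) g))"
    using parity_proj_sum[of f] parity_proj_sum[of g] by (cases e) (simp_all add: add.commute)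
  also have "\<dots> = ?p e (?p True f * ?p e g) + ?p e (?p False f * ?p e g)
      + (?p e (?p True f * ?p (\<not> e) g) + ?p e (?p False f * ?p (\<not> e) g))"
    by (simp add: algebra_simps parity_proj_add)
  also have "?p e (?p True f * ?p e g) = ?p True f * ?p e g"
    using grassmann_part_times[OF parity_proj_part parity_proj_part, of True f e g]
    by (intro parity_proj_same) simp
  also have "?p e (?p False f * ?p e g) = 0"
    using grassmann_part_times[OF parity_proj_part parity_proj_part, of False f e g]
    by (intro parity_proj_other[of _ "\<not> e"]) auto
  also have "?p e (?p True f * ?p (\<not> e) g) = 0"
    using grassmann_part_times[OF parity_proj_part parity_proj_part, of True f "\<not> e" g]
    by (intro parity_proj_other[of _ "\<not> e"]) auto
  also have "?p e (?p False f * ?p (\<not> e) g) = ?p False f * ?p (\<not> e) g"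
    using grassmann_part_times[OF parity_proj_part parity_proj_part, of False f "\<not> e" g]
    by (intro parity_proj_same) simp
  finally show ?thesis by simp
qed

section \<open>Nilpotent and invertible elements\<close>

lemma gcoeff_power_nonzero_card:
  fixes f :: "'c::comm_ring_1 grassmann"
  assumes "gcoeff f {} = 0" "gcoeff (f ^ k) S \<noteq> 0"
  shows "k \<le> card S \<and> S \<subseteq> \<Union>{S. gcoeff f S \<noteq> 0}"
  using assms(2)
proof (induction k arbitrary: S)
  case 0
  then show ?case by (simp add: gcoeff_one split: if_splits)
next
  case (Suc k)
  then obtain T where T: "T \<subseteq> S" "gcoeff f T \<noteq> 0" "gcoeff (f ^ k) (S - T) \<noteq> 0" "finite S"
    by (metis gcoeff_times_nonzero power_Suc)
  then have "T \<noteq> {}" using assms(1) by auto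
  then have "card T \<ge> 1"
    by (metis T(1,4) One_nat_def Suc_leI card_gt_0_iff finite_subset)
  moreover have "card S = card T + card (S - T)"
    using T by (metis Diff_disjoint Un_Diff_cancel card_Un_disjoint finite_Diff finite_subset sup.absorb2)
  ultimately show ?case using Suc.IH[OF T(3)] T by auto
qed

text \<open>A factor without body uses up at least one generator, and only the finitely many
  generators occurring in \<open>f\<close> are available. One factor more than there are generators
  gives zero.\<close>

lemma grassmann_nilpotent:
  fixes f :: "'c::comm_ring_1 grassmann"
  assumes "gcoeff f {} = 0"
  obtains k where "f ^ k = 0"
proof -
  let ?U = "\<Union>{S. gcoeff f S \<noteq> 0}"
  have "finite ?U" using finite_gcoeff_support finite_gcoeff by auto
  then have "f ^ Suc (card ?U) = 0"
    using gcoeff_power_nonzero_card[OF assms, of "Suc (card ?U)"]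
    by (intro gcoeff_eqI) (metis card_mono gcoeff_zero not_less_eq_eq)
  with that show ?thesis by blast
qed

text \<open>Once the body is scaled to 1, the element is \<open>1 - h\<close> with \<open>h\<close>
  nilpotent, and the geometric series for its inverse is finite.\<close>

lemma grassmann_even_inverse:
  fixes f :: "'c::field grassmann"
  assumes "f \<in> grassmann_part True" "gcoeff f {} \<noteq> 0"
  obtains g where "g \<in> grassmann_part True" "f * g = 1"
proof -
  define c where "c = inverse (gcoeff f {})"
  define h where "h = 1 - gconst c * f"
  have "gcoeff h {} = 0" using assms(2) by (simp add: h_def c_def gconst.rep_eq gcoeff_one)
  then obtain k where k: "h ^ k = 0" using grassmann_nilpotent by blast
  have h: "h \<in> grassmann_part True"
    unfolding h_def
    using grassmann_part_times[OF gconst_even assms(1)] by (simp add: grassmann_part_diff one_even)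
  have pow: "h ^ j \<in> grassmann_part True" for j
  proof (induction j)
    case (Suc j)
    then show ?case using grassmann_part_times[OF h, of "h ^ j" True] by simp
  qed (simp add: one_even)
  have sum: "(\<Sum>j<k. h ^ j) \<in> grassmann_part True"
    by (induction k) (auto intro: grassmann_part_add pow)
  have "(1 - h) * (\<Sum>j<k. h ^ j) = 1 - h ^ k"
  proof (induction k)
    case (Suc k)
    have "(1 - h) * (\<Sum>j<Suc k. h ^ j) = (1 - h) * (\<Sum>j<k. h ^ j) + (1 - h) * h ^ k"
      by (simp add: distrib_left)
    also have "\<dots> = 1 - h ^ k + (h ^ k - h * h ^ k)"
      using Suc by (simp only: left_diff_distrib mult_1_left)
    finally show ?case by simp
  qed simp
  then have "f * (gconst c * (\<Sum>j<k. h ^ j)) = 1"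
    using k by (simp add: h_def gconst_commute mult.assoc)
  moreover have "gconst c * (\<Sum>j<k. h ^ j) \<in> grassmann_part True"
    using grassmann_part_times[OF gconst_even sum] by simp
  ultimately show ?thesis using that by blast
qed


section \<open>Superpolynomials in a set of variables\<close>

definition polys_in :: "nat set \<Rightarrow> ((nat \<Rightarrow>\<^sub>0 nat) \<Rightarrow>\<^sub>0 'k::zero) set" where
  "polys_in V = {p. \<forall>m\<in>Poly_Mapping.keys p. Poly_Mapping.keys m \<subseteq> V}"

lemma polys_in_0 [simp]: "0 \<in> polys_in V"
  by (simp add: polys_in_def)

lemma polys_in_add: "p \<in> polys_in V \<Longrightarrow> q \<in> polys_in V \<Longrightarrow> p + q \<in> polys_in V"
  using Poly_Mapping.keys_add[of p q] by (auto simp: polys_in_def)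

lemma polys_in_uminus: "p \<in> polys_in V \<Longrightarrow> - p \<in> polys_in V" for p :: "_ \<Rightarrow>\<^sub>0 'k::comm_ring_1"
  by (auto simp: polys_in_def in_keys_iff)

lemma polys_in_diff: "p \<in> polys_in V \<Longrightarrow> q \<in> polys_in V \<Longrightarrow> p - q \<in> polys_in V"
  for p :: "_ \<Rightarrow>\<^sub>0 'k::comm_ring_1"
  using polys_in_add[of p V "- q"] polys_in_uminus[of q V] by simp

lemma polys_in_mult:
  assumes "p \<in> polys_in V" "q \<in> polys_in V"
  shows "p * q \<in> polys_in V"
  unfolding polys_in_def
proof safe
  fix m x assume "m \<in> Poly_Mapping.keys (p * q)" "x \<in> Poly_Mapping.keys m"
  then obtain a b where "m = a + b" "a \<in> Poly_Mapping.keys p" "b \<in> Poly_Mapping.keys q"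
    using keys_mult[of p q] by blast
  with \<open>x \<in> Poly_Mapping.keys m\<close> assms show "x \<in> V"
    using Poly_Mapping.keys_add[of a b] unfolding polys_in_def by blast
qed

lemma polys_in_single: "Poly_Mapping.keys m \<subseteq> V \<Longrightarrow> Poly_Mapping.single m c \<in> polys_in V"
  by (simp add: polys_in_def)

lemma polys_in_sum: "(\<And>i. i \<in> I \<Longrightarrow> f i \<in> polys_in V) \<Longrightarrow> (\<Sum>i\<in>I. f i) \<in> polys_in V"
  by (induction I rule: infinite_finite_induct) (auto intro: polys_in_add)

lemma polys_in_shuffle_sign: "shuffle_sign S T \<in> (polys_in V :: ((nat \<Rightarrow>\<^sub>0 nat) \<Rightarrow>\<^sub>0 'k::comm_ring_1) set)"
proof -
  have 1: "(1 :: (nat \<Rightarrow>\<^sub>0 nat) \<Rightarrow>\<^sub>0 'k) \<in> polys_in V" by (auto simp: polys_in_def)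
  have "(-1) ^ k \<in> (polys_in V :: ((nat \<Rightarrow>\<^sub>0 nat) \<Rightarrow>\<^sub>0 'k) set)" for k
    by (induction k) (auto intro: 1 polys_in_uminus)
  then show ?thesis by (simp add: shuffle_sign_def)
qed

text \<open>The index set is a parameter because three of them occur: \<open>{1..n}\<close> for the
  ambient superspace, \<open>{1..m}\<close> after the elimination, and all indices in the proof that
  evaluation is multiplicative.\<close>

definition superpolys_in :: "nat set \<Rightarrow> 'k::comm_ring_1 superpoly set" where
  "superpolys_in V = {f. \<forall>S. gcoeff f S \<noteq> 0 \<longrightarrow> S \<subseteq> V \<and> gcoeff f S \<in> polys_in V}"

lemma superpolys_in_gcoeff: "f \<in> superpolys_in V \<Longrightarrow> gcoeff f S \<in> polys_in V"
  by (cases "gcoeff f S = 0") (auto simp: superpolys_in_def)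

lemma superpolys_in_support: "f \<in> superpolys_in V \<Longrightarrow> gcoeff f S \<noteq> 0 \<Longrightarrow> S \<subseteq> V"
  by (auto simp: superpolys_in_def)

lemma superpolys_in_0 [simp]: "0 \<in> superpolys_in V"
  by (simp add: superpolys_in_def)

lemma superpolys_in_add:
  assumes "f \<in> superpolys_in V" "g \<in> superpolys_in V"
  shows "f + g \<in> superpolys_in V"
  unfolding superpolys_in_def
  using assms by (auto intro: polys_in_add superpolys_in_gcoeff)
    (metis add.right_neutral superpolys_in_support subsetD)

lemma superpolys_in_uminus: "f \<in> superpolys_in V \<Longrightarrow> - f \<in> superpolys_in V"
  by (auto simp: superpolys_in_def intro: polys_in_uminus)

lemma superpolys_in_diff: "f \<in> superpolys_in V \<Longrightarrow> g \<in> superpolys_in V \<Longrightarrow> f - g \<in> superpolys_in V"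
  using superpolys_in_add[of f V "- g"] superpolys_in_uminus[of g V] by simp

lemma superpolys_in_mult:
  assumes "f \<in> superpolys_in V" "g \<in> superpolys_in V"
  shows "f * g \<in> superpolys_in V"
  unfolding superpolys_in_def
proof safe
  fix S x assume "gcoeff (f * g) S \<noteq> 0" "x \<in> S"
  then show "x \<in> V"
    using assms by (elim gcoeff_times_nonzero) (metis Diff_iff subsetD superpolys_in_support)
next
  fix S show "gcoeff (f * g) S \<in> polys_in V"
    unfolding gcoeff_times
    by (intro polys_in_sum polys_in_mult superpolys_in_gcoeff polys_in_shuffle_sign assms)
qed

lemma superpolys_in_gmono: "S \<subseteq> V \<Longrightarrow> p \<in> polys_in V \<Longrightarrow> gmono S p \<in> superpolys_in V"
  by (auto simp: superpolys_in_def gmono.rep_eq split: if_splits)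

lemma superpolys_in_gconst: "p \<in> polys_in V \<Longrightarrow> gconst p \<in> superpolys_in V"
  using superpolys_in_gmono[of "{}" V p] by (simp add: gmono_empty)

lemma superpolys_in_scalar: "gconst (Poly_Mapping.single 0 c) \<in> superpolys_in V"
  by (intro superpolys_in_gconst polys_in_single) simp

lemma superpolys_in_1 [simp]: "1 \<in> superpolys_in V"
  using superpolys_in_scalar[of 1 V] by simp

lemma superpolys_in_even_var: "i \<in> V \<Longrightarrow> even_var i \<in> superpolys_in V"
  unfolding even_var_def by (intro superpolys_in_gconst polys_in_single) simp

lemma superpolys_in_odd_var: "i \<in> V \<Longrightarrow> odd_var i \<in> superpolys_in V"
  unfolding odd_var_def gmono_singleton[symmetric]
  by (intro superpolys_in_gmono) (auto simp: polys_in_def)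

lemma superpolys_in_parity_proj: "f \<in> superpolys_in V \<Longrightarrow> parity_proj e f \<in> superpolys_in V"
  by (auto simp: superpolys_in_def parity_proj.rep_eq split: if_splits)

lemma superpolys_in_mono: "V \<subseteq> W \<Longrightarrow> superpolys_in V \<subseteq> superpolys_in W"
  unfolding superpolys_in_def polys_in_def by blast

lemma poly_mapping_expansion:
  "p = (\<Sum>m\<in>Poly_Mapping.keys p. Poly_Mapping.single m (Poly_Mapping.lookup p m))"
  for p :: "'a \<Rightarrow>\<^sub>0 'b::comm_monoid_add"
proof (rule poly_mapping_eqI)
  fix m
  have "Poly_Mapping.lookup (\<Sum>m\<in>Poly_Mapping.keys p. Poly_Mapping.single m (Poly_Mapping.lookup p m)) m
    = (\<Sum>l\<in>Poly_Mapping.keys p. if l = m then Poly_Mapping.lookup p m else 0)"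
    unfolding Poly_Mapping.lookup_sum by (rule sum.cong) (auto simp: lookup_single when_def)
  then show "Poly_Mapping.lookup p m
    = Poly_Mapping.lookup (\<Sum>m\<in>Poly_Mapping.keys p. Poly_Mapping.single m (Poly_Mapping.lookup p m)) m"
    by (simp add: in_keys_iff)
qed

lemma gmono_add: "gmono S (c + d) = gmono S c + (gmono S d :: 'c::comm_ring_1 grassmann)"
  by (rule gcoeff_eqI) (auto simp: gmono.rep_eq)

lemma gmono_0 [simp]: "gmono S 0 = (0 :: 'c::comm_ring_1 grassmann)"
  by (rule gcoeff_eqI) (auto simp: gmono.rep_eq)

lemma gmono_sum: "gmono S (\<Sum>i\<in>I. c i) = (\<Sum>i\<in>I. gmono S (c i) :: 'c::comm_ring_1 grassmann)"
  by (induction I rule: infinite_finite_induct) (auto simp: gmono_add)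

lemma superpoly_induct [consumes 1, case_names zero gmono add]:
  assumes f: "f \<in> superpolys_in V"
    and zero: "P 0"
    and mono: "\<And>S m c. finite S \<Longrightarrow> S \<subseteq> V \<Longrightarrow> Poly_Mapping.keys m \<subseteq> V
        \<Longrightarrow> P (gmono S (Poly_Mapping.single m c))"
    and add: "\<And>g h. g \<in> superpolys_in V \<Longrightarrow> h \<in> superpolys_in V \<Longrightarrow> P g \<Longrightarrow> P h \<Longrightarrow> P (g + h)"
  shows "P f"
proof -
  let ?Q = "\<lambda>f. f \<in> superpolys_in V \<and> P f"
  have sum: "?Q (sum g I)" if "\<And>i. i \<in> I \<Longrightarrow> ?Q (g i)" for g :: "'b \<Rightarrow> 'a superpoly" and I
    using that
    by (induction I rule: infinite_finite_induct) (auto intro: zero add superpolys_in_add)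
  have "?Q (gmono S (gcoeff f S))" if "gcoeff f S \<noteq> 0" for S
  proof -
    have S: "finite S" "S \<subseteq> V" using that f by (auto dest: finite_gcoeff superpolys_in_support)
    have "?Q (gmono S (Poly_Mapping.single m (Poly_Mapping.lookup (gcoeff f S) m)))"
      if "m \<in> Poly_Mapping.keys (gcoeff f S)" for m
    proof -
      have "Poly_Mapping.keys m \<subseteq> V"
        using superpolys_in_gcoeff[OF f, of S] that by (auto simp: polys_in_def)
      then show ?thesis
        using S by (auto intro!: mono superpolys_in_gmono polys_in_single)
    qed
    then have "?Q (\<Sum>m\<in>Poly_Mapping.keys (gcoeff f S).
        gmono S (Poly_Mapping.single m (Poly_Mapping.lookup (gcoeff f S) m)))"
      by (rule sum)
    then show ?thesis
      by (simp flip: gmono_sum poly_mapping_expansion)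
  qed
  then have "?Q (\<Sum>S | gcoeff f S \<noteq> 0. gmono S (gcoeff f S))"
    by (intro sum) blast
  then show ?thesis
    using grassmann_expansion[of f] by simp
qed

lemma exponent_induct [case_names zero add]:
  fixes m :: "'a \<Rightarrow>\<^sub>0 nat"
  assumes zero: "P 0" and add: "\<And>m i. P m \<Longrightarrow> P (m + Poly_Mapping.single i 1)"
  shows "P m"
proof (induction m rule: update_induct)
  case const
  show ?case by (rule zero)
next
  case (update m i k)
  have "P (m + Poly_Mapping.single i j)" for j
  proof (induction j)
    case (Suc j)
    then show ?case using add[of "m + Poly_Mapping.single i j" i]
      by (simp add: add.assoc flip: single_add)
  qed (use update in simp)
  moreover have "Poly_Mapping.update i k m = m + Poly_Mapping.single i k"
    using update by (intro poly_mapping_eqI) (auto simp: lookup_update lookup_add lookup_single in_keys_iff when_def)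
  ultimately show ?case by simp
qed

text \<open>Reduces a claim about all superpolynomials to the scalars, the variables and closure
  under sums and products. Finite type, uniqueness of points, elimination of variables and
  rationality along lines are all proved in this way.\<close>

lemma superpoly_generated:
  assumes f: "f \<in> superpolys_in V"
    and scalar: "\<And>c. gconst (Poly_Mapping.single 0 c) \<in> Q"
    and vars: "\<And>i. i \<in> V \<Longrightarrow> even_var i \<in> Q" "\<And>i. i \<in> V \<Longrightarrow> odd_var i \<in> Q"
    and add: "\<And>g h. g \<in> Q \<Longrightarrow> h \<in> Q \<Longrightarrow> g + h \<in> Q"
    and mult: "\<And>g h. g \<in> Q \<Longrightarrow> h \<in> Q \<Longrightarrow> g * h \<in> Q"
  shows "f \<in> Q"
  using f
proof (induction rule: superpoly_induct)
  case zero
  show ?case using scalar[of 0] by simp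
next
  case (gmono S m c)
  have even: "gconst (Poly_Mapping.single m c) \<in> Q" if "Poly_Mapping.keys m \<subseteq> V" for m and c :: 'a
    using that
  proof (induction m rule: exponent_induct)
    case zero
    show ?case by (rule scalar)
  next
    case (add m i)
    have keys: "Poly_Mapping.keys (m + Poly_Mapping.single i 1) = insert i (Poly_Mapping.keys m)"
      by (auto simp: in_keys_iff lookup_add lookup_single when_def split: if_splits)
    have "Poly_Mapping.single (m + Poly_Mapping.single i 1) c
      = Poly_Mapping.single m c * Poly_Mapping.single (Poly_Mapping.single i 1) 1"
      by (simp add: mult_single)
    then show ?case
      using add keys mult[OF add.IH vars(1)[of i]] by (simp add: gconst_mult even_var_def)
  qed
  have odd: "gmono S 1 \<in> Q"
    using gmono(1,2)
  proof (induction S rule: finite_linorder_min_induct)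
    case empty
    then show ?case using scalar[of 1] by (simp add: gmono_empty)
  next
    case (insert i S)
    \<comment> \<open>The smallest index enters on the left, where it has to pass no other
      generator; hence no sign.\<close>
    then have "{(k, j). k \<in> {i} \<and> j \<in> S \<and> j < k} = {}" by auto
    then have "shuffle_sign {i} S = (1 :: (nat \<Rightarrow>\<^sub>0 nat) \<Rightarrow>\<^sub>0 'a)"
      unfolding shuffle_sign_def by (simp only: card.empty power_0)
    moreover have "i \<notin> S" using insert by auto
    ultimately have "odd_var i * gmono S 1 = (gmono (insert i S) 1 :: 'a superpoly)"
      using insert by (simp add: gmono_times odd_var_def flip: gmono_singleton)
    with insert vars(2)[of i] mult show ?case by (metis insert_subset)
  qed
  have "gconst (Poly_Mapping.single m c) * gmono S 1 = gmono S (Poly_Mapping.single m c)"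
    using gmono by (simp add: gmono_times flip: gmono_empty)
  then show ?case using even odd mult gmono by metis
next
  case (add g h)
  then show ?case using assms(5) by blast
qed


section \<open>Superalgebras of Grassmann type\<close>

text \<open>One construction for both superalgebras in play: the superpolynomials, with
  \<open>h\<close> giving the constant polynomials, and the Grassmann algebra over the ground field,
  in which points take their values.\<close>

definition grassmann_superalg ::
  "'c::comm_ring_1 grassmann set \<Rightarrow> ('k \<Rightarrow> 'c) \<Rightarrow> ('k, 'c grassmann) superalg" where
  "grassmann_superalg C h = \<lparr>carrier = C, monoid.mult = (*), one = 1, zero = 0, add = (+),
     even_part = C \<inter> grassmann_part True, odd_part = C \<inter> grassmann_part False,
     scalar = (\<lambda>c. gconst (h c))\<rparr>"

lemma grassmann_superalg_simps [simp]:
  "carrier (grassmann_superalg C h) = C"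
  "monoid.mult (grassmann_superalg C h) = (*)"
  "one (grassmann_superalg C h) = 1"
  "zero (grassmann_superalg C h) = 0"
  "add (grassmann_superalg C h) = (+)"
  "even_part (grassmann_superalg C h) = C \<inter> grassmann_part True"
  "odd_part (grassmann_superalg C h) = C \<inter> grassmann_part False"
  "scalar (grassmann_superalg C h) = (\<lambda>c. gconst (h c))"
  by (simp_all add: grassmann_superalg_def)

lemma affine_superspace_eq:
  "affine_superspace n = grassmann_superalg (superpolys_in {1..n}) (Poly_Mapping.single 0)"
  by (auto simp: affine_superspace_def grassmann_superalg_def superpolys_in_def polys_in_def
      grassmann_part_def Let_def)

text \<open>Closure under \<open>parity_proj\<close> is what makes \<open>C\<close> the sum of its
  even and odd elements.\<close>

locale grassmann_subalgebra =
  fixes C :: "'c::{idom, ring_char_0} grassmann set" and h :: "'k::field \<Rightarrow> 'c"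
  assumes add_closed: "f \<in> C \<Longrightarrow> g \<in> C \<Longrightarrow> f + g \<in> C"
    and uminus_closed: "f \<in> C \<Longrightarrow> - f \<in> C"
    and mult_closed: "f \<in> C \<Longrightarrow> g \<in> C \<Longrightarrow> f * g \<in> C"
    and proj_closed: "f \<in> C \<Longrightarrow> parity_proj e f \<in> C"
    and scalar_closed: "gconst (h c) \<in> C"
    and h_1: "h 1 = 1" and h_add: "h (c + d) = h c + h d" and h_mult: "h (c * d) = h c * h d"
begin

lemma h_0: "h 0 = 0"
  using h_add[of 0 0] by simp

lemma zero_mem: "0 \<in> C" and one_mem: "1 \<in> C"
  using scalar_closed[of 0] scalar_closed[of 1] by (simp_all add: h_0 h_1)

lemma ring_grassmann_superalg: "ring (grassmann_superalg C h)"
proof (rule ringI)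
  show "abelian_group (grassmann_superalg C h)"
    by (rule abelian_groupI)
      (auto intro: add_closed zero_mem uminus_closed simp: add.assoc add.commute
        intro: bexI[OF _ uminus_closed])
  show "Group.monoid (grassmann_superalg C h)"
    by (rule monoidI) (auto intro: one_mem mult_closed simp: mult.assoc)
qed (auto simp: distrib_right distrib_left)

lemma a_inv_grassmann_superalg: "f \<in> C \<Longrightarrow> \<ominus>\<^bsub>grassmann_superalg C h\<^esub> f = - f"
  using abelian_group.minus_equality[OF ring.is_abelian_group[OF ring_grassmann_superalg], of "- f" f]
  by (simp add: uminus_closed)

lemma supercommutative: "supercommutative_superalgebra (grassmann_superalg C h)"
proof -
  interpret ring "grassmann_superalg C h" by (rule ring_grassmann_superalg)
  have inv: "inv\<^bsub>add_monoid (grassmann_superalg C h)\<^esub> f = - f" if "f \<in> C" for f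
    using a_inv_grassmann_superalg[OF that] by (simp add: a_inv_def)
  have sub: "subgroup (C \<inter> grassmann_part e) (add_monoid (grassmann_superalg C h))" for e
    by (rule subgroup.intro)
      (auto simp: inv[simplified] zero_mem intro: add_closed uminus_closed grassmann_part_add grassmann_part_uminus)
  have sum: "C = (C \<inter> grassmann_part True) <+>\<^bsub>grassmann_superalg C h\<^esub> (C \<inter> grassmann_part False)"
  proof
    show "C \<subseteq> (C \<inter> grassmann_part True) <+>\<^bsub>grassmann_superalg C h\<^esub> (C \<inter> grassmann_part False)"
    proof
      fix f assume f: "f \<in> C"
      show "f \<in> (C \<inter> grassmann_part True) <+>\<^bsub>grassmann_superalg C h\<^esub> (C \<inter> grassmann_part False)"
        unfolding set_add_def'
        by (rule UN_I[of "parity_proj True f"], simp add: f parity_proj_part proj_closed,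
            rule UN_I[of "parity_proj False f"])
          (simp_all add: f parity_proj_part proj_closed parity_proj_sum)
    qed
  qed (auto simp: set_add_def' intro: add_closed)
  have inter: "f = 0" if "f \<in> grassmann_part True" "f \<in> grassmann_part False" for f :: "'c grassmann"
    using that by (intro gcoeff_eqI) (auto simp: grassmann_part_def)
  have comm: "f * g = g * f" if "f \<in> grassmann_part True" for f g :: "'c grassmann"
    using grassmann_part_commute[OF that parity_proj_part[of True g]]
      grassmann_part_commute[OF that parity_proj_part[of False g]]
    by (metis distrib_left distrib_right parity_proj_sum)
  note part = grassmann_part_times[of _ True _ True] grassmann_part_times[of _ True _ False]
    grassmann_part_times[of _ False _ False]
  show ?thesis
  proof (rule supercommutative_superalgebra.intro[OF ring_axioms],
      rule supercommutative_superalgebra_axioms.intro, unfold grassmann_superalg_simps)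
    show "f * g = \<ominus>\<^bsub>grassmann_superalg C h\<^esub> (g * f)"
      if "f \<in> C \<inter> grassmann_part False" "g \<in> C \<inter> grassmann_part False" for f g
      using that grassmann_part_commute[of f False g False]
      by (simp add: a_inv_grassmann_superalg mult_closed)
    show "f * g = g * f" if "f \<in> C \<inter> grassmann_part True" for f g
      using that comm by blast
    show "(C \<inter> grassmann_part True) \<inter> (C \<inter> grassmann_part False) = {0}"
      using inter zero_mem by auto
  qed (use sub[of True] sub[of False] sum part in \<open>auto simp: mult_closed gconst_add gconst_mult
      h_1 h_add h_mult scalar_closed gconst_even odd_square_zero\<close>)
qed

end

lemma grassmann_subalgebra_superpolys:
  "grassmann_subalgebra (superpolys_in V) (Poly_Mapping.single 0 :: 'k::field_char_0 \<Rightarrow> _)"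
  by unfold_locales
    (auto intro: superpolys_in_add superpolys_in_uminus superpolys_in_mult superpolys_in_parity_proj
      superpolys_in_scalar simp: single_add mult_single)

lemma grassmann_subalgebra_UNIV: "grassmann_subalgebra UNIV (\<lambda>c::'k::field_char_0. c)"
  by unfold_locales auto

lemma affine_superspace_supercommutative:
  "supercommutative_superalgebra (affine_superspace n :: ('k::field_char_0, 'k superpoly) superalg)"
  unfolding affine_superspace_eq
  by (rule grassmann_subalgebra.supercommutative[OF grassmann_subalgebra_superpolys])

lemma affine_superspace_simps [simp]:
  "carrier (affine_superspace n) = superpolys_in {1..n}"
  "monoid.mult (affine_superspace n) = (*)"
  "one (affine_superspace n) = 1"
  "zero (affine_superspace n) = 0"
  "add (affine_superspace n) = (+)"
  "even_part (affine_superspace n) = superpolys_in {1..n} \<inter> grassmann_part True"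
  "odd_part (affine_superspace n) = superpolys_in {1..n} \<inter> grassmann_part False"
  "scalar (affine_superspace n) = (\<lambda>c. gconst (Poly_Mapping.single 0 c))"
  by (simp_all add: affine_superspace_eq)

lemma a_inv_affine_superspace:
  "f \<in> superpolys_in {1..n} \<Longrightarrow> \<ominus>\<^bsub>affine_superspace n\<^esub> f = - (f :: 'k::field_char_0 superpoly)"
  unfolding affine_superspace_eq
  by (rule grassmann_subalgebra.a_inv_grassmann_superalg[OF grassmann_subalgebra_superpolys])


section \<open>Quotients\<close>

lemma quotient_superalg_simps [simp]:
  "carrier (quotient_superalg A I) = carrier (A Quot I)"
  "monoid.mult (quotient_superalg A I) = monoid.mult (A Quot I)"
  "one (quotient_superalg A I) = one (A Quot I)"
  "zero (quotient_superalg A I) = zero (A Quot I)"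
  "add (quotient_superalg A I) = add (A Quot I)"
  "even_part (quotient_superalg A I) = (\<lambda>f. I +>\<^bsub>A\<^esub> f) ` even_part A"
  "odd_part (quotient_superalg A I) = (\<lambda>f. I +>\<^bsub>A\<^esub> f) ` odd_part A"
  "scalar (quotient_superalg A I) = (\<lambda>c. I +>\<^bsub>A\<^esub> scalar A c)"
  by (simp_all add: quotient_superalg_def ring.defs superalg.defs)

lemma even_ring_simps [simp]:
  "carrier (even_ring A) = even_part A" "monoid.mult (even_ring A) = monoid.mult A"
  "one (even_ring A) = one A" "zero (even_ring A) = zero A" "add (even_ring A) = add A"
  by (simp_all add: even_ring_def)

text \<open>A superalgebra, its even ring and a quotient ring are records of different types even
  where their operations agree. The identity map is a homomorphism between them and carries the ring
  axioms across.\<close>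

lemma (in ring) ring_same_operations:
  assumes "carrier S = carrier R" "monoid.mult S = monoid.mult R" "one S = one R"
    "zero S = zero R" "add S = add R"
  shows "ring S"
proof -
  have "(\<lambda>x. x) \<in> ring_hom R S"
    using assms by (auto simp: ring_hom_def)
  from ring_hom_imp_img_ring[OF this]
  have "ring (S\<lparr>carrier := carrier S, zero := zero S\<rparr>)"
    by (simp only: assms image_ident)
  then show ?thesis by simp
qed

context supercommutative_superalgebra
begin

lemma even_subset: "x \<in> even_part A \<Longrightarrow> x \<in> carrier A"
  using subgroup.subset[OF even_subgroup] by auto

lemma odd_subset: "x \<in> odd_part A \<Longrightarrow> x \<in> carrier A"
  using subgroup.subset[OF odd_subgroup] by auto

lemma even_zero: "\<zero> \<in> even_part A" and odd_zero: "\<zero> \<in> odd_part A"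
  using subgroup.one_closed[OF even_subgroup] subgroup.one_closed[OF odd_subgroup] by simp_all

lemma even_add: "x \<in> even_part A \<Longrightarrow> y \<in> even_part A \<Longrightarrow> x \<oplus> y \<in> even_part A"
  and odd_add: "x \<in> odd_part A \<Longrightarrow> y \<in> odd_part A \<Longrightarrow> x \<oplus> y \<in> odd_part A"
  using subgroup.m_closed[OF even_subgroup] subgroup.m_closed[OF odd_subgroup] by simp_all

lemma even_a_inv: "x \<in> even_part A \<Longrightarrow> \<ominus> x \<in> even_part A"
  and odd_a_inv: "x \<in> odd_part A \<Longrightarrow> \<ominus> x \<in> odd_part A"
  using subgroup.m_inv_closed[OF even_subgroup] subgroup.m_inv_closed[OF odd_subgroup]
  by (simp_all add: a_inv_def)

lemma odd_even: "x \<in> odd_part A \<Longrightarrow> y \<in> even_part A \<Longrightarrow> x \<otimes> y \<in> odd_part A"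
  using even_odd even_central odd_subset by metis

lemma even_one: "\<one> \<in> even_part A"
  using scalar_even[of 1] by (simp add: scalar_one)

lemma even_odd_decomp:
  assumes "x \<in> carrier A"
  obtains y z where "y \<in> even_part A" "z \<in> odd_part A" "x = y \<oplus> z"
  using assms unfolding even_odd_sum set_add_def' by auto

lemma scalar_zero: "scalar A 0 = \<zero>"
proof -
  have "scalar A 0 \<in> carrier A" using scalar_even even_subset by blast
  moreover have "scalar A 0 \<oplus> scalar A 0 = scalar A 0" using scalar_add[of 0 0] by simp
  ultimately show ?thesis by (metis add.r_cancel_one)
qed

lemma cring_even_ring: "cring (even_ring A)"
proof -
  have sub: "subring (even_part A) A"
    by (rule subringI) (auto simp: even_subset even_one even_a_inv even_even even_add)
  have "ring (A\<lparr>carrier := even_part A\<rparr>)" by (rule subring_is_ring[OF sub])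
  then have ring: "ring (even_ring A)"
    by (rule ring.ring_same_operations) (simp_all add: even_ring_def)
  show ?thesis
    by (rule cring.intro[OF ring], rule comm_monoid.intro)
      (use ring in \<open>auto simp: ring_def even_ring_def comm_monoid_axioms_def even_central even_subset\<close>)
qed

end

text \<open>Every axiom but one is inherited by a surjective image. The images of the even and the
  odd part could overlap; \<open>inter\<close> excludes this.\<close>

lemma supercommutative_superalgebra_image:
  assumes A: "supercommutative_superalgebra A" and p: "ring_hom_ring A Q p"
    and carr: "carrier Q = p ` carrier A"
    and ev: "even_part Q = p ` even_part A" and od: "odd_part Q = p ` odd_part A"
    and sc: "\<And>c. scalar Q c = p (scalar A c)"
    and inter: "\<And>x y. x \<in> even_part A \<Longrightarrow> y \<in> odd_part A \<Longrightarrow> p x = p y \<Longrightarrow> p x = \<zero>\<^bsub>Q\<^esub>"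
  shows "supercommutative_superalgebra Q"
proof -
  interpret A: supercommutative_superalgebra A by (rule A)
  interpret p: ring_hom_ring A Q p by (rule p)
  note c = A.even_subset A.odd_subset
  have sub: "subgroup (p ` H) (add_monoid Q)" if H: "subgroup H (add_monoid A)" for H
  proof (rule subgroup.intro)
    have HA: "H \<subseteq> carrier A" using subgroup.subset[OF H] by simp
    then show "p ` H \<subseteq> carrier (add_monoid Q)" using carr by auto
    show "x \<otimes>\<^bsub>add_monoid Q\<^esub> y \<in> p ` H" if xy: "x \<in> p ` H" "y \<in> p ` H" for x y
    proof -
      obtain u v where uv: "u \<in> H" "x = p u" "v \<in> H" "y = p v" using xy by auto
      then have "u \<in> carrier A" "v \<in> carrier A" using HA by blast+
      then have "x \<oplus>\<^bsub>Q\<^esub> y = p (u \<oplus>\<^bsub>A\<^esub> v)" using uv by simp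
      moreover have "u \<oplus>\<^bsub>A\<^esub> v \<in> H" using subgroup.m_closed[OF H uv(1,3)] by simp
      ultimately show ?thesis by auto
    qed
    show "\<one>\<^bsub>add_monoid Q\<^esub> \<in> p ` H"
      using subgroup.one_closed[OF H] p.hom_zero by (metis image_eqI monoid.simps(2))
    show "inv\<^bsub>add_monoid Q\<^esub> x \<in> p ` H" if x: "x \<in> p ` H" for x
    proof -
      obtain u where u: "u \<in> H" "x = p u" using x by auto
      then have "u \<in> carrier A" using HA by blast
      then have "\<ominus>\<^bsub>Q\<^esub> x = p (\<ominus>\<^bsub>A\<^esub> u)" using u by simp
      moreover have "\<ominus>\<^bsub>A\<^esub> u \<in> H" using subgroup.m_inv_closed[OF H u(1)] by (simp add: a_inv_def)
      ultimately show ?thesis by (auto simp: a_inv_def)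
    qed
  qed
  have sum: "x \<in> p ` even_part A <+>\<^bsub>Q\<^esub> p ` odd_part A \<longleftrightarrow> x \<in> carrier Q" for x
  proof
    assume "x \<in> carrier Q"
    then obtain u where "u \<in> carrier A" "x = p u" using carr by blast
    then obtain y z where yz: "y \<in> even_part A" "z \<in> odd_part A" "x = p (y \<oplus>\<^bsub>A\<^esub> z)"
      by (metis A.even_odd_decomp)
    then have "x = p y \<oplus>\<^bsub>Q\<^esub> p z" using c by auto
    then show "x \<in> p ` even_part A <+>\<^bsub>Q\<^esub> p ` odd_part A" using yz unfolding set_add_def' by blast
  next
    assume "x \<in> p ` even_part A <+>\<^bsub>Q\<^esub> p ` odd_part A"
    then show "x \<in> carrier Q" unfolding set_add_def' using c by auto
  qed
  show ?thesis
  proof (rule supercommutative_superalgebra.intro[OF p.S.ring_axioms],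
      rule supercommutative_superalgebra_axioms.intro, unfold ev od sc)
    show "subgroup (p ` even_part A) (add_monoid Q)"
      by (rule sub[OF A.even_subgroup])
    show "subgroup (p ` odd_part A) (add_monoid Q)"
      by (rule sub[OF A.odd_subgroup])
    show "carrier Q = p ` even_part A <+>\<^bsub>Q\<^esub> p ` odd_part A"
      using sum by blast
    show "p ` even_part A \<inter> p ` odd_part A = {\<zero>\<^bsub>Q\<^esub>}"
    proof
      show "p ` even_part A \<inter> p ` odd_part A \<subseteq> {\<zero>\<^bsub>Q\<^esub>}"
        using inter by blast
      show "{\<zero>\<^bsub>Q\<^esub>} \<subseteq> p ` even_part A \<inter> p ` odd_part A"
        using p.hom_zero A.even_zero A.odd_zero by (metis IntI empty_subsetI image_eqI insert_subset)
    qed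
    show "p (scalar A c) \<in> p ` even_part A" for c using A.scalar_even by blast
    show "p (scalar A 1) = \<one>\<^bsub>Q\<^esub>" by (simp add: A.scalar_one)
    show "p (scalar A (d + e)) = p (scalar A d) \<oplus>\<^bsub>Q\<^esub> p (scalar A e)"
      "p (scalar A (d * e)) = p (scalar A d) \<otimes>\<^bsub>Q\<^esub> p (scalar A e)" for d e
      using c(1)[OF A.scalar_even] by (simp_all add: A.scalar_add A.scalar_mult)
    show "x \<otimes>\<^bsub>Q\<^esub> x = \<zero>\<^bsub>Q\<^esub>" if x: "x \<in> p ` odd_part A" for x
    proof -
      obtain u where u: "u \<in> odd_part A" "x = p u" using x by auto
      then show ?thesis using c A.odd_square[OF u(1)] p.hom_mult[of u u] by simp
    qed
    show "x \<otimes>\<^bsub>Q\<^esub> y = \<ominus>\<^bsub>Q\<^esub> (y \<otimes>\<^bsub>Q\<^esub> x)" if xy: "x \<in> p ` odd_part A" "y \<in> p ` odd_part A" for x y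
    proof -
      obtain u v where uv: "u \<in> odd_part A" "x = p u" "v \<in> odd_part A" "y = p v" using xy by auto
      then have "p (u \<otimes>\<^bsub>A\<^esub> v) = \<ominus>\<^bsub>Q\<^esub> p (v \<otimes>\<^bsub>A\<^esub> u)"
        using c A.odd_anticommute[OF uv(1,3)] by simp
      then show ?thesis using uv c by simp
    qed
    show "x \<otimes>\<^bsub>Q\<^esub> y = y \<otimes>\<^bsub>Q\<^esub> x" if xy: "x \<in> p ` even_part A" "y \<in> carrier Q" for x y
    proof -
      obtain u v where uv: "u \<in> even_part A" "x = p u" "v \<in> carrier A" "y = p v"
        using xy unfolding carr by auto
      then have "p (u \<otimes>\<^bsub>A\<^esub> v) = p (v \<otimes>\<^bsub>A\<^esub> u)" using A.even_central[of u v] by simp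
      then show ?thesis using uv c by simp
    qed
    have mult: "x \<otimes>\<^bsub>Q\<^esub> y \<in> p ` L"
      if xy: "x \<in> p ` H" "y \<in> p ` K" and closed: "\<And>u v. u \<in> H \<Longrightarrow> v \<in> K \<Longrightarrow> u \<otimes>\<^bsub>A\<^esub> v \<in> L"
        and HK: "\<And>u. u \<in> H \<Longrightarrow> u \<in> carrier A" "\<And>u. u \<in> K \<Longrightarrow> u \<in> carrier A" for x y H K L
    proof -
      obtain u v where uv: "u \<in> H" "x = p u" "v \<in> K" "y = p v" using xy by auto
      then have "x \<otimes>\<^bsub>Q\<^esub> y = p (u \<otimes>\<^bsub>A\<^esub> v)" using HK by simp
      then show ?thesis using closed uv by blast
    qed
    show "x \<otimes>\<^bsub>Q\<^esub> y \<in> p ` even_part A" if "x \<in> p ` even_part A" "y \<in> p ` even_part A" for x y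
      by (rule mult[OF that A.even_even c(1) c(1)])
    show "x \<otimes>\<^bsub>Q\<^esub> y \<in> p ` odd_part A" if "x \<in> p ` even_part A" "y \<in> p ` odd_part A" for x y
      by (rule mult[OF that A.even_odd c(1) c(2)])
    show "x \<otimes>\<^bsub>Q\<^esub> y \<in> p ` even_part A" if "x \<in> p ` odd_part A" "y \<in> p ` odd_part A" for x y
      by (rule mult[OF that A.odd_odd c(2) c(2)])
  qed
qed

lemma quotient_superalg_carrier: "carrier (quotient_superalg A I) = (\<lambda>x. I +>\<^bsub>A\<^esub> x) ` carrier A"
  by (auto simp: FactRing_def A_RCOSETS_def')

lemma quotient_superalg_ring_hom:
  assumes "ideal I A"
  shows "ring_hom_ring A (quotient_superalg A I) (\<lambda>x. I +>\<^bsub>A\<^esub> x)"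
proof -
  interpret ideal I A by (rule assms)
  have "ring (quotient_superalg A I)"
    by (rule ring.ring_same_operations[OF quotient_is_ring]) simp_all
  moreover have "(\<lambda>x. I +>\<^bsub>A\<^esub> x) \<in> ring_hom A (quotient_superalg A I)"
    using rcos_ring_hom by (simp add: ring_hom_def)
  ultimately show ?thesis
    by (intro ring_hom_ring.intro ring_hom_ring_axioms.intro ring_axioms)
qed

text \<open>If an even and an odd element agree modulo \<open>I\<close>, their difference lies in
  \<open>I\<close>, and so does its even component when \<open>I\<close> is homogeneous. Hence the
  two parts of the quotient meet only in zero.\<close>

lemma quotient_superalg_supercommutative:
  assumes A: "supercommutative_superalgebra A" and I: "ideal I A"
    and homogeneous: "\<And>x y. x \<in> even_part A \<Longrightarrow> y \<in> odd_part A \<Longrightarrow> x \<oplus>\<^bsub>A\<^esub> y \<in> I \<Longrightarrow> x \<in> I"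
  shows "supercommutative_superalgebra (quotient_superalg A I)"
proof (rule supercommutative_superalgebra_image[OF A quotient_superalg_ring_hom[OF I] quotient_superalg_carrier])
  interpret A: supercommutative_superalgebra A by (rule A)
  fix x y assume xy: "x \<in> even_part A" "y \<in> odd_part A" "I +>\<^bsub>A\<^esub> x = I +>\<^bsub>A\<^esub> y"
  then have "x \<oplus>\<^bsub>A\<^esub> \<ominus>\<^bsub>A\<^esub> y \<in> I"
    using A.quotient_eq_iff_same_a_r_cos[OF I, of x y] A.even_subset A.odd_subset
    by (simp add: a_minus_def)
  then have "x \<in> I" using homogeneous xy A.odd_a_inv by blast
  then show "I +>\<^bsub>A\<^esub> x = \<zero>\<^bsub>quotient_superalg A I\<^esub>"
    using A.a_rcos_zero[OF I] by (simp add: FactRing_def)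
qed simp_all


section \<open>Chains of primes under surjective homomorphisms\<close>

lemma prime_chain_vimage:
  assumes R: "cring R" and h: "ring_hom_ring R S h" and surj: "h ` carrier R = carrier S"
    and P: "prime_chain S e P"
  shows "prime_chain R e (\<lambda>i. {x \<in> carrier R. h x \<in> P i})"
    and "i \<le> e \<Longrightarrow> x \<in> carrier R \<Longrightarrow> h x = \<zero>\<^bsub>S\<^esub> \<Longrightarrow> h x \<in> P i"
proof -
  have prime: "primeideal (P i) S" if "i \<le> e" for i using P that by (simp add: prime_chain_def)
  show "i \<le> e \<Longrightarrow> x \<in> carrier R \<Longrightarrow> h x = \<zero>\<^bsub>S\<^esub> \<Longrightarrow> h x \<in> P i"
    using prime[of i] additive_subgroup.zero_closed[OF ideal.axioms(1)] by (metis primeideal.axioms(1))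
  have "{x \<in> carrier R. h x \<in> P i} \<subset> {x \<in> carrier R. h x \<in> P (Suc i)}" if "i < e" for i
  proof -
    obtain y where "y \<in> P (Suc i)" "y \<notin> P i" and sub: "P i \<subseteq> P (Suc i)"
      using P \<open>i < e\<close> unfolding prime_chain_def by blast
    moreover have "P (Suc i) \<subseteq> carrier S"
      using prime[of "Suc i"] \<open>i < e\<close>
      by (meson Suc_leI additive_subgroup.a_subset ideal.axioms(1) primeideal.axioms(1))
    ultimately obtain x where "x \<in> carrier R" "y = h x" using surj by blast
    then show ?thesis using \<open>y \<in> P (Suc i)\<close> \<open>y \<notin> P i\<close> sub by blast
  qed
  then show "prime_chain R e (\<lambda>i. {x \<in> carrier R. h x \<in> P i})"
    unfolding prime_chain_def using prime ring_hom_ring.primeideal_vimage[OF h R] by blast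
qed

text \<open>A prime containing the kernel is a union of fibres of \<open>h\<close> (the fact
  \<open>mem\<close>), so properness, primality and strict inclusions are not lost in the
  image.\<close>

lemma prime_chain_image:
  assumes S: "cring S" and h: "ring_hom_ring R S h" and surj: "h ` carrier R = carrier S"
    and P: "prime_chain R e P" and ker: "\<And>x. x \<in> carrier R \<Longrightarrow> h x = \<zero>\<^bsub>S\<^esub> \<Longrightarrow> x \<in> P 0"
  shows "prime_chain S e (\<lambda>i. h ` P i)"
proof -
  interpret ring_hom_ring R S h by (rule h)
  have prime: "primeideal (P i) R" if "i \<le> e" for i using P that by (simp add: prime_chain_def)
  have carr: "P i \<subseteq> carrier R" if "i \<le> e" for i
    using prime[OF that] by (meson additive_subgroup.a_subset ideal.axioms(1) primeideal.axioms(1))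
  have kerP: "x \<in> P i" if "x \<in> carrier R" "h x = \<zero>\<^bsub>S\<^esub>" "i \<le> e" for x i
    using that(3)
  proof (induction i)
    case (Suc i)
    then show ?case using P unfolding prime_chain_def by (metis Suc_leD Suc_le_eq psubsetD)
  qed (use ker that in blast)
  have mem: "x \<in> P i" if x: "x \<in> carrier R" "h x \<in> h ` P i" "i \<le> e" for x i
  proof -
    interpret P: primeideal "P i" R using prime x by blast
    obtain y where y: "y \<in> P i" "h x = h y" using x by blast
    then have yc: "y \<in> carrier R" using P.a_Hcarr by blast
    have "h (x \<ominus>\<^bsub>R\<^esub> y) = \<zero>\<^bsub>S\<^esub>"
      using x y yc by (simp add: R.minus_eq S.r_neg)
    then have "x \<ominus>\<^bsub>R\<^esub> y \<in> P i" using kerP x yc by blast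
    then have "(x \<ominus>\<^bsub>R\<^esub> y) \<oplus>\<^bsub>R\<^esub> y \<in> P i" using y by blast
    then show ?thesis using x(1) yc by (simp add: R.minus_eq R.a_assoc R.l_neg)
  qed
  have "primeideal (h ` P i) S" if i: "i \<le> e" for i
  proof -
    interpret P: primeideal "P i" R using prime i by blast
    have ideal: "ideal (h ` P i) S"
    proof (rule idealI[OF S.ring_axioms])
      show "subgroup (h ` P i) (add_monoid S)"
      proof (rule subgroup.intro)
        show "h ` P i \<subseteq> carrier (add_monoid S)" using P.a_Hcarr by auto
        show "x \<otimes>\<^bsub>add_monoid S\<^esub> y \<in> h ` P i" if xy: "x \<in> h ` P i" "y \<in> h ` P i" for x y
        proof -
          obtain u v where "u \<in> P i" "x = h u" "v \<in> P i" "y = h v" using xy by auto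
          then have "x \<oplus>\<^bsub>S\<^esub> y = h (u \<oplus>\<^bsub>R\<^esub> v)" "u \<oplus>\<^bsub>R\<^esub> v \<in> P i" using P.a_Hcarr by auto
          then show ?thesis by auto
        qed
        show "\<one>\<^bsub>add_monoid S\<^esub> \<in> h ` P i" using P.zero_closed hom_zero by (metis image_eqI monoid.simps(2))
        show "inv\<^bsub>add_monoid S\<^esub> x \<in> h ` P i" if x: "x \<in> h ` P i" for x
        proof -
          obtain u where "u \<in> P i" "x = h u" using x by auto
          then have "\<ominus>\<^bsub>S\<^esub> x = h (\<ominus>\<^bsub>R\<^esub> u)" "\<ominus>\<^bsub>R\<^esub> u \<in> P i" using P.a_Hcarr by auto
          then show ?thesis by (auto simp: a_inv_def)
        qed
      qed
    next
      fix a x assume "a \<in> h ` P i" "x \<in> carrier S"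
      then obtain u v where "u \<in> P i" "a = h u" "v \<in> carrier R" "x = h v" using surj by blast
      then have "x \<otimes>\<^bsub>S\<^esub> a = h (v \<otimes>\<^bsub>R\<^esub> u)" "a \<otimes>\<^bsub>S\<^esub> x = h (u \<otimes>\<^bsub>R\<^esub> v)"
        "v \<otimes>\<^bsub>R\<^esub> u \<in> P i" "u \<otimes>\<^bsub>R\<^esub> v \<in> P i" using P.a_Hcarr by (auto simp: P.I_l_closed P.I_r_closed)
      then show "x \<otimes>\<^bsub>S\<^esub> a \<in> h ` P i" "a \<otimes>\<^bsub>S\<^esub> x \<in> h ` P i" by auto
    qed
    show ?thesis
    proof (rule primeidealI[OF ideal S])
      show "carrier S \<noteq> h ` P i"
      proof
        assume "carrier S = h ` P i"
        moreover have "h \<one>\<^bsub>R\<^esub> \<in> carrier S" by (rule hom_closed) simp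
        ultimately have "h \<one>\<^bsub>R\<^esub> \<in> h ` P i" by (simp only:)
        then have "\<one>\<^bsub>R\<^esub> \<in> P i" using mem[OF R.one_closed _ i] by blast
        then show False using P.one_imp_carrier P.I_notcarr by blast
      qed
    next
      fix a b assume ab: "a \<in> carrier S" "b \<in> carrier S" "a \<otimes>\<^bsub>S\<^esub> b \<in> h ` P i"
      then obtain u v where uv: "u \<in> carrier R" "a = h u" "v \<in> carrier R" "b = h v"
        using surj by blast
      then have "u \<otimes>\<^bsub>R\<^esub> v \<in> P i" using ab mem[of "u \<otimes>\<^bsub>R\<^esub> v" i] i by simp
      then show "a \<in> h ` P i \<or> b \<in> h ` P i" using P.I_prime uv by blast
    qed
  qed
  moreover have "h ` P i \<subset> h ` P (Suc i)" if "i < e" for i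
  proof -
    have sub: "P i \<subset> P (Suc i)" using P that by (simp add: prime_chain_def)
    then obtain x where x: "x \<in> P (Suc i)" "x \<notin> P i" by (rule psubsetE) auto
    have "x \<in> carrier R" using x(1) carr[of "Suc i"] that by auto
    then have "h x \<notin> h ` P i" using mem[of x i] x(2) that by auto
    then show ?thesis using x(1) sub by (auto simp: psubset_eq)
  qed
  ultimately show ?thesis by (simp add: prime_chain_def)
qed

text \<open>Transfers dimension questions to chains of primes above the kernel, all in one fixed
  ring. It is used twice over the even superpolynomials: for the even part of the coordinate
  superalgebra and for its quotient by the annihilator of the odd product.\<close>

lemma has_krull_dim_surjective:
  assumes R: "cring R" and S: "cring S" and h: "ring_hom_ring R S h"
    and surj: "h ` carrier R = carrier S"
    and lower: "prime_chain R d P" "\<And>x. x \<in> carrier R \<Longrightarrow> h x = \<zero>\<^bsub>S\<^esub> \<Longrightarrow> x \<in> P 0"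
    and upper: "\<And>e P. prime_chain R e P \<Longrightarrow> (\<And>x. x \<in> carrier R \<Longrightarrow> h x = \<zero>\<^bsub>S\<^esub> \<Longrightarrow> x \<in> P 0) \<Longrightarrow> e \<le> d"
  shows "has_krull_dim S d"
  unfolding has_krull_dim_def
proof (intro conjI exI allI impI)
  show "prime_chain S d (\<lambda>i. h ` P i)" by (rule prime_chain_image[OF S h surj lower])
  fix e Q assume Q: "prime_chain S e Q"
  note * = prime_chain_vimage[OF R h surj Q]
  show "e \<le> d" by (rule upper[OF *(1)]) (use *(2) in auto)
qed


section \<open>Evaluation of superpolynomials\<close>

lemma (in abelian_monoid) finsum_in_submonoid:
  assumes "H \<subseteq> carrier G" "\<zero> \<in> H" "\<And>x y. x \<in> H \<Longrightarrow> y \<in> H \<Longrightarrow> x \<oplus> y \<in> H"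
    and "\<And>i. i \<in> I \<Longrightarrow> f i \<in> H"
  shows "finsum G f I \<in> H"
  using assms(4)
proof (induction I rule: infinite_finite_induct)
  case (insert i I)
  then have "f i \<in> carrier G" "f \<in> I \<rightarrow> carrier G" using assms(1) by auto
  then show ?case using insert assms(3) by simp
qed (use assms(2) in auto)

lemma shuffle_sign_times_single:
  "shuffle_sign S T * Poly_Mapping.single (m :: nat \<Rightarrow>\<^sub>0 nat) c
    = Poly_Mapping.single m (shuffle_sign S T * (c :: 'k::comm_ring_1))"
  unfolding shuffle_sign_def by (cases "even (card {(i, j). i \<in> S \<and> j \<in> T \<and> j < i})")
    (simp_all add: single_uminus)

lemma shuffle_sign_singleton_less:
  assumes "\<And>j. j \<in> T \<Longrightarrow> i < j"
  shows "shuffle_sign {i} T = 1"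
proof -
  have "{(k, j). k \<in> {i} \<and> j \<in> T \<and> j < k} = {}" using assms by force
  then show ?thesis unfolding shuffle_sign_def by (simp only: card.empty power_0)
qed

lemma shuffle_sign_singleton_greater:
  assumes "j < i"
  shows "shuffle_sign {i} {j} = - 1"
proof -
  have "{(k, l). k \<in> {i} \<and> l \<in> {j} \<and> l < k} = {(i, j)}" using assms by auto
  then show ?thesis unfolding shuffle_sign_def by simp
qed

text \<open>The universal property of superpolynomials: the variables may be sent to any elements of
  the right parity.\<close>

locale superalg_evaluation = supercommutative_superalgebra A
  for A :: "('k::field, 'a) superalg" (structure) +
  fixes a b :: "nat \<Rightarrow> 'a"
  assumes a_even: "a i \<in> even_part A" and b_odd: "b i \<in> odd_part A"
begin

lemma scalar_closed [simp]: "scalar A c \<in> carrier A"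
  using scalar_even even_subset by blast

lemma scalar_uminus: "scalar A (- c) = \<ominus> scalar A c"
proof -
  have "scalar A (- c) \<oplus> scalar A c = \<zero>" using scalar_add[of "- c" c] by (simp add: scalar_zero)
  then show ?thesis using minus_equality[of "scalar A (- c)" "scalar A c"] by simp
qed

lemma even_left_commute:
  assumes "y \<in> even_part A" "u \<in> carrier A" "v \<in> carrier A"
  shows "u \<otimes> (y \<otimes> v) = y \<otimes> (u \<otimes> v)"
  using assms even_central[of y u] even_subset by (metis m_assoc)

definition odd_prod :: "nat set \<Rightarrow> 'a" where
  "odd_prod S = foldr (\<lambda>i x. b i \<otimes> x) (sorted_list_of_set S) \<one>"

lemma b_closed [simp]: "b i \<in> carrier A"
  using b_odd odd_subset by blast

lemma odd_prod_closed [simp]: "odd_prod S \<in> carrier A"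
proof -
  have "foldr (\<lambda>i x. b i \<otimes> x) xs \<one> \<in> carrier A" for xs
    by (induction xs) auto
  then show ?thesis by (simp add: odd_prod_def)
qed

lemma odd_prod_empty [simp]: "odd_prod {} = \<one>"
  by (simp add: odd_prod_def)

lemma odd_prod_insert:
  assumes "finite S" "\<And>j. j \<in> S \<Longrightarrow> i < j"
  shows "odd_prod (insert i S) = b i \<otimes> odd_prod S"
proof -
  have "i \<notin> S" using assms(2) by blast
  then have "sorted_list_of_set (insert i S) = insort i (sorted_list_of_set S)"
    using assms(1) by simp
  also have "\<dots> = i # sorted_list_of_set S"
    by (rule insort_is_Cons) (use assms in \<open>auto intro: less_imp_le\<close>)
  finally show ?thesis by (simp add: odd_prod_def)
qed

lemma odd_prod_parity:
  assumes "finite S"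
  shows "odd_prod S \<in> (if even (card S) then even_part A else odd_part A)"
  using assms
proof (induction S rule: finite_linorder_min_induct)
  case empty
  then show ?case by (simp add: even_one)
next
  case (insert i S)
  then have "i \<notin> S" by auto
  with insert show ?case
    using odd_odd[OF b_odd, of "odd_prod S" i] odd_even[OF b_odd, of "odd_prod S" i]
    by (auto simp: odd_prod_insert split: if_splits)
qed

text \<open>Induction on the smallest index \<open>j\<close> of the set: when \<open>j < i\<close>,
  the factor \<open>b i\<close> passes \<open>b j\<close> at the cost of one sign, which is the pair
  that \<open>shuffle_sign\<close> counts for \<open>j\<close>.\<close>

lemma b_times_odd_prod:
  assumes "finite T"
  shows "b i \<otimes> odd_prod T
    = (if i \<in> T then \<zero> else scalar A (shuffle_sign {i} T) \<otimes> odd_prod (insert i T))"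
  using assms
proof (induction T rule: finite_linorder_min_induct)
  case empty
  then show ?case using odd_prod_insert[of "{}" i] by (simp add: scalar_one)
next
  case (insert j T)
  then have j: "j \<notin> T" and odj: "odd_prod (insert j T) = b j \<otimes> odd_prod T"
    by (auto intro: odd_prod_insert)
  consider "i < j" | "i = j" | "j < i" by linarith
  then show ?case
  proof cases
    case 1
    then have less: "i < k" if "k \<in> insert j T" for k using insert that by force
    then have "i \<notin> insert j T" by blast
    then show ?thesis
      using odd_prod_insert[of "insert j T" i] less insert(1)
        shuffle_sign_singleton_less[of "insert j T" i, where 'a = 'k]
      by (simp add: scalar_one)
  next
    case 2
    have "b i \<otimes> (b i \<otimes> odd_prod T) = \<zero>"
      using odd_square[OF b_odd, of i] by (simp flip: m_assoc)
    then show ?thesis using 2 odj by simp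
  next
    case 3
    have "b i \<otimes> odd_prod (insert j T) = \<ominus> (b j \<otimes> (b i \<otimes> odd_prod T))"
      using odd_anticommute[OF b_odd b_odd, of i j] by (simp add: odj l_minus flip: m_assoc)
    also have "\<dots> = (if i \<in> insert j T then \<zero>
        else scalar A (shuffle_sign {i} (insert j T)) \<otimes> odd_prod (insert i (insert j T)))"
    proof (cases "i \<in> T")
      case True
      then show ?thesis using insert by simp
    next
      case False
      have "odd_prod (insert i (insert j T)) = b j \<otimes> odd_prod (insert i T)"
        using odd_prod_insert[of "insert i T" j] 3 insert by (auto simp: insert_commute)
      moreover have "shuffle_sign {i} (insert j T) = - (shuffle_sign {i} T :: 'k)"
        using shuffle_sign_Un_right[of "{i}" "{j}" T, where 'a = 'k] insert j 3
        by (simp add: shuffle_sign_singleton_greater)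
      moreover have "\<ominus> (b j \<otimes> (b i \<otimes> odd_prod T))
        = \<ominus> (scalar A (shuffle_sign {i} T) \<otimes> (b j \<otimes> odd_prod (insert i T)))"
        using insert False even_left_commute[OF scalar_even b_closed odd_prod_closed] by simp
      ultimately show ?thesis using False 3 by (simp add: scalar_uminus l_minus)
    qed
    finally show ?thesis .
  qed
qed

lemma odd_prod_times:
  assumes "finite S" "finite T"
  shows "odd_prod S \<otimes> odd_prod T
    = (if S \<inter> T = {} then scalar A (shuffle_sign S T) \<otimes> odd_prod (S \<union> T) else \<zero>)"
  using assms(1)
proof (induction S rule: finite_linorder_min_induct)
  case empty
  then show ?case by (simp add: scalar_one)
next
  case (insert i S)
  then have i: "i \<notin> S" by auto
  have "odd_prod (insert i S) \<otimes> odd_prod T = b i \<otimes> (odd_prod S \<otimes> odd_prod T)"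
    using insert by (simp add: odd_prod_insert m_assoc)
  also have "\<dots> = (if insert i S \<inter> T = {}
      then scalar A (shuffle_sign (insert i S) T) \<otimes> odd_prod (insert i S \<union> T) else \<zero>)"
  proof (cases "S \<inter> T = {}")
    case True
    have "b i \<otimes> (odd_prod S \<otimes> odd_prod T)
      = scalar A (shuffle_sign S T) \<otimes> (b i \<otimes> odd_prod (S \<union> T))"
      using insert True even_left_commute[OF scalar_even b_closed odd_prod_closed] by simp
    also have "\<dots> = (if i \<in> T then \<zero> else scalar A (shuffle_sign S T) \<otimes>
        (scalar A (shuffle_sign {i} (S \<union> T)) \<otimes> odd_prod (insert i (S \<union> T))))"
      using b_times_odd_prod[of "S \<union> T" i] insert assms(2) i by simp
    also have "\<dots> = (if i \<in> T then \<zero>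
        else scalar A (shuffle_sign S T * shuffle_sign {i} (S \<union> T)) \<otimes> odd_prod (insert i (S \<union> T)))"
      by (simp add: scalar_mult m_assoc)
    finally show ?thesis
      using shuffle_sign_Un_left[of "{i}" S T, where 'a = 'k] shuffle_sign_Un_right[of "{i}" S T, where 'a = 'k]
        shuffle_sign_singleton_less[of S i, where 'a = 'k] insert assms(2) i True
      by (auto simp: mult.commute)
  next
    case False
    then show ?thesis using insert by auto
  qed
  finally show ?case .
qed

text \<open>The product is formed in \<open>even_ring A\<close> because \<open>finprod\<close>
  requires commutativity, which \<open>A\<close> itself does not have.\<close>

definition even_mono :: "(nat \<Rightarrow>\<^sub>0 nat) \<Rightarrow> 'a" where
  "even_mono m = finprod (even_ring A) (\<lambda>i. a i [^]\<^bsub>even_ring A\<^esub> Poly_Mapping.lookup m i) (Poly_Mapping.keys m)"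

lemma even_mono_closed: "even_mono m \<in> even_part A"
  and even_mono_zero: "even_mono 0 = \<one>"
  and even_mono_single: "even_mono (Poly_Mapping.single i 1) = a i"
  and even_mono_add: "even_mono (m + m') = even_mono m \<otimes> even_mono m'"
proof -
  interpret E: cring "even_ring A" by (rule cring_even_ring)
  have pow [simp]: "a i [^]\<^bsub>even_ring A\<^esub> (k::nat) \<in> even_part A" for i k
    using E.nat_pow_closed[of "a i" k] a_even by simp
  then have pow': "(\<lambda>i. a i [^]\<^bsub>even_ring A\<^esub> (f i::nat)) \<in> K \<rightarrow> carrier (even_ring A)" for f K
    by simp
  show "even_mono m \<in> even_part A"
    using E.finprod_closed[OF pow'] by (simp add: even_mono_def)
  show "even_mono 0 = \<one>"
    by (simp add: even_mono_def)
  show "even_mono (Poly_Mapping.single i 1) = a i"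
    using a_even[of i] E.finprod_insert[of "{}" i "\<lambda>i'. a i' [^]\<^bsub>even_ring A\<^esub> (Poly_Mapping.lookup (Poly_Mapping.single i 1) i' :: nat)"]
      E.nat_pow_eone[of "a i"] even_subset[of "a i"]
    by (simp add: even_mono_def)
  have ext: "even_mono l = finprod (even_ring A) (\<lambda>i. a i [^]\<^bsub>even_ring A\<^esub> Poly_Mapping.lookup l i) K"
    if "finite K" "Poly_Mapping.keys l \<subseteq> K" for l K
    unfolding even_mono_def
    by (rule E.finprod_mono_neutral_cong_left) (use that pow in \<open>auto simp: in_keys_iff\<close>)
  let ?K = "Poly_Mapping.keys m \<union> Poly_Mapping.keys m'"
  have "even_mono (m + m') = finprod (even_ring A)
      (\<lambda>i. (a i [^]\<^bsub>even_ring A\<^esub> Poly_Mapping.lookup m i) \<otimes>\<^bsub>even_ring A\<^esub> (a i [^]\<^bsub>even_ring A\<^esub> Poly_Mapping.lookup m' i)) ?K"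
    using ext[of ?K "m + m'"] Poly_Mapping.keys_add[of m m'] a_even
    by (simp add: lookup_add E.nat_pow_mult[symmetric, simplified])
  also have "\<dots> = finprod (even_ring A) (\<lambda>i. a i [^]\<^bsub>even_ring A\<^esub> Poly_Mapping.lookup m i) ?K
      \<otimes>\<^bsub>even_ring A\<^esub> finprod (even_ring A) (\<lambda>i. a i [^]\<^bsub>even_ring A\<^esub> Poly_Mapping.lookup m' i) ?K"
    by (rule E.finprod_multf) (use pow in auto)
  also have "\<dots> = even_mono m \<otimes> even_mono m'"
    using ext[of ?K m] ext[of ?K m'] by simp
  finally show "even_mono (m + m') = even_mono m \<otimes> even_mono m'" .
qed

definition superpoly_eval :: "'k superpoly \<Rightarrow> 'a" where
  "superpoly_eval f = finsum A
     (\<lambda>(S, m). scalar A (Poly_Mapping.lookup (gcoeff f S) m) \<otimes> (even_mono m \<otimes> odd_prod S))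
     {(S, m). Poly_Mapping.lookup (gcoeff f S) m \<noteq> 0}"

lemma even_mono_carrier [simp]: "even_mono m \<in> carrier A"
  using even_mono_closed even_subset by blast

lemma finite_superpoly_support: "finite {(S, m). Poly_Mapping.lookup (gcoeff f S) m \<noteq> 0}"
proof (rule finite_subset)
  show "{(S, m). Poly_Mapping.lookup (gcoeff f S) m \<noteq> 0}
    \<subseteq> Sigma {S. gcoeff f S \<noteq> 0} (\<lambda>S. Poly_Mapping.keys (gcoeff f S))"
    by (auto simp: in_keys_iff)
qed (simp add: finite_gcoeff_support)

lemma superpoly_eval_extend:
  assumes "finite K" "{(S, m). Poly_Mapping.lookup (gcoeff f S) m \<noteq> 0} \<subseteq> K"
  shows "superpoly_eval f = finsum A
     (\<lambda>(S, m). scalar A (Poly_Mapping.lookup (gcoeff f S) m) \<otimes> (even_mono m \<otimes> odd_prod S)) K"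
  unfolding superpoly_eval_def
  by (rule add.finprod_mono_neutral_cong_left) (use assms in \<open>auto simp: scalar_zero\<close>)

lemma superpoly_eval_closed [simp]: "superpoly_eval f \<in> carrier A"
  unfolding superpoly_eval_def by (rule finsum_closed) auto

lemma superpoly_eval_add: "superpoly_eval (f + g) = superpoly_eval f \<oplus> superpoly_eval g"
proof -
  let ?s = "\<lambda>f. {(S, m). Poly_Mapping.lookup (gcoeff f S) m \<noteq> (0::'k)}"
  let ?K = "?s f \<union> ?s g"
  let ?t = "\<lambda>f (S, m). scalar A (Poly_Mapping.lookup (gcoeff f S) m) \<otimes> (even_mono m \<otimes> odd_prod S)"
  have fin: "finite ?K" by (simp add: finite_superpoly_support)
  have "superpoly_eval (f + g) = finsum A (?t (f + g)) ?K"
    by (rule superpoly_eval_extend[OF fin]) (auto simp: lookup_add)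
  also have "\<dots> = finsum A (\<lambda>x. ?t f x \<oplus> ?t g x) ?K"
    by (rule finsum_cong') (auto simp: lookup_add scalar_add l_distr)
  also have "\<dots> = finsum A (?t f) ?K \<oplus> finsum A (?t g) ?K"
    by (rule finsum_addf) auto
  also have "finsum A (?t f) ?K = superpoly_eval f"
    by (rule superpoly_eval_extend[OF fin, symmetric]) auto
  also have "finsum A (?t g) ?K = superpoly_eval g"
    by (rule superpoly_eval_extend[OF fin, symmetric]) auto
  finally show ?thesis .
qed

lemma superpoly_eval_zero [simp]: "superpoly_eval 0 = \<zero>"
  by (simp add: superpoly_eval_def)

lemma superpoly_eval_mono:
  assumes "finite S"
  shows "superpoly_eval (gmono S (Poly_Mapping.single m c)) = scalar A c \<otimes> (even_mono m \<otimes> odd_prod S)"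
proof -
  have "superpoly_eval (gmono S (Poly_Mapping.single m c)) = finsum A
     (\<lambda>(T, l). scalar A (Poly_Mapping.lookup (gcoeff (gmono S (Poly_Mapping.single m c)) T) l)
        \<otimes> (even_mono l \<otimes> odd_prod T)) {(S, m)}"
    by (rule superpoly_eval_extend) (auto simp: gmono.rep_eq lookup_single when_def split: if_splits)
  then show ?thesis using assms by (simp add: gmono.rep_eq)
qed

text \<open>By additivity in both factors it suffices to multiply two monomials. There scalars and
  even factors are central, and the odd factors produce the same \<open>shuffle_sign\<close> before
  and after evaluation.\<close>

lemma superpoly_eval_mult: "superpoly_eval (f * g) = superpoly_eval f \<otimes> superpoly_eval g"
proof -
  have U: "f \<in> superpolys_in UNIV" for f :: "'k superpoly"
    by (simp add: superpolys_in_def polys_in_def)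
  have interchange: "(x \<otimes> (y \<otimes> u)) \<otimes> (x' \<otimes> (y' \<otimes> v)) = (x \<otimes> x') \<otimes> ((y \<otimes> y') \<otimes> (u \<otimes> v))"
    if "x \<in> even_part A" "y \<in> even_part A" "x' \<in> even_part A" "y' \<in> even_part A"
      "u \<in> carrier A" "v \<in> carrier A" for x y x' y' u v
  proof -
    have c: "x \<in> carrier A" "y \<in> carrier A" "x' \<in> carrier A" "y' \<in> carrier A"
      using that even_subset by auto
    have "(x \<otimes> (y \<otimes> u)) \<otimes> (x' \<otimes> (y' \<otimes> v)) = x' \<otimes> ((x \<otimes> (y \<otimes> u)) \<otimes> (y' \<otimes> v))"
      using that c by (intro even_left_commute) auto
    also have "(x \<otimes> (y \<otimes> u)) \<otimes> (y' \<otimes> v) = y' \<otimes> ((x \<otimes> (y \<otimes> u)) \<otimes> v)"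
      using that c by (intro even_left_commute) auto
    also have "\<dots> = y' \<otimes> (x \<otimes> (y \<otimes> (u \<otimes> v)))"
      using that c by (simp add: m_assoc)
    also have "\<dots> = x \<otimes> (y \<otimes> (y' \<otimes> (u \<otimes> v)))"
      using that c even_left_commute[of x y'] even_left_commute[of y y'] by simp
    also have "x' \<otimes> \<dots> = x \<otimes> (x' \<otimes> (y \<otimes> (y' \<otimes> (u \<otimes> v))))"
      using that c by (intro even_left_commute) auto
    finally show ?thesis using that c by (simp add: m_assoc)
  qed
  have mono: "superpoly_eval (gmono S (Poly_Mapping.single m c) * gmono T (Poly_Mapping.single l d))
      = superpoly_eval (gmono S (Poly_Mapping.single m c)) \<otimes> superpoly_eval (gmono T (Poly_Mapping.single l d))"
    if "finite S" "finite T" for S T m l c d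
  proof -
    have "gmono S (Poly_Mapping.single m c) * gmono T (Poly_Mapping.single l d)
      = (if S \<inter> T = {} then gmono (S \<union> T) (Poly_Mapping.single (m + l) (shuffle_sign S T * (c * d))) else 0)"
      using that by (simp add: gmono_times mult.assoc mult_single shuffle_sign_times_single)
    then have "superpoly_eval (gmono S (Poly_Mapping.single m c) * gmono T (Poly_Mapping.single l d))
      = (if S \<inter> T = {} then scalar A (shuffle_sign S T * (c * d))
          \<otimes> (even_mono (m + l) \<otimes> odd_prod (S \<union> T)) else \<zero>)"
      using that by (simp add: superpoly_eval_mono)
    also have "\<dots> = scalar A (c * d) \<otimes> (even_mono (m + l) \<otimes> (odd_prod S \<otimes> odd_prod T))"
      using that
      by (simp add: odd_prod_times even_left_commute scalar_even even_mono_closed scalar_mult m_assoc)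
    also have "\<dots> = (scalar A c \<otimes> (even_mono m \<otimes> odd_prod S)) \<otimes> (scalar A d \<otimes> (even_mono l \<otimes> odd_prod T))"
      by (subst interchange) (simp_all add: scalar_even even_mono_closed scalar_mult even_mono_add)
    finally show ?thesis using that by (simp add: superpoly_eval_mono)
  qed
  have right: "superpoly_eval (gmono S (Poly_Mapping.single m c) * g)
      = superpoly_eval (gmono S (Poly_Mapping.single m c)) \<otimes> superpoly_eval g" if "finite S" for S m c
    using U[of g]
  proof (induction g rule: superpoly_induct)
    case (gmono T l d)
    then show ?case using mono that by blast
  qed (simp_all add: distrib_left superpoly_eval_add r_distr)
  show ?thesis
    using U[of f]
  proof (induction f rule: superpoly_induct)
    case (gmono S m c)
    then show ?case using right by blast
  qed (simp_all add: distrib_right superpoly_eval_add l_distr)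
qed

lemma superpoly_eval_scalar: "superpoly_eval (gconst (Poly_Mapping.single 0 c)) = scalar A c"
  using superpoly_eval_mono[of "{}" 0 c] by (simp add: gmono_empty even_mono_zero)

lemma superpoly_eval_one [simp]: "superpoly_eval 1 = \<one>"
  using superpoly_eval_scalar[of 1] by (simp add: scalar_one)

lemma superpoly_eval_uminus: "superpoly_eval (- f) = \<ominus> superpoly_eval f"
proof -
  have "superpoly_eval (- f) \<oplus> superpoly_eval f = \<zero>" by (simp flip: superpoly_eval_add)
  then show ?thesis using minus_equality[of "superpoly_eval (- f)" "superpoly_eval f"] by simp
qed

lemma superpoly_eval_even_var: "superpoly_eval (even_var i) = a i"
  using superpoly_eval_mono[of "{}" "Poly_Mapping.single i 1" 1] even_mono_single[of i] a_even even_subset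
  by (simp add: gmono_empty even_var_def scalar_one)

lemma superpoly_eval_odd_var: "superpoly_eval (odd_var i) = b i"
  using superpoly_eval_mono[of "{i}" 0 1] odd_prod_insert[of "{}" i]
  by (simp add: gmono_singleton odd_var_def scalar_one even_mono_zero)

lemma superpoly_eval_part:
  assumes "f \<in> grassmann_part e"
  shows "superpoly_eval f \<in> (if e then even_part A else odd_part A)"
proof -
  let ?H = "if e then even_part A else odd_part A"
  show ?thesis
    unfolding superpoly_eval_def
  proof (rule finsum_in_submonoid)
    fix x assume "x \<in> {(S, m). Poly_Mapping.lookup (gcoeff f S) m \<noteq> 0}"
    then obtain S m where x: "x = (S, m)" "Poly_Mapping.lookup (gcoeff f S) m \<noteq> 0" by blast
    then have "gcoeff f S \<noteq> 0" by auto
    then have "finite S" "even (card S) = e"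
      using assms by (auto simp: grassmann_part_def dest: finite_gcoeff)
    then have "odd_prod S \<in> ?H" using odd_prod_parity[of S] by simp
    then show "(case x of (S, m) \<Rightarrow> scalar A (Poly_Mapping.lookup (gcoeff f S) m) \<otimes> (even_mono m \<otimes> odd_prod S)) \<in> ?H"
      using x even_even even_odd scalar_even even_mono_closed by (auto split: if_splits)
  qed (auto simp: even_subset odd_subset even_zero odd_zero even_add odd_add split: if_splits)
qed

end


section \<open>The coordinate superalgebra\<close>

text \<open>Keeps the index sets \<open>{1..n}\<close> in this form.\<close>

declare One_nat_def [simp del]

lemma monodromy_Suc [simp]:
  "monodromy a b i (Suc k) $ 1 $ s = monodromy a b i k $ 2 $ s"
  "monodromy a b i (Suc k) $ 2 $ s = a (i + int k) * monodromy a b i k $ 2 $ s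
     - monodromy a b i k $ 1 $ s - b (i + int k) * monodromy a b i k $ 3 $ s"
  "monodromy a b i (Suc k) $ 3 $ s
    = b (i + int k) * monodromy a b i k $ 2 $ s + monodromy a b i k $ 3 $ s"
  by (simp_all add: matrix_matrix_mult_def sum_3 step_matrix_def)

declare monodromy.simps(2) [simp del]

lemma monodromy_superpolys_in:
  assumes "\<And>j. i \<le> j \<Longrightarrow> j < i + int k \<Longrightarrow> a j \<in> superpolys_in V"
    and "\<And>j. i \<le> j \<Longrightarrow> j < i + int k \<Longrightarrow> b j \<in> superpolys_in V"
  shows "monodromy a b i k $ r $ s \<in> superpolys_in V"
  using assms
proof (induction k arbitrary: r)
  case 0
  then show ?case by (simp add: mat_def)
next
  case (Suc k)
  then have "\<forall>r. monodromy a b i k $ r $ s \<in> superpolys_in V"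
    by simp
  moreover have "a (i + int k) \<in> superpolys_in V" "b (i + int k) \<in> superpolys_in V"
    using Suc.prems by auto
  ultimately have "\<forall>r. monodromy a b i (Suc k) $ r $ s \<in> superpolys_in V"
    unfolding forall_3 by (simp add: superpolys_in_add superpolys_in_diff superpolys_in_mult)
  then show ?case by blast
qed

text \<open>Index 3 is the odd direction, belonging to \<open>W\<close>: an entry changes parity
  exactly when just one of its indices is 3.\<close>

lemma monodromy_grassmann_part:
  assumes "\<And>j. i \<le> j \<Longrightarrow> j < i + int k \<Longrightarrow> a j \<in> grassmann_part True"
    and "\<And>j. i \<le> j \<Longrightarrow> j < i + int k \<Longrightarrow> b j \<in> grassmann_part False"
  shows "monodromy a b i k $ r $ s \<in> grassmann_part ((r = 3) = (s = 3))"
  using assms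
proof (induction k arbitrary: r)
  case 0
  then show ?case by (auto simp: mat_def one_even)
next
  case (Suc k)
  let ?M = "monodromy a b i k"
  have IH: "?M $ r $ s \<in> grassmann_part ((r = 3) = (s = 3))" for r
    using Suc by simp
  have a: "a (i + int k) \<in> grassmann_part True" and b: "b (i + int k) \<in> grassmann_part False"
    using Suc.prems by auto
  have "?M $ 1 $ s \<in> grassmann_part (s \<noteq> 3)" "?M $ 2 $ s \<in> grassmann_part (s \<noteq> 3)"
    "?M $ 3 $ s \<in> grassmann_part (s = 3)"
    using IH[of 1] IH[of 2] IH[of 3] by simp_all
  moreover from this have "a (i + int k) * ?M $ 2 $ s \<in> grassmann_part (s \<noteq> 3)"
    "b (i + int k) * ?M $ 3 $ s \<in> grassmann_part (s \<noteq> 3)"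
    "b (i + int k) * ?M $ 2 $ s \<in> grassmann_part (s = 3)"
    using grassmann_part_times[OF a] grassmann_part_times[OF b] by fastforce+
  ultimately have "\<forall>r. monodromy a b i (Suc k) $ r $ s \<in> grassmann_part ((r = 3) = (s = 3))"
    unfolding forall_3 by (simp add: grassmann_part_add grassmann_part_diff)
  then show ?case by blast
qed

lemma hill_monodromy_entry [simp]:
  "hill_monodromy $ 1 $ 1 = -1" "hill_monodromy $ 1 $ 2 = 0" "hill_monodromy $ 1 $ 3 = 0"
  "hill_monodromy $ 2 $ 1 = 0" "hill_monodromy $ 2 $ 2 = -1" "hill_monodromy $ 2 $ 3 = 0"
  "hill_monodromy $ 3 $ 1 = 0" "hill_monodromy $ 3 $ 2 = 0" "hill_monodromy $ 3 $ 3 = 1"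
  by (simp_all add: hill_monodromy_def)

lemma hill_index:
  assumes "n > 0"
  shows "nat (1 + (i - 1) mod int n) \<in> {1..n}"
proof -
  have "0 \<le> (i - 1) mod int n" "(i - 1) mod int n < int n" using assms by simp_all
  then show ?thesis by (simp add: nat_le_iff Suc_le_eq)
qed

lemma even_var_even: "even_var i \<in> grassmann_part True"
  by (simp add: even_var_def gconst_even)

lemma odd_var_odd: "odd_var i \<in> grassmann_part False"
  by (simp add: odd_var_def gvar_odd)

lemma hill_a_even: "hill_a n i \<in> grassmann_part True"
  by (simp add: hill_a_def even_var_even)

lemma hill_b_odd: "hill_b n i \<in> grassmann_part False"
  by (simp add: hill_b_def odd_var_odd grassmann_part_uminus)

lemma hill_a_in: "n > 0 \<Longrightarrow> hill_a n i \<in> superpolys_in {1..n}"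
  unfolding hill_a_def by (intro superpolys_in_even_var hill_index)

lemma hill_b_in: "n > 0 \<Longrightarrow> hill_b n i \<in> superpolys_in {1..n}"
  using superpolys_in_odd_var[OF hill_index, of n i]
  by (auto simp: hill_b_def intro: superpolys_in_uminus)

lemma hill_a_nat: "i \<in> {1..n} \<Longrightarrow> hill_a n (int i) = even_var i"
  by (simp add: hill_a_def mod_pos_pos_trivial)

lemma hill_b_nat: "i \<in> {1..n} \<Longrightarrow> hill_b n (int i) = odd_var i"
  by (simp add: hill_b_def mod_pos_pos_trivial div_pos_pos_trivial)

lemma hill_a_periodic: "hill_a n (i + int n) = hill_a n i"
proof -
  have "(i + int n - 1) mod int n = (i - 1) mod int n"
    by (metis add_diff_eq diff_add_eq mod_add_self2)
  then show ?thesis by (simp add: hill_a_def)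
qed

lemma hill_b_antiperiodic:
  assumes "n > 0"
  shows "hill_b n (i + int n) = - hill_b n i"
proof -
  have eq: "i + int n - 1 = (i - 1) + int n" by simp
  have "(i + int n - 1) mod int n = (i - 1) mod int n" "(i + int n - 1) div int n = (i - 1) div int n + 1"
    unfolding eq using assms by simp_all
  then show ?thesis by (simp add: hill_b_def)
qed

lemma hill_monodromy_in: "hill_monodromy $ r $ s \<in> superpolys_in V"
proof -
  have "\<forall>r s. hill_monodromy $ r $ s \<in> (superpolys_in V :: 'a superpoly set)"
    unfolding forall_3 by (simp add: superpolys_in_uminus)
  then show ?thesis by blast
qed

lemma hill_monodromy_part: "hill_monodromy $ r $ s \<in> grassmann_part ((r = 3) = (s = 3))"
proof -
  have "\<forall>r s. hill_monodromy $ r $ s \<in> (grassmann_part ((r = 3) = (s = 3)) :: 'a grassmann set)"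
    unfolding forall_3 by (simp add: one_even grassmann_part_uminus)
  then show ?thesis by blast
qed

text \<open>The parameter \<open>k_type\<close> only fixes the ground field.\<close>

locale hill_superspace =
  fixes n :: nat and k_type :: "'k::field_char_0 itself"
  assumes n: "n > 0"
begin

abbreviation B :: "('k, 'k superpoly) superalg" where "B \<equiv> affine_superspace n"
abbreviation M :: "int \<Rightarrow> 'k superpoly ^ 3 ^ 3" where "M i \<equiv> monodromy (hill_a n) (hill_b n) i n"
abbreviation I :: "'k superpoly set" where "I \<equiv> hill_ideal n"

sublocale B: supercommutative_superalgebra B
  by (rule affine_superspace_supercommutative)

lemma generators_in: "(M i - hill_monodromy) $ r $ s \<in> superpolys_in {1..n}"
  by (simp add: superpolys_in_diff monodromy_superpolys_in hill_monodromy_in hill_a_in hill_b_in n)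

lemma ideal_I: "ideal I B"
  unfolding hill_ideal_def by (rule B.genideal_ideal) (auto simp: generators_in simp del: vector_minus_component)

lemma generator_in_I: "(M i - hill_monodromy) $ r $ s \<in> I"
  unfolding hill_ideal_def by (rule subsetD[OF B.genideal_self]) (auto simp: generators_in simp del: vector_minus_component)

lemma I_minimal: "ideal J B \<Longrightarrow> (\<And>i r s. (M i - hill_monodromy) $ r $ s \<in> J) \<Longrightarrow> I \<subseteq> J"
  unfolding hill_ideal_def by (rule B.genideal_minimal) auto

lemma I_zero: "0 \<in> I"
  using additive_subgroup.zero_closed[OF ideal.axioms(1)[OF ideal_I]] by simp

lemma I_add: "f \<in> I \<Longrightarrow> g \<in> I \<Longrightarrow> f + g \<in> I"
  using additive_subgroup.a_closed[OF ideal.axioms(1)[OF ideal_I]] by simp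

lemma I_mult_left: "f \<in> I \<Longrightarrow> g \<in> superpolys_in {1..n} \<Longrightarrow> g * f \<in> I"
  using ideal.I_l_closed[OF ideal_I] by simp

lemma I_mult_right: "f \<in> I \<Longrightarrow> g \<in> superpolys_in {1..n} \<Longrightarrow> f * g \<in> I"
  using ideal.I_r_closed[OF ideal_I] by simp

lemma I_uminus: "f \<in> I \<Longrightarrow> - f \<in> I"
  using I_mult_left[of f "-1"] by (simp add: superpolys_in_uminus)

lemma I_diff: "f \<in> I \<Longrightarrow> g \<in> I \<Longrightarrow> f - g \<in> I"
  using I_add[of f "- g"] I_uminus[of g] by simp

lemma idealI_superpolys:
  assumes "J \<subseteq> superpolys_in {1..n}" "0 \<in> J" "\<And>f g. f \<in> J \<Longrightarrow> g \<in> J \<Longrightarrow> f + g \<in> J"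
    and mult: "\<And>f g. f \<in> J \<Longrightarrow> g \<in> superpolys_in {1..n} \<Longrightarrow> g * f \<in> J"
      "\<And>f g. f \<in> J \<Longrightarrow> g \<in> superpolys_in {1..n} \<Longrightarrow> f * g \<in> J"
  shows "ideal J B"
proof (rule idealI[OF B.ring_axioms])
  have inv: "inv\<^bsub>add_monoid B\<^esub> f = - f" if "f \<in> superpolys_in {1..n}" for f
    using a_inv_affine_superspace[OF that] by (simp add: a_inv_def)
  have um: "- f \<in> J" if "f \<in> J" for f
    using mult(1)[OF that, of "-1"] by (simp add: superpolys_in_uminus)
  show "subgroup J (add_monoid B)"
  proof (rule subgroup.intro)
    show "inv\<^bsub>add_monoid B\<^esub> f \<in> J" if "f \<in> J" for f
      using inv[of f] um[OF that] assms(1) that by auto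
  qed (use assms in auto)
qed (use mult in auto)

text \<open>The generators are homogeneous, and the elements whose parity components both lie in
  \<open>I\<close> form an ideal; so this ideal contains \<open>I\<close>.\<close>

lemma I_parity_proj:
  assumes "f \<in> I"
  shows "parity_proj e f \<in> I"
proof -
  let ?J = "{f \<in> superpolys_in {1..n}. \<forall>e. parity_proj e f \<in> I}"
  have "I \<subseteq> ?J"
  proof (rule I_minimal)
    have 0: "parity_proj e 0 = (0 :: 'k superpoly)" for e
      using parity_proj_add[of e 0 "0 :: 'k superpoly"] by simp
    show "ideal ?J B"
      by (rule idealI_superpolys)
        (auto simp: 0 I_zero I_add parity_proj_add parity_proj_times superpolys_in_add superpolys_in_mult
          superpolys_in_parity_proj I_mult_left I_mult_right)
    fix i r s
    have "(M i - hill_monodromy) $ r $ s \<in> grassmann_part ((r = 3) = (s = 3))"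
      by (simp add: grassmann_part_diff hill_monodromy_part monodromy_grassmann_part hill_a_even hill_b_odd)
    then have "parity_proj e ((M i - hill_monodromy) $ r $ s) \<in> I" for e
      using generator_in_I[of i r s] I_zero
      by (cases "e = ((r = 3) = (s = 3))") (simp_all add: parity_proj_same parity_proj_other del: vector_minus_component)
    then show "(M i - hill_monodromy) $ r $ s \<in> ?J" using generators_in by blast
  qed
  then show ?thesis using assms by blast
qed

abbreviation Q :: "('k, 'k superpoly set) superalg" where "Q \<equiv> hill_superalg n"
abbreviation proj :: "'k superpoly \<Rightarrow> 'k superpoly set" where "proj f \<equiv> I +>\<^bsub>B\<^esub> f"

lemma Q_supercommutative: "supercommutative_superalgebra Q"
  unfolding hill_superalg_def
proof (rule quotient_superalg_supercommutative[OF B.supercommutative_superalgebra_axioms ideal_I])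
  fix x y assume "x \<in> even_part B" "y \<in> odd_part B" "x \<oplus>\<^bsub>B\<^esub> y \<in> I"
  then show "x \<in> I"
    using I_parity_proj[of "x + y" True] by (simp add: parity_proj_add parity_proj_same parity_proj_other[of y False])
qed

lemma proj_hom: "ring_hom_ring B Q proj"
  unfolding hill_superalg_def by (rule quotient_superalg_ring_hom[OF ideal_I])

lemma Q_carrier: "carrier Q = proj ` superpolys_in {1..n}"
  unfolding hill_superalg_def quotient_superalg_carrier by simp

lemma Q_parts: "even_part Q = proj ` (superpolys_in {1..n} \<inter> grassmann_part True)"
    "odd_part Q = proj ` (superpolys_in {1..n} \<inter> grassmann_part False)"
    "scalar Q c = proj (gconst (Poly_Mapping.single 0 c))"
  by (simp_all add: hill_superalg_def)

lemma proj_add: "f \<in> superpolys_in {1..n} \<Longrightarrow> g \<in> superpolys_in {1..n}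
    \<Longrightarrow> proj f \<oplus>\<^bsub>Q\<^esub> proj g = proj (f + g)"
  and proj_mult: "f \<in> superpolys_in {1..n} \<Longrightarrow> g \<in> superpolys_in {1..n}
    \<Longrightarrow> proj f \<otimes>\<^bsub>Q\<^esub> proj g = proj (f * g)"
  and proj_one: "proj 1 = \<one>\<^bsub>Q\<^esub>"
  and proj_zero: "proj 0 = \<zero>\<^bsub>Q\<^esub>"
proof -
  note hom = ring_hom_ring.homh[OF proj_hom]
  show "f \<in> superpolys_in {1..n} \<Longrightarrow> g \<in> superpolys_in {1..n} \<Longrightarrow> proj f \<oplus>\<^bsub>Q\<^esub> proj g = proj (f + g)"
    using ring_hom_add[OF hom, of f g] by simp
  show "f \<in> superpolys_in {1..n} \<Longrightarrow> g \<in> superpolys_in {1..n} \<Longrightarrow> proj f \<otimes>\<^bsub>Q\<^esub> proj g = proj (f * g)"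
    using ring_hom_mult[OF hom, of f g] by simp
  show "proj 1 = \<one>\<^bsub>Q\<^esub>" using ring_hom_one[OF hom] by simp
  show "proj 0 = \<zero>\<^bsub>Q\<^esub>"
    using ring_hom_zero[OF hom ring_hom_ring.axioms(1,2)[OF proj_hom]] by simp
qed

lemma proj_eq_zero_iff: "f \<in> superpolys_in {1..n} \<Longrightarrow> proj f = \<zero>\<^bsub>Q\<^esub> \<longleftrightarrow> f \<in> I"
  using B.quotient_eq_iff_same_a_r_cos[OF ideal_I, of f "\<zero>\<^bsub>B\<^esub>"] proj_zero
  by (simp add: a_minus_def a_inv_affine_superspace)

lemma affine_Q: "affine_superalgebra Q"
  unfolding affine_superalgebra_def
proof (intro conjI exI allI impI)
  show "supercommutative_superalgebra Q" by (rule Q_supercommutative)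
  let ?F = "proj ` (even_var ` {1..n} \<union> odd_var ` {1..n})"
  show "finite ?F" by simp
  have "even_var ` {1..n} \<union> odd_var ` {1..n} \<subseteq> (superpolys_in {1..n} :: 'k superpoly set)"
    by (auto intro: superpolys_in_even_var superpolys_in_odd_var)
  then show "?F \<subseteq> carrier Q"
    unfolding Q_carrier by (rule image_mono)
  fix H assume "subring H Q \<and> ?F \<subseteq> H \<and> range (scalar Q) \<subseteq> H"
  then have H: "subring H Q" and F: "\<And>f. f \<in> even_var ` {1..n} \<union> odd_var ` {1..n} \<Longrightarrow> proj f \<in> H"
    and sc: "\<And>c. scalar Q c \<in> H" by (simp_all add: image_subset_iff)
  show "H = carrier Q"
  proof
    show "H \<subseteq> carrier Q" by (rule subringE(1)[OF H])
    have "f \<in> superpolys_in {1..n} \<inter> {f. proj f \<in> H}" if "f \<in> superpolys_in {1..n}" for f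
      using that
    proof (rule superpoly_generated)
      show "gconst (Poly_Mapping.single 0 c) \<in> superpolys_in {1..n} \<inter> {f. proj f \<in> H}" for c
        using sc[of c] unfolding Q_parts by (simp add: superpolys_in_scalar)
      show "g + h \<in> superpolys_in {1..n} \<inter> {f. proj f \<in> H}"
        if "g \<in> superpolys_in {1..n} \<inter> {f. proj f \<in> H}" "h \<in> superpolys_in {1..n} \<inter> {f. proj f \<in> H}" for g h
        using that subringE(7)[OF H, of "proj g" "proj h"]
        by (simp add: proj_add superpolys_in_add)
      show "g * h \<in> superpolys_in {1..n} \<inter> {f. proj f \<in> H}"
        if "g \<in> superpolys_in {1..n} \<inter> {f. proj f \<in> H}" "h \<in> superpolys_in {1..n} \<inter> {f. proj f \<in> H}" for g h
        using that subringE(6)[OF H, of "proj g" "proj h"]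
        by (simp add: proj_mult superpolys_in_mult)
    qed (use F in \<open>auto intro: superpolys_in_even_var superpolys_in_odd_var\<close>)
    then show "carrier Q \<subseteq> H" unfolding Q_carrier by blast
  qed
qed

end


section \<open>Points of the supervariety\<close>

text \<open>Dependent choice in both directions from the index \<open>i\<close>. It turns a
  recurrence that can be solved forwards and backwards into a solution indexed by all
  integers.\<close>

lemma two_sided_sequence:
  fixes rel :: "int \<Rightarrow> 's \<Rightarrow> 's \<Rightarrow> bool"
  assumes fwd: "\<And>j s. s \<in> C \<Longrightarrow> \<exists>s'\<in>C. rel j s s'"
    and bwd: "\<And>j s. s \<in> C \<Longrightarrow> \<exists>s'\<in>C. rel j s' s"
    and s0: "s0 \<in> C"
  obtains S where "S i = s0" "\<And>j. S j \<in> C" "\<And>j. rel j (S (j - 1)) (S j)"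
proof -
  define f where "f j s = (SOME s'. s' \<in> C \<and> rel j s s')" for j s
  define g where "g j s = (SOME s'. s' \<in> C \<and> rel j s' s)" for j s
  have f: "f j s \<in> C \<and> rel j s (f j s)" if "s \<in> C" for j s
    unfolding f_def by (rule someI_ex) (use fwd[OF that, of j] in blast)
  have g: "g j s \<in> C \<and> rel j (g j s) s" if "s \<in> C" for j s
    unfolding g_def by (rule someI_ex) (use bwd[OF that, of j] in blast)
  define F where "F = rec_nat s0 (\<lambda>k. f (i + int k + 1))"
  define G where "G = rec_nat s0 (\<lambda>k. g (i - int k))"
  have F: "F k \<in> C" for k by (induction k) (auto simp: F_def s0 f)
  have G: "G k \<in> C" for k by (induction k) (auto simp: G_def s0 g)
  define S where "S j = (if j \<ge> i then F (nat (j - i)) else G (nat (i - j)))" for j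
  show ?thesis
  proof
    show "S i = s0" by (simp add: S_def F_def)
    show "S j \<in> C" for j by (simp add: S_def F G)
    show "rel j (S (j - 1)) (S j)" for j
    proof (cases "j > i")
      case True
      define k where "k = nat (j - 1 - i)"
      have "nat (j - i) = Suc k" "i + int k + 1 = j" using True by (auto simp: k_def)
      then have "S j = f j (F k)" "S (j - 1) = F k" using True by (auto simp: S_def F_def k_def)
      then show ?thesis using f F by simp
    next
      case False
      define k where "k = nat (i - j)"
      have "nat (i - (j - 1)) = Suc k" "i - int k = j" using False by (auto simp: k_def)
      moreover have "S j = G k" using False by (auto simp: S_def k_def F_def G_def)
      ultimately have "S (j - 1) = g j (S j)" using False by (auto simp: S_def G_def)
      then show ?thesis using g G \<open>S j = G k\<close> by simp
    qed
  qed
qed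

lemma (in ring) minus_minus_cancel:
  assumes "p \<in> carrier R" "q \<in> carrier R" "y \<in> carrier R"
  shows "p \<ominus> (p \<ominus> y \<ominus> q) \<ominus> q = y"
  using assms by algebra

lemma sturm_liouville_solutionD:
  assumes "sturm_liouville_solution R a b V W"
  shows "V i \<in> carrier R" "W i \<in> carrier R"
    "V i = a i \<otimes>\<^bsub>R\<^esub> V (i - 1) \<ominus>\<^bsub>R\<^esub> V (i - 2) \<ominus>\<^bsub>R\<^esub> b i \<otimes>\<^bsub>R\<^esub> W (i - 1)"
    "W i = W (i - 1) \<oplus>\<^bsub>R\<^esub> b i \<otimes>\<^bsub>R\<^esub> V (i - 1)"
  using assms unfolding sturm_liouville_solution_def by blast+

text \<open>One step of the recurrence applied to linear combinations of initial values.
  Coefficients stay on the left of \<open>u\<close>, \<open>v\<close>, \<open>w\<close> throughout,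
  since nothing commutes here.\<close>

lemma (in ring) three_term_rows:
  assumes "a \<in> carrier R" "b \<in> carrier R" "u \<in> carrier R" "v \<in> carrier R" "w \<in> carrier R"
    "p1 \<in> carrier R" "p2 \<in> carrier R" "p3 \<in> carrier R" "q1 \<in> carrier R" "q2 \<in> carrier R" "q3 \<in> carrier R"
    "r1 \<in> carrier R" "r2 \<in> carrier R" "r3 \<in> carrier R"
  shows "a \<otimes> (p2 \<otimes> u \<oplus> q2 \<otimes> v \<oplus> r2 \<otimes> w) \<ominus> (p1 \<otimes> u \<oplus> q1 \<otimes> v \<oplus> r1 \<otimes> w) \<ominus> b \<otimes> (p3 \<otimes> u \<oplus> q3 \<otimes> v \<oplus> r3 \<otimes> w)
    = (a \<otimes> p2 \<ominus> p1 \<ominus> b \<otimes> p3) \<otimes> u \<oplus> (a \<otimes> q2 \<ominus> q1 \<ominus> b \<otimes> q3) \<otimes> v \<oplus> (a \<otimes> r2 \<ominus> r1 \<ominus> b \<otimes> r3) \<otimes> w" (is ?first)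
    and "(p3 \<otimes> u \<oplus> q3 \<otimes> v \<oplus> r3 \<otimes> w) \<oplus> b \<otimes> (p2 \<otimes> u \<oplus> q2 \<otimes> v \<oplus> r2 \<otimes> w)
    = (b \<otimes> p2 \<oplus> p3) \<otimes> u \<oplus> (b \<otimes> q2 \<oplus> q3) \<otimes> v \<oplus> (b \<otimes> r2 \<oplus> r3) \<otimes> w" (is ?second)
proof -
  show ?first using assms by (simp add: a_minus_def l_distr r_distr l_minus minus_add m_assoc a_ac)
  show ?second using assms by (simp add: l_distr r_distr m_assoc a_ac)
qed

text \<open>Vanishing on \<open>I\<close> is deliberately not assumed: the locale also serves to
  evaluate a potential before the evaluation is known to kill the ideal, and at potentials outside
  the supervariety.\<close>

locale superpoly_point = hill_superspace n k_type + R: supercommutative_superalgebra R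
  for n and k_type :: "'k::field_char_0 itself" and R :: "('k, 'r) superalg" (structure) +
  fixes \<psi> :: "'k superpoly \<Rightarrow> 'r"
  assumes psi_closed: "f \<in> superpolys_in {1..n} \<Longrightarrow> \<psi> f \<in> carrier R"
    and psi_add: "f \<in> superpolys_in {1..n} \<Longrightarrow> g \<in> superpolys_in {1..n} \<Longrightarrow> \<psi> (f + g) = \<psi> f \<oplus> \<psi> g"
    and psi_mult: "f \<in> superpolys_in {1..n} \<Longrightarrow> g \<in> superpolys_in {1..n} \<Longrightarrow> \<psi> (f * g) = \<psi> f \<otimes> \<psi> g"
    and psi_one: "\<psi> 1 = \<one>"
begin

lemma psi_zero: "\<psi> 0 = \<zero>"
  using psi_add[of 0 0] psi_closed[of 0] by (metis R.add.r_cancel_one add_0 superpolys_in_0)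

lemma psi_uminus: "f \<in> superpolys_in {1..n} \<Longrightarrow> \<psi> (- f) = \<ominus> \<psi> f"
  using psi_add[of "- f" f] psi_closed[of f] psi_closed[of "- f"] psi_zero R.minus_equality[of "\<psi> (- f)" "\<psi> f"]
  by (simp add: superpolys_in_uminus)

lemma psi_diff: "f \<in> superpolys_in {1..n} \<Longrightarrow> g \<in> superpolys_in {1..n} \<Longrightarrow> \<psi> (f - g) = \<psi> f \<ominus> \<psi> g"
  using psi_add[of f "- g"] psi_uminus[of g] by (simp add: superpolys_in_uminus a_minus_def)

abbreviation a where "a i \<equiv> \<psi> (hill_a n i)"
abbreviation b where "b i \<equiv> \<psi> (hill_b n i)"
abbreviation m where "m i k r s \<equiv> \<psi> (monodromy (hill_a n) (hill_b n) i k $ r $ s)"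

lemma monodromy_in: "monodromy (hill_a n) (hill_b n) i k $ r $ s \<in> superpolys_in {1..n}"
  by (simp add: monodromy_superpolys_in hill_a_in hill_b_in n)

lemma m_closed [simp]: "m i k r s \<in> carrier R"
  by (rule psi_closed[OF monodromy_in])

lemma m_0: "m i 0 r s = (if r = s then \<one> else \<zero>)"
  by (simp add: mat_def psi_one psi_zero)

lemma m_Suc:
  "m i (Suc k) 1 s = m i k 2 s"
  "m i (Suc k) 2 s = a (i + int k) \<otimes> m i k 2 s \<ominus> m i k 1 s \<ominus> b (i + int k) \<otimes> m i k 3 s"
  "m i (Suc k) 3 s = b (i + int k) \<otimes> m i k 2 s \<oplus> m i k 3 s"
  by (simp_all add: psi_diff psi_add psi_mult monodromy_in hill_a_in hill_b_in n superpolys_in_mult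
      superpolys_in_diff)

text \<open>The state before step \<open>j\<close> is
  \<open>(V (j - 2), V (j - 1), W (j - 1))\<close>; the product of \<open>k\<close> step matrices
  starting at \<open>i\<close> carries the state before step \<open>i\<close> to the state before
  step \<open>i + k\<close>.\<close>

lemma solution_monodromy:
  assumes "sturm_liouville_solution R a b V W"
  shows "V (i + int k - 2) = m i k 1 1 \<otimes> V (i - 2) \<oplus> m i k 1 2 \<otimes> V (i - 1) \<oplus> m i k 1 3 \<otimes> W (i - 1)
    \<and> V (i + int k - 1) = m i k 2 1 \<otimes> V (i - 2) \<oplus> m i k 2 2 \<otimes> V (i - 1) \<oplus> m i k 2 3 \<otimes> W (i - 1)
    \<and> W (i + int k - 1) = m i k 3 1 \<otimes> V (i - 2) \<oplus> m i k 3 2 \<otimes> V (i - 1) \<oplus> m i k 3 3 \<otimes> W (i - 1)"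
proof -
  have VW: "V j \<in> carrier R" "W j \<in> carrier R" for j
    using sturm_liouville_solutionD(1,2)[OF assms] by blast+
  show ?thesis
  proof (induction k)
    case 0
    then show ?case using VW by (simp add: m_0 del: monodromy.simps)
  next
    case (Suc k)
    have ab: "a (i + int k) \<in> carrier R" "b (i + int k) \<in> carrier R"
      by (simp_all add: psi_closed hill_a_in hill_b_in n)
    have eqs: "V (i + int k) = a (i + int k) \<otimes> V (i + int k - 1) \<ominus> V (i + int k - 2) \<ominus> b (i + int k) \<otimes> W (i + int k - 1)"
      "W (i + int k) = W (i + int k - 1) \<oplus> b (i + int k) \<otimes> V (i + int k - 1)"
      by (rule sturm_liouville_solutionD[OF assms])+
    have idx: "i + int (Suc k) - 2 = i + int k - 1" "i + int (Suc k) - 1 = i + int k" by simp_all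
    note IH = Suc.IH[THEN conjunct1] Suc.IH[THEN conjunct2, THEN conjunct1] Suc.IH[THEN conjunct2, THEN conjunct2]
    show ?case
      unfolding idx m_Suc eqs
      unfolding IH
      by (intro conjI refl R.three_term_rows(1)[OF ab]
          R.three_term_rows(2)[OF ab, where ?p1.0 = \<zero> and ?q1.0 = \<zero> and ?r1.0 = \<zero>]) (simp_all add: VW)
  qed
qed

lemma unit_solution:
  assumes "u \<in> carrier R" "v \<in> carrier R" "w \<in> carrier R"
  obtains V W where "sturm_liouville_solution R a b V W" "V (i - 2) = u" "V (i - 1) = v" "W (i - 1) = w"
proof -
  define C where "C = carrier R \<times> carrier R \<times> carrier R"
  define rel where "rel j s s' = (case (s, s') of ((x, y, z), (x', y', z')) \<Rightarrow>
      x' = y \<and> y' = a j \<otimes> y \<ominus> x \<ominus> b j \<otimes> z \<and> z' = z \<oplus> b j \<otimes> y)" for j s s'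
  have ab: "a j \<in> carrier R" "b j \<in> carrier R" for j
    by (simp_all add: psi_closed hill_a_in hill_b_in n)
  have fwd: "\<exists>s'\<in>C. rel j s s'" if "s \<in> C" for j s
    using that ab by (auto simp: C_def rel_def)
  have bwd: "\<exists>s'\<in>C. rel j s' s" if sC: "s \<in> C" for j s
  proof -
    obtain x y z where s: "s = (x, y, z)" "x \<in> carrier R" "y \<in> carrier R" "z \<in> carrier R"
      using sC by (cases s) (auto simp: C_def)
    \<comment> \<open>Backward step: the state before \<open>(x, y, z)\<close> is
      \<open>(x', x, z')\<close>. The equation for \<open>W\<close> gives \<open>z'\<close>, and
      then the equation for \<open>V\<close> gives \<open>x'\<close>.\<close>
    define z' where "z' = z \<ominus> b j \<otimes> x"
    define x' where "x' = a j \<otimes> x \<ominus> y \<ominus> b j \<otimes> z'"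
    have z': "z' \<in> carrier R" using s ab by (simp add: z'_def)
    have "z = z' \<oplus> b j \<otimes> x"
      using s ab by (simp add: z'_def a_minus_def R.a_assoc R.l_neg)
    moreover have "y = a j \<otimes> x \<ominus> x' \<ominus> b j \<otimes> z'"
      using s ab z' by (simp add: x'_def R.minus_minus_cancel)
    ultimately have "rel j (x', x, z') s" by (simp add: rel_def s(1))
    moreover have "(x', x, z') \<in> C" using s ab z' by (simp add: C_def x'_def)
    ultimately show ?thesis by blast
  qed
  obtain S where S: "S (i - 1) = (u, v, w)" "\<And>j. S j \<in> C" "\<And>j. rel j (S (j - 1)) (S j)"
    by (rule two_sided_sequence[of C rel "(u, v, w)" "i - 1"]) (use fwd bwd assms in \<open>auto simp: C_def\<close>)
  define V where "V j = fst (snd (S j))" for j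
  define W where "W j = snd (snd (S j))" for j
  have Sj: "S j = (V (j - 1), V j, W j)" for j
    using S(3)[of j] by (auto simp: V_def W_def rel_def split: prod.splits)
  have "V j = a j \<otimes> V (j - 1) \<ominus> V (j - 2) \<ominus> b j \<otimes> W (j - 1) \<and> W j = W (j - 1) \<oplus> b j \<otimes> V (j - 1)" for j
    using S(3)[of j] Sj[of j] Sj[of "j - 1"] by (simp add: rel_def)
  moreover have "V j \<in> carrier R" "W j \<in> carrier R" for j
    using S(2)[of j] unfolding Sj by (simp_all add: C_def)
  ultimately have "sturm_liouville_solution R a b V W"
    unfolding sturm_liouville_solution_def by blast
  moreover have "V (i - 2) = u" "V (i - 1) = v" "W (i - 1) = w"
    using S(1) Sj[of "i - 1"] by simp_all
  ultimately show ?thesis using that by blast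
qed

text \<open>Solutions whose initial states are the three unit vectors read off the columns of the
  monodromy matrix. Such initial values are available because solutions carry no parity
  condition.\<close>

lemma monodromy_of_periodic_solutions:
  assumes "\<And>V W j. sturm_liouville_solution R a b V W \<Longrightarrow> V (j + int n) = \<ominus> V j \<and> W (j + int n) = W j"
  shows "\<psi> ((M i - hill_monodromy) $ r $ s) = \<zero>"
proof -
  have entries: "m i n 1 1 \<otimes> u \<oplus> m i n 1 2 \<otimes> v \<oplus> m i n 1 3 \<otimes> w = \<ominus> u
    \<and> m i n 2 1 \<otimes> u \<oplus> m i n 2 2 \<otimes> v \<oplus> m i n 2 3 \<otimes> w = \<ominus> v
    \<and> m i n 3 1 \<otimes> u \<oplus> m i n 3 2 \<otimes> v \<oplus> m i n 3 3 \<otimes> w = w"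
    if uvw: "u \<in> carrier R" "v \<in> carrier R" "w \<in> carrier R" for u v w
  proof -
    obtain V W where VW: "sturm_liouville_solution R a b V W" "V (i - 2) = u" "V (i - 1) = v" "W (i - 1) = w"
      by (rule unit_solution[OF uvw])
    have "V (i + int n - 2) = \<ominus> u" "V (i + int n - 1) = \<ominus> v" "W (i + int n - 1) = w"
      using assms[OF VW(1), of "i - 2"] assms[OF VW(1), of "i - 1"] VW(2-4)
      by (simp_all add: algebra_simps)
    then show ?thesis using solution_monodromy[OF VW(1), of i n] VW(2-4) by simp
  qed
  have "\<forall>r s. m i n r s = \<psi> (hill_monodromy $ r $ s)"
    unfolding forall_3
    using entries[of \<one> \<zero> \<zero>] entries[of \<zero> \<one> \<zero>] entries[of \<zero> \<zero> \<one>]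
    by (simp add: psi_one psi_zero psi_uminus)
  then have "m i n r s = \<psi> (hill_monodromy $ r $ s)" by blast
  then show ?thesis
    using psi_closed[OF hill_monodromy_in[of r s]]
    by (simp add: psi_diff monodromy_in hill_monodromy_in a_minus_def R.r_neg)
qed

lemma periodic_of_monodromy:
  assumes "\<And>i r s. \<psi> ((M i - hill_monodromy) $ r $ s) = \<zero>" "sturm_liouville_solution R a b V W"
  shows "V (j + int n) = \<ominus> V j \<and> W (j + int n) = W j"
proof -
  have VW: "V j \<in> carrier R" "W j \<in> carrier R" for j
    using sturm_liouville_solutionD(1,2)[OF assms(2)] by blast+
  have "m i n r s = \<psi> (hill_monodromy $ r $ s)" for i r s
  proof -
    have "m i n r s \<ominus> \<psi> (hill_monodromy $ r $ s) = \<zero>"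
      using assms(1)[of i r s] by (simp add: psi_diff monodromy_in hill_monodromy_in)
    then show ?thesis using psi_closed[OF hill_monodromy_in[of r s]] by simp
  qed
  then have m: "m i n 1 1 = \<ominus> \<one>" "m i n 1 2 = \<zero>" "m i n 1 3 = \<zero>"
    "m i n 3 1 = \<zero>" "m i n 3 2 = \<zero>" "m i n 3 3 = \<one>" for i
    by (simp_all add: psi_one psi_zero psi_uminus)
  \<comment> \<open>The first row at starting index \<open>j + 2\<close> gives the claim for
    \<open>V j\<close>, the third row at starting index \<open>j + 1\<close> the one for
    \<open>W j\<close>.\<close>
  show ?thesis
    using solution_monodromy[OF assms(2), of "j + 2" n] solution_monodromy[OF assms(2), of "j + 1" n] VW
    by (simp add: m R.l_minus algebra_simps)
qed

end

context hill_superspace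
begin

lemma superalg_homsD:
  assumes "\<phi> \<in> superalg_homs Q R"
  shows "f \<in> superpolys_in {1..n} \<Longrightarrow> \<phi> (proj f) \<in> carrier R"
    and "f \<in> superpolys_in {1..n} \<Longrightarrow> g \<in> superpolys_in {1..n}
      \<Longrightarrow> \<phi> (proj (f + g)) = \<phi> (proj f) \<oplus>\<^bsub>R\<^esub> \<phi> (proj g)"
    and "f \<in> superpolys_in {1..n} \<Longrightarrow> g \<in> superpolys_in {1..n}
      \<Longrightarrow> \<phi> (proj (f * g)) = \<phi> (proj f) \<otimes>\<^bsub>R\<^esub> \<phi> (proj g)"
    and "\<phi> (proj 1) = \<one>\<^bsub>R\<^esub>"
    and "f \<in> superpolys_in {1..n} \<Longrightarrow> f \<in> grassmann_part True \<Longrightarrow> \<phi> (proj f) \<in> even_part R"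
    and "f \<in> superpolys_in {1..n} \<Longrightarrow> f \<in> grassmann_part False \<Longrightarrow> \<phi> (proj f) \<in> odd_part R"
    and "\<phi> (proj (gconst (Poly_Mapping.single 0 c))) = scalar R c"
proof -
  have hom: "\<phi> \<in> ring_hom Q R" and ev: "\<phi> ` even_part Q \<subseteq> even_part R" and od: "\<phi> ` odd_part Q \<subseteq> odd_part R"
    and sc: "\<phi> (scalar Q c) = scalar R c"
    using assms by (simp_all add: superalg_homs_def)
  have Q: "proj f \<in> carrier Q" if "f \<in> superpolys_in {1..n}" for f
    unfolding Q_carrier using that by (rule imageI)
  show "f \<in> superpolys_in {1..n} \<Longrightarrow> \<phi> (proj f) \<in> carrier R"
    by (rule ring_hom_closed[OF hom Q])
  show "f \<in> superpolys_in {1..n} \<Longrightarrow> g \<in> superpolys_in {1..n}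
      \<Longrightarrow> \<phi> (proj (f + g)) = \<phi> (proj f) \<oplus>\<^bsub>R\<^esub> \<phi> (proj g)"
    using ring_hom_add[OF hom Q Q, of f g] by (simp only: proj_add)
  show "f \<in> superpolys_in {1..n} \<Longrightarrow> g \<in> superpolys_in {1..n}
      \<Longrightarrow> \<phi> (proj (f * g)) = \<phi> (proj f) \<otimes>\<^bsub>R\<^esub> \<phi> (proj g)"
    using ring_hom_mult[OF hom Q Q, of f g] by (simp only: proj_mult)
  show "\<phi> (proj 1) = \<one>\<^bsub>R\<^esub>"
    using ring_hom_one[OF hom] by (simp only: proj_one)
  show "f \<in> superpolys_in {1..n} \<Longrightarrow> f \<in> grassmann_part True \<Longrightarrow> \<phi> (proj f) \<in> even_part R"
    using ev unfolding Q_parts by blast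
  show "f \<in> superpolys_in {1..n} \<Longrightarrow> f \<in> grassmann_part False \<Longrightarrow> \<phi> (proj f) \<in> odd_part R"
    using od unfolding Q_parts by blast
  show "\<phi> (proj (gconst (Poly_Mapping.single 0 c))) = scalar R c"
    using sc unfolding Q_parts .
qed

lemma superalg_homs_point:
  assumes "supercommutative_superalgebra R" "\<phi> \<in> superalg_homs Q R"
  shows "superpoly_point n R (\<lambda>f. \<phi> (proj f))"
  by (intro superpoly_point.intro superpoly_point_axioms.intro hill_superspace_axioms assms(1)
      superalg_homsD[OF assms(2)])

lemma hill_potential_in:
  assumes R: "supercommutative_superalgebra R" and \<phi>: "\<phi> \<in> superalg_homs Q R"
  shows "hill_potential n \<phi> \<in> hill_equations n R"
proof -
  interpret P: superpoly_point n k_type R "\<lambda>f. \<phi> (proj f)" by (rule superalg_homs_point[OF assms])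
  have "\<phi> (proj ((M i - hill_monodromy) $ r $ s)) = \<zero>\<^bsub>R\<^esub>" for i r s
  proof -
    have "proj ((M i - hill_monodromy) $ r $ s) = proj 0"
      unfolding proj_zero using proj_eq_zero_iff[OF generators_in[of i r s]] generator_in_I[of i r s] by (rule iffD2)
    then show ?thesis unfolding P.psi_zero[symmetric] by (rule arg_cong)
  qed
  note periodic = P.periodic_of_monodromy[OF this]
  show ?thesis
    unfolding hill_equations_def hill_potential_def mem_Collect_eq prod.case
  proof (intro conjI allI impI)
    show "range P.a \<subseteq> even_part R"
      by (rule image_subsetI) (rule superalg_homsD(5)[OF \<phi> hill_a_in[OF n] hill_a_even])
    show "range P.b \<subseteq> odd_part R"
      by (rule image_subsetI) (rule superalg_homsD(6)[OF \<phi> hill_b_in[OF n] hill_b_odd])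
    show "P.a (i + int n) = P.a i" for i by (simp add: hill_a_periodic)
    show "P.b (i + int n) = \<ominus>\<^bsub>R\<^esub> P.b i" for i
      using P.psi_uminus[of "hill_b n i"] by (simp add: hill_b_antiperiodic hill_b_in n)
    fix V W i assume "sturm_liouville_solution R P.a P.b V W"
    from periodic[OF this, of i] show "V (i + int n) = \<ominus>\<^bsub>R\<^esub> V i" "W (i + int n) = W i" by blast+
  qed
qed

lemma hill_potential_inj:
  assumes \<phi>: "\<phi> \<in> superalg_homs Q R" and \<phi>': "\<phi>' \<in> superalg_homs Q R"
    and eq: "hill_potential n \<phi> = hill_potential n \<phi>'"
  shows "\<phi> = \<phi>'"
proof -
  have eqs: "\<phi> (proj (hill_a n i)) = \<phi>' (proj (hill_a n i))" "\<phi> (proj (hill_b n i)) = \<phi>' (proj (hill_b n i))" for i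
    using eq unfolding hill_potential_def prod.inject fun_eq_iff by blast+
  have "f \<in> superpolys_in {1..n} \<inter> {f. \<phi> (proj f) = \<phi>' (proj f)}" if "f \<in> superpolys_in {1..n}" for f
    using that
  proof (rule superpoly_generated)
    fix i assume i: "i \<in> {1..n}"
    show "even_var i \<in> superpolys_in {1..n} \<inter> {f. \<phi> (proj f) = \<phi>' (proj f)}"
      using eqs(1)[of "int i"] unfolding hill_a_nat[OF i] by (simp add: superpolys_in_even_var[OF i])
    show "odd_var i \<in> superpolys_in {1..n} \<inter> {f. \<phi> (proj f) = \<phi>' (proj f)}"
      using eqs(2)[of "int i"] unfolding hill_b_nat[OF i] by (simp add: superpolys_in_odd_var[OF i])
  qed (simp_all add: superpolys_in_scalar superpolys_in_add superpolys_in_mult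
      superalg_homsD[OF \<phi>] superalg_homsD[OF \<phi>'])
  then have "\<phi> x = \<phi>' x" if "x \<in> carrier Q" for x
    using that unfolding Q_carrier by blast
  moreover have "\<phi> \<in> extensional (carrier Q)" "\<phi>' \<in> extensional (carrier Q)"
    using \<phi> \<phi>' by (simp_all add: superalg_homs_def)
  ultimately show ?thesis by (intro extensionalityI)
qed

lemma point_factors:
  assumes "superpoly_point n R \<psi>" and kill: "\<And>i r s. \<psi> ((M i - hill_monodromy) $ r $ s) = \<zero>\<^bsub>R\<^esub>"
    and f: "f \<in> I"
  shows "\<psi> f = \<zero>\<^bsub>R\<^esub>"
proof -
  interpret P: superpoly_point n k_type R \<psi> by (rule assms(1))
  let ?J = "{f \<in> superpolys_in {1..n}. \<psi> f = \<zero>\<^bsub>R\<^esub>}"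
  have "I \<subseteq> ?J"
  proof (rule I_minimal)
    show "ideal ?J B"
      by (rule idealI_superpolys)
        (auto simp: P.psi_zero P.psi_add P.psi_mult P.psi_closed superpolys_in_add superpolys_in_mult)
  qed (use kill generators_in in blast)
  then show ?thesis using f by blast
qed

text \<open>Evaluating superpolynomials at the potential kills the generators of \<open>I\<close>
  because all solutions are (anti)periodic; so the evaluation descends to the quotient.\<close>

lemma hill_potential_surj:
  assumes R: "supercommutative_superalgebra R" and ab: "(a, b) \<in> hill_equations n R"
  obtains \<phi> where "\<phi> \<in> superalg_homs Q R" "hill_potential n \<phi> = (a, b)"
proof -
  interpret R: supercommutative_superalgebra R by (rule R)
  have a: "a i \<in> even_part R" and b: "b i \<in> odd_part R"
    and a_per: "a (i + int n) = a i" and b_per: "b (i + int n) = \<ominus>\<^bsub>R\<^esub> b i" for i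
    using ab unfolding hill_equations_def by auto
  have periodic: "V (i + int n) = \<ominus>\<^bsub>R\<^esub> V i \<and> W (i + int n) = W i"
    if "sturm_liouville_solution R a b V W" for V W i
    using ab that unfolding hill_equations_def by blast
  interpret E: superalg_evaluation R "\<lambda>i. a (int i)" "\<lambda>i. b (int i)"
    by unfold_locales (use a b in auto)
  let ?\<psi> = E.superpoly_eval
  interpret P: superpoly_point n k_type R ?\<psi>
    by unfold_locales (simp_all add: E.superpoly_eval_add E.superpoly_eval_mult)
  have a_shift: "a (i + int k * int n) = a i" for i k
  proof (induction k)
    case (Suc k)
    have "a (i + int (Suc k) * int n) = a (i + int k * int n + int n)" by (simp add: algebra_simps)
    then show ?case using Suc a_per by simp
  qed simp
  have b_carr: "b i \<in> carrier R" for i using b R.odd_subset by blast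
  have b_shift: "b (i + int k * int n) = (if even k then b i else \<ominus>\<^bsub>R\<^esub> b i)" for i k
  proof (induction k)
    case (Suc k)
    have "b (i + int (Suc k) * int n) = b (i + int k * int n + int n)" by (simp add: algebra_simps)
    then show ?case using Suc b_per b_carr by simp
  qed simp
  have idx: "int (nat (1 + (i - 1) mod int n)) = 1 + (i - 1) mod int n" for i
    using n by simp
  have split: "1 + (i - 1) mod int n + (i - 1) div int n * int n = i"
    "i + - ((i - 1) div int n) * int n = 1 + (i - 1) mod int n" for i
    using div_mult_mod_eq[of "i - 1" "int n"] by linarith+
  \<comment> \<open>\<open>hill_a n i\<close> is the variable of the residue of \<open>i\<close> in
    \<open>{1..n}\<close>. The shift by natural multiples of \<open>n\<close> starts from the
    residue if the quotient is nonnegative, and from \<open>i\<close> otherwise.\<close>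
  have ea: "?\<psi> (hill_a n i) = a i" for i
  proof -
    let ?r = "1 + (i - 1) mod int n" and ?q = "(i - 1) div int n"
    have "a i = a ?r"
    proof (cases "?q \<ge> 0")
      case True
      then have "int (nat ?q) = ?q" by simp
      then show ?thesis using a_shift[of ?r "nat ?q"] by (simp only: split)
    next
      case False
      then have "int (nat (- ?q)) = - ?q" by simp
      then show ?thesis using a_shift[of i "nat (- ?q)"] by (simp only: split)
    qed
    then show ?thesis by (simp add: hill_a_def E.superpoly_eval_even_var idx del: int_nat_eq)
  qed
  have eb: "?\<psi> (hill_b n i) = b i" for i
  proof -
    let ?r = "1 + (i - 1) mod int n" and ?q = "(i - 1) div int n"
    have "b i = (if even ?q then b ?r else \<ominus>\<^bsub>R\<^esub> b ?r)"
    proof (cases "?q \<ge> 0")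
      case True
      then have "int (nat ?q) = ?q" "even (nat ?q) = even ?q" by (simp_all add: even_nat_iff)
      then show ?thesis using b_shift[of ?r "nat ?q"] by (simp only: split)
    next
      case False
      then have "int (nat (- ?q)) = - ?q" "even (nat (- ?q)) = even ?q" by (simp_all add: even_nat_iff)
      then have "b ?r = (if even ?q then b i else \<ominus>\<^bsub>R\<^esub> b i)"
        using b_shift[of i "nat (- ?q)"] by (simp only: split)
      then show ?thesis using b_carr by simp
    qed
    then show ?thesis
      by (simp add: hill_b_def E.superpoly_eval_odd_var E.superpoly_eval_uminus idx del: int_nat_eq)
  qed
  have "?\<psi> ((M i - hill_monodromy) $ r $ s) = \<zero>\<^bsub>R\<^esub>" for i r s
  proof (rule P.monodromy_of_periodic_solutions)
    fix V W j assume "sturm_liouville_solution R P.a P.b V W"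
    then show "V (j + int n) = \<ominus>\<^bsub>R\<^esub> V j \<and> W (j + int n) = W j"
      using periodic unfolding ea eb by blast
  qed
  then have kill: "?\<psi> f = \<zero>\<^bsub>R\<^esub>" if "f \<in> I" for f
    using point_factors[OF P.superpoly_point_axioms] that by blast
  have eq: "?\<psi> f = ?\<psi> g" if "f \<in> superpolys_in {1..n}" "g \<in> superpolys_in {1..n}" "proj f = proj g" for f g
  proof -
    have "f - g \<in> I"
      using B.quotient_eq_iff_same_a_r_cos[OF ideal_I, of f g] that
      by (simp add: a_minus_def a_inv_affine_superspace)
    then have "?\<psi> f \<ominus>\<^bsub>R\<^esub> ?\<psi> g = \<zero>\<^bsub>R\<^esub>" using kill[of "f - g"] that by (simp add: P.psi_diff)
    then show ?thesis by simp
  qed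
  define \<phi> where "\<phi> = restrict (\<lambda>X. ?\<psi> (SOME f. f \<in> superpolys_in {1..n} \<and> proj f = X)) (carrier Q)"
  have \<phi>: "\<phi> (proj f) = ?\<psi> f" if f: "f \<in> superpolys_in {1..n}" for f
  proof -
    have "proj f \<in> carrier Q" unfolding Q_carrier using f by (rule imageI)
    then have val: "\<phi> (proj f) = ?\<psi> (SOME g. g \<in> superpolys_in {1..n} \<and> proj g = proj f)"
      unfolding \<phi>_def by (rule restrict_apply')
    have some: "(SOME g. g \<in> superpolys_in {1..n} \<and> proj g = proj f) \<in> superpolys_in {1..n}
      \<and> proj (SOME g. g \<in> superpolys_in {1..n} \<and> proj g = proj f) = proj f"
      by (rule someI[of _ f]) (use f in simp)
    show ?thesis using val eq[OF conjunct1[OF some] f conjunct2[OF some]] by (rule trans)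
  qed
  have "\<phi> \<in> superalg_homs Q R"
    unfolding superalg_homs_def mem_Collect_eq
  proof (intro conjI allI)
    show "\<phi> \<in> ring_hom Q R"
    proof (rule ring_hom_memI)
      fix x assume "x \<in> carrier Q"
      then obtain f where f: "f \<in> superpolys_in {1..n}" and x: "x = proj f"
        unfolding Q_carrier by (rule imageE)
      show "\<phi> x \<in> carrier R" unfolding x \<phi>[OF f] by (rule E.superpoly_eval_closed)
      fix y assume "y \<in> carrier Q"
      then obtain g where g: "g \<in> superpolys_in {1..n}" and y: "y = proj g"
        unfolding Q_carrier by (rule imageE)
      show "\<phi> (x \<otimes>\<^bsub>Q\<^esub> y) = \<phi> x \<otimes>\<^bsub>R\<^esub> \<phi> y"
        unfolding x y proj_mult[OF f g] \<phi>[OF f] \<phi>[OF g] \<phi>[OF superpolys_in_mult[OF f g]]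
        by (rule E.superpoly_eval_mult)
      show "\<phi> (x \<oplus>\<^bsub>Q\<^esub> y) = \<phi> x \<oplus>\<^bsub>R\<^esub> \<phi> y"
        unfolding x y proj_add[OF f g] \<phi>[OF f] \<phi>[OF g] \<phi>[OF superpolys_in_add[OF f g]]
        by (rule E.superpoly_eval_add)
    next
      show "\<phi> \<one>\<^bsub>Q\<^esub> = \<one>\<^bsub>R\<^esub>" unfolding proj_one[symmetric] \<phi>[OF superpolys_in_1] by (rule E.superpoly_eval_one)
    qed
    show "\<phi> \<in> extensional (carrier Q)" by (simp add: \<phi>_def)
    show "\<phi> ` even_part Q \<subseteq> even_part R" "\<phi> ` odd_part Q \<subseteq> odd_part R"
      unfolding Q_parts using E.superpoly_eval_part[of _ True] E.superpoly_eval_part[of _ False] \<phi>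
      by (simp_all add: image_subset_iff)
    show "\<phi> (scalar Q c) = scalar R c" for c
      unfolding Q_parts \<phi>[OF superpolys_in_scalar] by (rule E.superpoly_eval_scalar)
  qed
  moreover have "hill_potential n \<phi> = (a, b)"
    unfolding hill_potential_def \<phi>[OF hill_a_in[OF n]] \<phi>[OF hill_b_in[OF n]] ea eb by (rule refl)
  ultimately show ?thesis using that by blast
qed

lemma bij_hill_potential:
  assumes "supercommutative_superalgebra R"
  shows "bij_betw (hill_potential n) (superalg_homs Q R) (hill_equations n R)"
  unfolding bij_betw_def
proof
  show "inj_on (hill_potential n) (superalg_homs Q R)"
    by (rule inj_onI) (rule hill_potential_inj)
  show "hill_potential n ` superalg_homs Q R = hill_equations n R"
  proof
    show "hill_potential n ` superalg_homs Q R \<subseteq> hill_equations n R"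
      using hill_potential_in[OF assms] by blast
    show "hill_equations n R \<subseteq> hill_potential n ` superalg_homs Q R"
      using hill_potential_surj[OF assms] by (metis image_eqI subrelI)
  qed
qed

end


section \<open>Orthosymplectic relations\<close>

lemma monodromy_cong:
  assumes "\<And>j. i \<le> j \<Longrightarrow> j < i + int k \<Longrightarrow> a j = a' j" "\<And>j. i \<le> j \<Longrightarrow> j < i + int k \<Longrightarrow> b j = b' j"
  shows "monodromy a b i k = monodromy a' b' i k"
  using assms by (induction k) (simp_all add: monodromy.simps)

lemma even_even_commute:
  fixes u v w :: "'c::comm_ring_1 grassmann"
  shows "u \<in> grassmann_part True \<Longrightarrow> v \<in> grassmann_part True \<Longrightarrow> u * v = v * u"
    and "u \<in> grassmann_part True \<Longrightarrow> v \<in> grassmann_part True \<Longrightarrow> u * (v * w) = v * (u * w)"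
  using grassmann_part_commute[of u True v True] by (simp_all flip: mult.assoc)

lemma odd_even_commute:
  fixes u v w :: "'c::comm_ring_1 grassmann"
  assumes "u \<in> grassmann_part False" "v \<in> grassmann_part True"
  shows "u * v = v * u" "u * (v * w) = v * (u * w)"
  using grassmann_part_commute[OF assms] by (simp_all flip: mult.assoc)

lemma odd_odd_anticommute:
  fixes u v w :: "'c::comm_ring_1 grassmann"
  assumes "u \<in> grassmann_part False" "v \<in> grassmann_part False"
  shows "u * v = - (v * u)" "u * (v * w) = - (v * (u * w))"
  using grassmann_part_commute[OF assms] by (simp_all flip: mult.assoc)

context
  fixes a b c d x \<xi> \<alpha> \<beta> :: "'c::{idom, ring_char_0} grassmann"
  assumes even: "a \<in> grassmann_part True" "b \<in> grassmann_part True" "c \<in> grassmann_part True"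
      "d \<in> grassmann_part True" "x \<in> grassmann_part True"
    and odd: "\<xi> \<in> grassmann_part False" "\<alpha> \<in> grassmann_part False" "\<beta> \<in> grassmann_part False"
begin

text \<open>Rules for a normal form: even factors stand left of odd ones, odd factors appear in the
  order \<open>\<xi>\<close>, \<open>\<alpha>\<close>, \<open>\<beta>\<close>, and a repeated odd
  factor gives zero.\<close>

lemmas super_simps = even_even_commute even
  odd_even_commute[OF odd(1) even(1)] odd_even_commute[OF odd(1) even(2)] odd_even_commute[OF odd(1) even(3)]
  odd_even_commute[OF odd(1) even(4)] odd_even_commute[OF odd(1) even(5)]
  odd_even_commute[OF odd(2) even(1)] odd_even_commute[OF odd(2) even(2)] odd_even_commute[OF odd(2) even(3)]
  odd_even_commute[OF odd(2) even(4)] odd_even_commute[OF odd(2) even(5)]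
  odd_even_commute[OF odd(3) even(1)] odd_even_commute[OF odd(3) even(2)] odd_even_commute[OF odd(3) even(3)]
  odd_even_commute[OF odd(3) even(4)] odd_even_commute[OF odd(3) even(5)]
  odd_odd_anticommute[OF odd(2) odd(1)] odd_odd_anticommute[OF odd(3) odd(1)] odd_odd_anticommute[OF odd(3) odd(2)]
  odd_square_zero[OF odd(1)] odd_square_zero[OF odd(2)] odd_square_zero[OF odd(3)]

text \<open>
  The relations between the entries of a matrix
  \<open>((a, b, \<gamma>), (c, d, \<delta>), (\<alpha>, \<beta>, e))\<close> of \<open>OSp(1|2)\<close> persist under left multiplication by
  \<open>step_matrix x \<xi>\<close>.
\<close>

lemma osp_step:
  assumes det: "a * d - b * c + \<alpha> * \<beta> = 1"
  defines "e \<equiv> 1 + \<alpha> * \<beta>" and "\<gamma> \<equiv> a * \<beta> - \<alpha> * b" and "\<delta> \<equiv> c * \<beta> - \<alpha> * d"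
    and "c' \<equiv> x * c - a - \<xi> * \<alpha>" and "d' \<equiv> x * d - b - \<xi> * \<beta>"
    and "\<alpha>' \<equiv> \<xi> * c + \<alpha>" and "\<beta>' \<equiv> \<xi> * d + \<beta>"
  shows "c * d' - d * c' + \<alpha>' * \<beta>' = 1"
    and "\<xi> * \<delta> + e = 1 + \<alpha>' * \<beta>'"
    and "\<delta> = c * \<beta>' - \<alpha>' * d"
    and "x * \<delta> - \<gamma> - \<xi> * e = c' * \<beta>' - \<alpha>' * d'"
proof -
  \<comment> \<open>The determinant relation becomes a rewrite rule eliminating
    \<open>a * d\<close>; \<open>ad'\<close> is the same rule inside right-nested products.\<close>
  have ad: "a * d = 1 + b * c - \<alpha> * \<beta>" using det by (simp add: algebra_simps)
  have ad': "a * (d * z) = z + b * (c * z) - \<alpha> * (\<beta> * z)" for z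
  proof -
    have "a * (d * z) = (a * d) * z" by (simp add: mult.assoc)
    then show ?thesis unfolding ad by (simp add: algebra_simps)
  qed
  note s = e_def \<gamma>_def \<delta>_def c'_def d'_def \<alpha>'_def \<beta>'_def
  show "c * d' - d * c' + \<alpha>' * \<beta>' = 1"
    unfolding s by (simp add: algebra_simps super_simps ad ad')
  show "\<xi> * \<delta> + e = 1 + \<alpha>' * \<beta>'"
    unfolding s by (simp add: algebra_simps super_simps ad ad')
  show "\<delta> = c * \<beta>' - \<alpha>' * d"
    unfolding s by (simp add: algebra_simps super_simps ad ad')
  show "x * \<delta> - \<gamma> - \<xi> * e = c' * \<beta>' - \<alpha>' * d'"
    unfolding s by (simp add: algebra_simps super_simps ad ad')
qed

text \<open>
  The case \<open>d = 1\<close>, followed by the steps with \<open>(x, \<xi>) = (b, - \<beta>)\<close> and \<open>(x, \<xi>) = (- c, - \<delta>)\<close>.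
\<close>

lemma osp_closing:
  assumes det: "a - b * c + \<alpha> * \<beta> = 1"
  defines "e \<equiv> 1 + \<alpha> * \<beta>" and "\<gamma> \<equiv> a * \<beta> - \<alpha> * b" and "\<delta> \<equiv> c * \<beta> - \<alpha>"
  shows "b * c - a + \<beta> * \<alpha> = - 1" "b * \<delta> - \<gamma> + \<beta> * e = 0"
    "- (\<beta> * \<delta>) + e = 1" "\<delta> * (\<alpha> - \<beta> * c) = 0" "\<delta> + (\<alpha> - \<beta> * c) = 0" "\<beta> * \<beta> = 0"
proof -
  have a: "a = 1 + b * c - \<alpha> * \<beta>" using det by (simp add: algebra_simps)
  note s = e_def \<gamma>_def \<delta>_def a
  show "b * c - a + \<beta> * \<alpha> = - 1" "b * \<delta> - \<gamma> + \<beta> * e = 0"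
    "- (\<beta> * \<delta>) + e = 1" "\<delta> * (\<alpha> - \<beta> * c) = 0" "\<delta> + (\<alpha> - \<beta> * c) = 0" "\<beta> * \<beta> = 0"
    unfolding s by (simp_all add: algebra_simps super_simps)
qed

end

text \<open>The identity matrix satisfies these relations and \<open>osp_step\<close> preserves
  them. They express the third column by the other six entries, which is why the matrix condition
  reduces to so few equations.\<close>

lemma monodromy_osp:
  fixes a b :: "int \<Rightarrow> 'c::{idom, ring_char_0} grassmann" and i :: int
  assumes a: "\<And>j. a j \<in> grassmann_part True" and b: "\<And>j. b j \<in> grassmann_part False"
  defines "C k \<equiv> monodromy a b i k"
  shows "C k $ 1 $ 1 * C k $ 2 $ 2 - C k $ 1 $ 2 * C k $ 2 $ 1 + C k $ 3 $ 1 * C k $ 3 $ 2 = 1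
    \<and> C k $ 3 $ 3 = 1 + C k $ 3 $ 1 * C k $ 3 $ 2
    \<and> C k $ 1 $ 3 = C k $ 1 $ 1 * C k $ 3 $ 2 - C k $ 3 $ 1 * C k $ 1 $ 2
    \<and> C k $ 2 $ 3 = C k $ 2 $ 1 * C k $ 3 $ 2 - C k $ 3 $ 1 * C k $ 2 $ 2"
proof (induction k)
  case 0
  then show ?case by (simp add: C_def mat_def)
next
  case (Suc k)
  note par = monodromy_grassmann_part[of i k a b, OF a b, folded C_def]
  have E: "C k $ 1 $ 1 \<in> grassmann_part True" "C k $ 1 $ 2 \<in> grassmann_part True"
    "C k $ 2 $ 1 \<in> grassmann_part True" "C k $ 2 $ 2 \<in> grassmann_part True"
    and O: "C k $ 3 $ 1 \<in> grassmann_part False" "C k $ 3 $ 2 \<in> grassmann_part False"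
    using par[of 1 1] par[of 1 2] par[of 2 1] par[of 2 2] par[of 3 1] par[of 3 2] by simp_all
  have comm: "C k $ 2 $ 2 * (a (i + int k) * C k $ 2 $ 1 - C k $ 1 $ 1 - b (i + int k) * C k $ 3 $ 1)
      = (a (i + int k) * C k $ 2 $ 1 - C k $ 1 $ 1 - b (i + int k) * C k $ 3 $ 1) * C k $ 2 $ 2"
    using grassmann_part_commute[OF E(4) monodromy_grassmann_part[of i "Suc k" a b 2 1, OF a b]]
    by (simp add: C_def)
  have comm': "C k $ 2 $ 2 * C k $ 2 $ 1 = C k $ 2 $ 1 * C k $ 2 $ 2"
    using grassmann_part_commute[OF E(4) E(3)] by simp
  note * = osp_step[OF E a[of "i + int k"] b[of "i + int k"] O, OF conjunct1[OF Suc.IH]]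
  have IH: "C k $ 3 $ 3 = 1 + C k $ 3 $ 1 * C k $ 3 $ 2"
    "C k $ 1 $ 3 = C k $ 1 $ 1 * C k $ 3 $ 2 - C k $ 3 $ 1 * C k $ 1 $ 2"
    "C k $ 2 $ 3 = C k $ 2 $ 1 * C k $ 3 $ 2 - C k $ 3 $ 1 * C k $ 2 $ 2"
    using Suc.IH by blast+
  show ?case
    unfolding C_def monodromy_Suc
    unfolding C_def[symmetric] IH
    using * by (intro conjI) (simp_all only:)
qed

text \<open>The direction opposite to elimination: a product with \<open>C $ 2 $ 2 = 1\<close> is
  closed up by two further steps whose coefficients are read off \<open>C\<close>. The
  orthosymplectic relations then leave exactly the identities of \<open>osp_closing\<close>.\<close>

lemma hill_monodromy_closing:
  fixes a b :: "int \<Rightarrow> 'c::{idom, ring_char_0} grassmann" and i :: int and k :: nat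
  assumes a: "\<And>j. a j \<in> grassmann_part True" and b: "\<And>j. b j \<in> grassmann_part False"
  defines "C \<equiv> monodromy a b i k"
  assumes "C $ 2 $ 2 = 1"
    and y: "a (i + int k) = C $ 1 $ 2" and z: "a (i + int k + 1) = - C $ 2 $ 1"
    and \<eta>: "b (i + int k) = - C $ 3 $ 2" and \<zeta>: "b (i + int k + 1) = - C $ 2 $ 3"
  shows "monodromy a b i (Suc (Suc k)) = hill_monodromy"
proof -
  note par = monodromy_grassmann_part[of i k a b, OF a b, folded C_def]
  have E: "C $ 1 $ 1 \<in> grassmann_part True" "C $ 1 $ 2 \<in> grassmann_part True"
    "C $ 2 $ 1 \<in> grassmann_part True" "C $ 2 $ 2 \<in> grassmann_part True"
    and O: "C $ 3 $ 1 \<in> grassmann_part False" "C $ 3 $ 2 \<in> grassmann_part False"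
    using par[of 1 1] par[of 1 2] par[of 2 1] par[of 2 2] par[of 3 1] par[of 3 2] by simp_all
  note osp = monodromy_osp[of a b i k, OF a b, folded C_def]
  have det: "C $ 1 $ 1 - C $ 1 $ 2 * C $ 2 $ 1 + C $ 3 $ 1 * C $ 3 $ 2 = 1"
    using osp \<open>C $ 2 $ 2 = 1\<close> by simp
  have e: "C $ 3 $ 3 = 1 + C $ 3 $ 1 * C $ 3 $ 2"
    and \<gamma>: "C $ 1 $ 3 = C $ 1 $ 1 * C $ 3 $ 2 - C $ 3 $ 1 * C $ 1 $ 2"
    and \<delta>: "C $ 2 $ 3 = C $ 2 $ 1 * C $ 3 $ 2 - C $ 3 $ 1"
    using osp \<open>C $ 2 $ 2 = 1\<close> by simp_all
  note cl = osp_closing[OF E one_even gvar_odd O det]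
  define N where "N = monodromy a b i (Suc k)"
  have N1: "N $ 1 $ s = C $ 2 $ s" for s by (simp add: N_def C_def)
  have N2: "N $ 2 $ 1 = - 1" "N $ 2 $ 2 = 0" "N $ 2 $ 3 = 0"
    using cl(1,2,6) \<open>C $ 2 $ 2 = 1\<close> unfolding N_def monodromy_Suc C_def[symmetric] y \<eta> e \<gamma> \<delta> by simp_all
  have N3: "N $ 3 $ 1 = C $ 3 $ 1 - C $ 3 $ 2 * C $ 2 $ 1" "N $ 3 $ 2 = 0" "N $ 3 $ 3 = 1"
    using cl(3) \<open>C $ 2 $ 2 = 1\<close> unfolding N_def monodromy_Suc C_def[symmetric] \<eta> e \<delta> by simp_all
  have idx: "i + int (Suc k) = i + int k + 1" by simp
  have "\<forall>r s. monodromy a b i (Suc (Suc k)) $ r $ s = hill_monodromy $ r $ s"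
    unfolding forall_3 monodromy_Suc(1)[of a b i "Suc k"] monodromy_Suc(2)[of a b i "Suc k"]
      monodromy_Suc(3)[of a b i "Suc k"] N_def[symmetric] idx N1 N2 N3 z \<zeta> \<open>C $ 2 $ 2 = 1\<close>
    using cl(4,5)[folded \<delta>] by simp
  then show ?thesis by (simp add: vec_eq_iff)
qed

section \<open>Independence of the starting index\<close>

lemma monodromy_shift:
  "monodromy a b (i + 1) k ** step_matrix (a i) (b i) = monodromy a b i (Suc k)"
proof (induction k)
  case 0
  then show ?case by (simp add: monodromy.simps)
next
  case (Suc k)
  have "monodromy a b (i + 1) (Suc k) ** step_matrix (a i) (b i)
    = step_matrix (a (i + int (Suc k))) (b (i + int (Suc k))) ** (monodromy a b (i + 1) k ** step_matrix (a i) (b i))"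
    by (simp add: monodromy.simps matrix_mul_assoc add_ac)
  then show ?case unfolding Suc by (simp add: monodromy.simps)
qed

definition step_inverse :: "'r::ring_1 \<Rightarrow> 'r \<Rightarrow> 'r ^ 3 ^ 3" where
  "step_inverse a b = vector [vector [a, -1, -b], vector [1, 0, 0], vector [-b, 0, 1]]"

lemma step_matrix_inverse:
  assumes "b * b = 0"
  shows "step_matrix a b ** step_inverse a b = mat 1" "step_inverse a b ** step_matrix a b = mat 1"
  using assms
  by (simp_all add: vec_eq_iff forall_3 matrix_matrix_mult_def sum_3 step_matrix_def step_inverse_def mat_def)

lemma step_matrix_conjugate:
  "step_matrix a (- b) = hill_monodromy ** step_matrix a b ** hill_monodromy"
  by (simp add: vec_eq_iff forall_3 matrix_matrix_mult_def sum_3 step_matrix_def)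

lemma hill_monodromy_square: "hill_monodromy ** hill_monodromy = mat 1"
  by (simp add: vec_eq_iff forall_3 matrix_matrix_mult_def sum_3 mat_def)

lemma hill_monodromy_shift:
  fixes a b :: "int \<Rightarrow> 'r::ring_1"
  assumes a: "\<And>j. a (j + int n) = a j" and b: "\<And>j. b (j + int n) = - b j"
    and sq: "\<And>j. b j * b j = 0"
  shows "monodromy a b i n = hill_monodromy \<longleftrightarrow> monodromy a b (i + 1) n = hill_monodromy"
proof -
  let ?A = "step_matrix (a i) (b i)" and ?A' = "step_inverse (a i) (b i)" and ?D = "hill_monodromy :: 'r ^ 3 ^ 3"
  have "monodromy a b (i + 1) n ** ?A = ?D ** ?A ** ?D ** monodromy a b i n"
    unfolding monodromy_shift by (simp add: monodromy.simps a b step_matrix_conjugate)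
  moreover have "?D ** ?A ** ?D ** ?D = ?D ** ?A"
    by (simp add: hill_monodromy_square flip: matrix_mul_assoc)
  ultimately have eq: "monodromy a b (i + 1) n ** ?A = ?D ** ?A" if "monodromy a b i n = ?D"
    using that by simp
  have eq': "?D ** ?A ** ?D ** monodromy a b i n = ?D ** ?A" if "monodromy a b (i + 1) n = ?D"
    using \<open>monodromy a b (i + 1) n ** ?A = ?D ** ?A ** ?D ** monodromy a b i n\<close> that by simp
  note inv = step_matrix_inverse[OF sq[of i], of "a i"]
  show ?thesis
  proof
    assume "monodromy a b i n = ?D"
    from arg_cong[OF eq[OF this], of "\<lambda>X. X ** ?A'"]
    show "monodromy a b (i + 1) n = ?D" by (simp add: inv flip: matrix_mul_assoc)
  next
    assume "monodromy a b (i + 1) n = ?D"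
    from arg_cong[OF eq'[OF this], of "\<lambda>X. ?D ** (?A' ** (?D ** X))"]
    have "?D ** (?A' ** (?D ** (?D ** (?A ** (?D ** monodromy a b i n))))) = ?D ** (?A' ** (?D ** (?D ** ?A)))"
      by (simp flip: matrix_mul_assoc)
    moreover have DD: "?D ** (?D ** X) = X" and AA: "?A' ** (?A ** X) = X" for X :: "'r ^ 3 ^ 3"
      by (simp_all add: matrix_mul_assoc hill_monodromy_square inv)
    ultimately show "monodromy a b i n = ?D" by (simp add: DD AA inv)
  qed
qed


section \<open>Elimination of the last two variables\<close>

text \<open>The determinant of the tridiagonal matrix with diagonal \<open>s\<close> and all
  off-diagonal entries 1.\<close>

fun continuant :: "(nat \<Rightarrow> 'a::comm_ring_1) \<Rightarrow> nat \<Rightarrow> 'a" where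
  "continuant s 0 = 1"
| "continuant s (Suc 0) = s 1"
| "continuant s (Suc (Suc k)) = s (Suc (Suc k)) * continuant s (Suc k) - continuant s k"

lemma gcoeff_odd_empty: "f \<in> grassmann_part False \<Longrightarrow> gcoeff f {} = 0"
  by (auto simp: grassmann_part_def)

text \<open>Taking bodies is multiplicative and kills the odd coefficients, so the recurrence for
  the rows becomes that of the continuant. The value 0 at \<open>k = 0\<close> stands for the
  continuant of length -1.\<close>

lemma monodromy_continuant:
  assumes "\<And>j. b j \<in> grassmann_part False"
  shows "gcoeff (monodromy a b 1 k $ 2 $ 2) {} = continuant (\<lambda>j. gcoeff (a (int j)) {}) k
    \<and> gcoeff (monodromy a b 1 k $ 1 $ 2) {} = (case k of 0 \<Rightarrow> 0 | Suc l \<Rightarrow> continuant (\<lambda>j. gcoeff (a (int j)) {}) l)"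
proof (induction k)
  case 0
  then show ?case by (simp add: mat_def gcoeff_one)
next
  case (Suc k)
  have idx: "1 + int k = int (Suc k)" by simp
  show ?case
    unfolding monodromy_Suc idx using Suc gcoeff_odd_empty[OF assms] by (cases k) (simp_all add: One_nat_def del: monodromy_Suc)
qed

abbreviation grassmann_algebra :: "('k::field_char_0, 'k grassmann) superalg" where
  "grassmann_algebra \<equiv> grassmann_superalg UNIV (\<lambda>c. c)"

lemma grassmann_algebra_supercommutative:
  "supercommutative_superalgebra (grassmann_algebra :: ('k::field_char_0, 'k grassmann) superalg)"
  by (rule grassmann_subalgebra.supercommutative[OF grassmann_subalgebra_UNIV])

locale hill_variety = hill_superspace n k_type for n and k_type :: "'k::field_char_0 itself" +
  fixes m :: nat
  assumes n_eq: "n = m + 2" and m: "m > 0"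
begin

abbreviation C :: "'k superpoly ^ 3 ^ 3" where "C \<equiv> monodromy (hill_a n) (hill_b n) 1 m"

lemma C_in: "C $ r $ s \<in> superpolys_in {1..m}"
proof (rule monodromy_superpolys_in)
  fix j assume "1 \<le> j" "j < 1 + int m"
  moreover from this obtain i where "j = int i" by (metis nonneg_int_cases order.trans zero_le_one)
  ultimately have i: "j = int i" "i \<in> {1..m}" by auto
  then have "i \<in> {1..n}" by (simp add: n_eq)
  with i show "hill_a n j \<in> superpolys_in {1..m}" "hill_b n j \<in> superpolys_in {1..m}"
    by (simp_all add: hill_a_nat hill_b_nat superpolys_in_even_var superpolys_in_odd_var)
qed

lemma superpolys_in_m: "f \<in> superpolys_in {1..m} \<Longrightarrow> f \<in> superpolys_in {1..n}"
  using superpolys_in_mono[of "{1..m}" "{1..n}"] by (auto simp: n_eq)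

lemma last_even_var: "even_var (Suc m) \<in> superpolys_in {1..n}" "even_var n \<in> superpolys_in {1..n}"
  and last_odd_var: "odd_var (Suc m) \<in> superpolys_in {1..n}" "odd_var n \<in> superpolys_in {1..n}"
  by (auto intro: superpolys_in_even_var superpolys_in_odd_var simp: n_eq)

text \<open>Undoing the last two steps expresses the rows of \<open>C\<close> through those of
  \<open>M 1\<close>. Replacing the latter by the rows of the diagonal target matrix changes the
  result only by multiples of the generators \<open>E r s\<close>.\<close>

lemma elimination:
  "C $ 2 $ 2 - 1 \<in> I"
  "even_var n + C $ 2 $ 1 \<in> I"
  "odd_var n + C $ 2 $ 3 \<in> I"
  "odd_var (Suc m) + C $ 3 $ 2 \<in> I"
  "even_var (Suc m) - C $ 1 $ 2 \<in> I"
proof -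
  let ?y = "even_var (Suc m) :: 'k superpoly" and ?\<eta> = "odd_var (Suc m) :: 'k superpoly"
  let ?z = "even_var n :: 'k superpoly" and ?\<zeta> = "odd_var n :: 'k superpoly"
  let ?D = "hill_monodromy :: 'k superpoly ^ 3 ^ 3"
  define E where "E r s = M 1 $ r $ s - ?D $ r $ s" for r s
  have E: "E r s \<in> I" for r s
    using generator_in_I[of 1 r s] by (simp add: E_def)
  have idx: "1 + int m = int (Suc m)" "1 + int (Suc m) = int n" by (simp_all add: n_eq)
  have vars: "hill_a n (int (Suc m)) = ?y" "hill_b n (int (Suc m)) = ?\<eta>"
    "hill_a n (int n) = ?z" "hill_b n (int n) = ?\<zeta>"
    by (rule hill_a_nat hill_b_nat, simp add: n_eq)+
  have nS: "n = Suc (Suc m)" by (simp add: n_eq)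
  define N :: "'k superpoly ^ 3 ^ 3" where "N = monodromy (hill_a n) (hill_b n) 1 (Suc m)"
  have MN: "M 1 $ 1 $ s = N $ 2 $ s" "M 1 $ 2 $ s = ?z * N $ 2 $ s - N $ 1 $ s - ?\<zeta> * N $ 3 $ s"
    "M 1 $ 3 $ s = ?\<zeta> * N $ 2 $ s + N $ 3 $ s" for s
  proof -
    have M1: "M 1 = monodromy (hill_a n) (hill_b n) 1 (Suc (Suc m))"
      by (simp only: nS)
    show "M 1 $ 1 $ s = N $ 2 $ s" "M 1 $ 2 $ s = ?z * N $ 2 $ s - N $ 1 $ s - ?\<zeta> * N $ 3 $ s"
      "M 1 $ 3 $ s = ?\<zeta> * N $ 2 $ s + N $ 3 $ s"
      unfolding M1 monodromy_Suc(1)[of _ _ _ "Suc m"] monodromy_Suc(2)[of _ _ _ "Suc m"]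
        monodromy_Suc(3)[of _ _ _ "Suc m"] idx vars N_def by (rule refl)+
  qed
  have NC: "N $ 1 $ s = C $ 2 $ s" "N $ 2 $ s = ?y * C $ 2 $ s - C $ 1 $ s - ?\<eta> * C $ 3 $ s"
    "N $ 3 $ s = ?\<eta> * C $ 2 $ s + C $ 3 $ s" for s
    unfolding N_def monodromy_Suc idx vars by simp_all
  have N3: "N $ 3 $ s = M 1 $ 3 $ s - ?\<zeta> * M 1 $ 1 $ s" for s by (simp add: MN)
  have row2: "C $ 2 $ s = ?z * M 1 $ 1 $ s - ?\<zeta> * (M 1 $ 3 $ s - ?\<zeta> * M 1 $ 1 $ s) - M 1 $ 2 $ s" for s
    using MN(2)[of s] unfolding N3 NC(1) MN(1)[symmetric] by (simp add: algebra_simps)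
  have row3: "C $ 3 $ s = M 1 $ 3 $ s - ?\<zeta> * M 1 $ 1 $ s - ?\<eta> * C $ 2 $ s" for s
    using N3[of s] NC(3)[of s] by (simp add: algebra_simps)
  have row1: "C $ 1 $ s = ?y * C $ 2 $ s - ?\<eta> * C $ 3 $ s - M 1 $ 1 $ s" for s
    using MN(1)[of s] NC(2)[of s] by (simp add: algebra_simps)
  have sq: "?\<zeta> * ?\<zeta> = 0" "?\<eta> * ?\<eta> = 0" "?\<zeta> * (?\<zeta> * f) = 0" "?\<eta> * (?\<eta> * f) = 0" for f
    by (simp_all add: odd_var_def gvar_square flip: mult.assoc)
  note in_I = I_add I_diff I_uminus I_mult_left I_zero E last_even_var last_odd_var
  have "C $ 2 $ 2 - 1 = ?z * E 1 2 - ?\<zeta> * (E 3 2 - ?\<zeta> * E 1 2) - E 2 2"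
    unfolding row2 E_def by (simp add: algebra_simps)
  also have "\<dots> \<in> I" by (intro in_I)
  finally show e1: "C $ 2 $ 2 - 1 \<in> I" .
  have "?z + C $ 2 $ 1 = ?z * E 1 1 - ?\<zeta> * (E 3 1 - ?\<zeta> * E 1 1) - E 2 1"
    unfolding row2 E_def by (simp add: algebra_simps sq)
  also have "\<dots> \<in> I" by (intro in_I)
  finally show "?z + C $ 2 $ 1 \<in> I" .
  have "?\<zeta> + C $ 2 $ 3 = ?z * E 1 3 - ?\<zeta> * (E 3 3 - ?\<zeta> * E 1 3) - E 2 3"
    unfolding row2 E_def by (simp add: algebra_simps sq)
  also have "\<dots> \<in> I" by (intro in_I)
  finally show "?\<zeta> + C $ 2 $ 3 \<in> I" .
  have "?\<eta> + C $ 3 $ 2 = E 3 2 - ?\<zeta> * E 1 2 - ?\<eta> * (C $ 2 $ 2 - 1)"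
    unfolding row3[of 2] E_def by (simp add: algebra_simps)
  also have "\<dots> \<in> I" by (intro in_I e1)
  finally show e4: "?\<eta> + C $ 3 $ 2 \<in> I" .
  have "?y - C $ 1 $ 2 = - (?y * (C $ 2 $ 2 - 1)) + ?\<eta> * (?\<eta> + C $ 3 $ 2) + E 1 2"
    unfolding row1[of 2] E_def by (simp add: algebra_simps sq)
  also have "\<dots> \<in> I" by (intro in_I e1 e4)
  finally show "?y - C $ 1 $ 2 \<in> I" .
qed

text \<open>Each of the four last variables is congruent to an entry of \<open>C\<close> up to sign,
  and congruence modulo a two-sided ideal is compatible with sums and products.\<close>

lemma representative:
  assumes "f \<in> superpolys_in {1..n}"
  obtains g where "g \<in> superpolys_in {1..m}" "f - g \<in> I"
proof -
  let ?Q = "{f \<in> superpolys_in {1..n}. \<exists>g\<in>superpolys_in {1..m}. f - g \<in> I}"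
  have mem: "f \<in> ?Q" if "f \<in> superpolys_in {1..n}" "g \<in> superpolys_in {1..m}" "f - g \<in> I" for f g
    using that by blast
  have self: "f \<in> ?Q" if "f \<in> superpolys_in {1..m}" for f
    using that superpolys_in_m I_zero by force
  have var_cases: "i \<in> {1..m} \<or> i = Suc m \<or> i = n" if "i \<in> {1..n}" for i
    using that by (auto simp: n_eq)
  have "f \<in> ?Q"
    using assms
  proof (rule superpoly_generated)
    show "gconst (Poly_Mapping.single 0 c) \<in> ?Q" for c by (rule self[OF superpolys_in_scalar])
    fix i assume i: "i \<in> {1..n}"
    from var_cases[OF i] show "even_var i \<in> ?Q"
    proof (elim disjE)
      assume "i \<in> {1..m}"
      then show ?thesis by (intro self superpolys_in_even_var)
    next
      assume "i = Suc m"
      then show ?thesis using mem[OF last_even_var(1) C_in elimination(5)] by (simp only:)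
    next
      assume "i = n"
      moreover have "even_var n - (- C $ 2 $ 1) \<in> I" using elimination(2) by simp
      ultimately show ?thesis using mem[OF last_even_var(2) superpolys_in_uminus[OF C_in]] by (simp only:)
    qed
    from var_cases[OF i] show "odd_var i \<in> ?Q"
    proof (elim disjE)
      assume "i \<in> {1..m}"
      then show ?thesis by (intro self superpolys_in_odd_var)
    next
      assume "i = Suc m"
      moreover have "odd_var (Suc m) - (- C $ 3 $ 2) \<in> I" using elimination(4) by simp
      ultimately show ?thesis using mem[OF last_odd_var(1) superpolys_in_uminus[OF C_in]] by (simp only:)
    next
      assume "i = n"
      moreover have "odd_var n - (- C $ 2 $ 3) \<in> I" using elimination(3) by simp
      ultimately show ?thesis using mem[OF last_odd_var(2) superpolys_in_uminus[OF C_in]] by (simp only:)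
    qed
  next
    fix f1 f2 assume "f1 \<in> ?Q" "f2 \<in> ?Q"
    then obtain g1 g2 where f: "f1 \<in> superpolys_in {1..n}" "f2 \<in> superpolys_in {1..n}"
      and g: "g1 \<in> superpolys_in {1..m}" "f1 - g1 \<in> I" "g2 \<in> superpolys_in {1..m}" "f2 - g2 \<in> I"
      by blast
    have "f1 + f2 - (g1 + g2) = (f1 - g1) + (f2 - g2)" by simp
    then have "f1 + f2 - (g1 + g2) \<in> I" using I_add[OF g(2,4)] by (simp only:)
    then show "f1 + f2 \<in> ?Q" using superpolys_in_add[OF g(1,3)] superpolys_in_add[OF f] by blast
    have "f1 * f2 - g1 * g2 = (f1 - g1) * f2 + g1 * (f2 - g2)" by (simp add: algebra_simps)
    also have "\<dots> \<in> I"
      using I_add I_mult_right[OF g(2) f(2)] I_mult_left[OF g(4) superpolys_in_m[OF g(1)]] by blast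
    finally have "f1 * f2 - g1 * g2 \<in> I" .
    then show "f1 * f2 \<in> ?Q" using superpolys_in_mult[OF g(1,3)] superpolys_in_mult[OF f] by blast
  qed
  then show ?thesis using that by blast
qed

lemma homogeneous_representative:
  assumes "f \<in> superpolys_in {1..n}" "f \<in> grassmann_part e"
  obtains g where "g \<in> superpolys_in {1..m}" "g \<in> grassmann_part e" "f - g \<in> I"
proof -
  obtain g where g: "g \<in> superpolys_in {1..m}" "f - g \<in> I" using representative[OF assms(1)] .
  have "parity_proj e (f + - g) \<in> I" using I_parity_proj g(2) by simp
  then have "f - parity_proj e g \<in> I"
    unfolding parity_proj_add parity_proj_uminus parity_proj_same[OF assms(2)] by simp
  then show ?thesis using that superpolys_in_parity_proj[OF g(1)] parity_proj_part by blast
qed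


section \<open>Points over the Grassmann algebra\<close>

lemma point_monodromy:
  fixes \<psi> :: "'k superpoly \<Rightarrow> 'k grassmann"
  assumes "superpoly_point n grassmann_algebra \<psi>"
  shows "\<psi> (monodromy (hill_a n) (hill_b n) i k $ r $ s)
    = monodromy (\<lambda>j. \<psi> (hill_a n j)) (\<lambda>j. \<psi> (hill_b n j)) i k $ r $ s"
proof -
  interpret P: superpoly_point n k_type grassmann_algebra \<psi> by (rule assms)
  have minus: "f \<ominus>\<^bsub>grassmann_algebra\<^esub> g = f - g" for f g :: "'k grassmann"
    by (simp add: a_minus_def grassmann_subalgebra.a_inv_grassmann_superalg[OF grassmann_subalgebra_UNIV])
  have "\<forall>r. P.m i k r s = monodromy P.a P.b i k $ r $ s"
  proof (induction k)
    case 0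
    show ?case unfolding P.m_0 by (simp add: mat_def)
  next
    case (Suc k)
    then show ?case unfolding forall_3 P.m_Suc minus unfolding monodromy_Suc by simp
  qed
  then show ?thesis by blast
qed

text \<open>The odd variables go to independent generators, so the point remembers their full
  product. The price is that the value of the variable \<open>a\<^sub>m\<close> is solved for in the
  Grassmann algebra, where an even element is invertible as soon as its body, here a continuant, is
  nonzero.\<close>

lemma exists_point:
  fixes s :: "nat \<Rightarrow> 'k"
  assumes "continuant s (m - 1) \<noteq> 0"
  obtains \<psi> :: "'k superpoly \<Rightarrow> 'k grassmann" where "superpoly_point n grassmann_algebra \<psi>" "\<And>f. f \<in> I \<Longrightarrow> \<psi> f = 0"
    "\<And>i. i \<in> {1..<m} \<Longrightarrow> \<psi> (even_var i) = gconst (s i)"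
    "\<And>i. i \<in> {1..m} \<Longrightarrow> \<psi> (odd_var i) = gvar i"
    "\<And>f. f \<in> grassmann_part False \<Longrightarrow> \<psi> f \<in> grassmann_part False"
    "\<And>c. \<psi> (gconst (Poly_Mapping.single 0 c)) = gconst c"
proof -
  define a0 where "a0 j = gconst (s (nat j))" for j :: int
  define b0 where "b0 j = (gvar (nat j) :: 'k grassmann)" for j :: int
  define C0 where "C0 = monodromy a0 b0 1 (m - 1)"
  have par0: "a0 j \<in> grassmann_part True" "b0 j \<in> grassmann_part False" for j
    by (simp_all add: a0_def b0_def gconst_even gvar_odd)
  note C0_part = monodromy_grassmann_part[of 1 "m - 1" a0 b0, OF par0, folded C0_def]
  have C022: "C0 $ 2 $ 2 \<in> grassmann_part True" using C0_part[of 2 2] by simp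
  have "gcoeff (C0 $ 2 $ 2) {} = continuant (\<lambda>j. gcoeff (a0 (int j)) {}) (m - 1)"
    using monodromy_continuant[of b0 a0 "m - 1", OF par0(2)] unfolding C0_def by blast
  also have "(\<lambda>j. gcoeff (a0 (int j)) {}) = s" by (simp add: a0_def gconst.rep_eq)
  finally have "gcoeff (C0 $ 2 $ 2) {} \<noteq> 0" using assms by simp
  then obtain g where g: "g \<in> grassmann_part True" "C0 $ 2 $ 2 * g = 1"
    using grassmann_even_inverse[OF C022] by blast
  \<comment> \<open>The solution of \<open>\<alpha> * C0 $ 2 $ 2 - C0 $ 1 $ 2 - b0 (int m) * C0 $ 3
    $ 2 = 1\<close>, that is, of \<open>C1 $ 2 $ 2 = 1\<close> for the coefficient at
    \<open>m\<close>.\<close>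
  define \<alpha> where "\<alpha> = (1 + C0 $ 1 $ 2 + b0 (int m) * C0 $ 3 $ 2) * g"
  have "1 + C0 $ 1 $ 2 + b0 (int m) * C0 $ 3 $ 2 \<in> grassmann_part True"
    using C0_part[of 1 2] C0_part[of 3 2] grassmann_part_times[OF par0(2), of "C0 $ 3 $ 2" False "int m"]
    by (simp add: grassmann_part_add one_even)
  then have \<alpha>_even: "\<alpha> \<in> grassmann_part True"
    unfolding \<alpha>_def using grassmann_part_times[OF _ g(1)] by fastforce
  have "\<alpha> * C0 $ 2 $ 2 = (1 + C0 $ 1 $ 2 + b0 (int m) * C0 $ 3 $ 2) * (g * C0 $ 2 $ 2)"
    by (simp add: \<alpha>_def mult.assoc)
  also have "g * C0 $ 2 $ 2 = 1" using grassmann_part_commute[OF g(1) C022] g(2) by simp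
  finally have \<alpha>: "\<alpha> * C0 $ 2 $ 2 = 1 + C0 $ 1 $ 2 + b0 (int m) * C0 $ 3 $ 2" by simp
  define a1 where "a1 j = (if j = int m then \<alpha> else a0 j)" for j
  define C1 where "C1 = monodromy a1 b0 1 m"
  have par1: "a1 j \<in> grassmann_part True" for j by (simp add: a1_def par0 \<alpha>_even)
  have C1_22: "C1 $ 2 $ 2 = 1"
  proof -
    have eq: "monodromy a1 b0 1 (m - 1) = C0"
      unfolding C0_def by (rule monodromy_cong) (use m in \<open>auto simp: a1_def\<close>)
    have "C1 = monodromy a1 b0 1 (Suc (m - 1))" using m by (simp add: C1_def)
    moreover have "1 + int (m - 1) = int m" using m by simp
    ultimately show ?thesis by (simp only: monodromy_Suc eq) (simp add: a1_def \<alpha>)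
  qed
  note C1_part = monodromy_grassmann_part[of 1 m a1 b0, OF par1 par0(2), folded C1_def]
  \<comment> \<open>The last two coefficients of either parity are the ones demanded by
    \<open>hill_monodromy_closing\<close>.\<close>
  define a' where "a' i = (if i = Suc m then C1 $ 1 $ 2 else if i = n then - C1 $ 2 $ 1 else a1 (int i))" for i
  define b' where "b' i = (if i = Suc m then - C1 $ 3 $ 2 else if i = n then - C1 $ 2 $ 3 else b0 (int i))" for i
  have a'_even: "a' i \<in> grassmann_part True" for i
    using C1_part[of 1 2] C1_part[of 2 1] par1 by (simp add: a'_def grassmann_part_uminus)
  have b'_odd: "b' i \<in> grassmann_part False" for i
    using C1_part[of 3 2] C1_part[of 2 3] par0 by (simp add: b'_def grassmann_part_uminus)
  interpret E: superalg_evaluation grassmann_algebra a' b'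
    by (rule superalg_evaluation.intro[OF grassmann_algebra_supercommutative])
      (simp add: superalg_evaluation_axioms_def a'_even b'_odd)
  let ?\<psi> = E.superpoly_eval
  have point: "superpoly_point n grassmann_algebra ?\<psi>"
    by (intro superpoly_point.intro superpoly_point_axioms.intro hill_superspace_axioms
        grassmann_algebra_supercommutative E.superpoly_eval_closed E.superpoly_eval_add
        E.superpoly_eval_mult E.superpoly_eval_one)
  interpret P: superpoly_point n k_type grassmann_algebra ?\<psi> by (rule point)
  have ev: "P.a (int i) = a' i" "P.b (int i) = b' i" if "i \<in> {1..n}" for i
    using that by (simp_all add: hill_a_nat hill_b_nat E.superpoly_eval_even_var E.superpoly_eval_odd_var)
  have low: "P.a j = a1 j" "P.b j = b0 j" if j: "1 \<le> j" "j < 1 + int m" for j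
  proof -
    obtain i where i: "j = int i" using j(1) by (metis nonneg_int_cases order.trans zero_le_one)
    then have "i \<in> {1..n}" "i \<noteq> Suc m" "i \<noteq> n" using j by (auto simp: n_eq)
    then show "P.a j = a1 j" "P.b j = b0 j" using ev[of i] by (simp_all add: i a'_def b'_def)
  qed
  have C1: "monodromy P.a P.b 1 m = C1"
    unfolding C1_def by (rule monodromy_cong) (use low in auto)
  have parP: "P.a j \<in> grassmann_part True" "P.b j \<in> grassmann_part False" for j
    using E.superpoly_eval_part[OF hill_a_even, of n j] E.superpoly_eval_part[OF hill_b_odd, of n j] by simp_all
  have idx: "1 + int m = int (Suc m)" "int (Suc m) + 1 = int n" by (simp_all add: n_eq)
  have "monodromy P.a P.b 1 (Suc (Suc m)) = hill_monodromy"
  proof (rule hill_monodromy_closing[OF parP]; unfold C1 idx)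
    have last: "Suc m \<in> {1..n}" "n \<in> {1..n}" "n \<noteq> Suc m" by (simp_all add: n_eq)
    show "C1 $ 2 $ 2 = 1" by (rule C1_22)
    show "P.a (int (Suc m)) = C1 $ 1 $ 2" unfolding ev(1)[OF last(1)] a'_def by simp
    show "P.a (int n) = - C1 $ 2 $ 1" unfolding ev(1)[OF last(2)] a'_def using last(3) by simp
    show "P.b (int (Suc m)) = - C1 $ 3 $ 2" unfolding ev(2)[OF last(1)] b'_def by simp
    show "P.b (int n) = - C1 $ 2 $ 3" unfolding ev(2)[OF last(2)] b'_def using last(3) by simp
  qed
  then have M1: "monodromy P.a P.b 1 n = hill_monodromy" by (simp add: n_eq)
  have "\<ominus>\<^bsub>grassmann_algebra\<^esub> f = - f" for f :: "'k grassmann"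
    using grassmann_subalgebra.a_inv_grassmann_superalg[OF grassmann_subalgebra_UNIV, of f] by simp
  then have anti: "P.b (j + int n) = - P.b j" for j
    using P.psi_uminus[OF hill_b_in[OF n, of j]] by (simp add: hill_b_antiperiodic n)
  \<comment> \<open>The generators of \<open>I\<close> involve every starting index; from index 1
    the condition spreads in both directions.\<close>
  have shift: "monodromy P.a P.b i n = hill_monodromy \<longleftrightarrow> monodromy P.a P.b (i + 1) n = hill_monodromy" for i
    by (rule hill_monodromy_shift) (simp_all add: hill_a_periodic anti odd_square_zero parP)
  have all: "monodromy P.a P.b i n = hill_monodromy" for i
  proof (induction i rule: int_induct[of _ 1])
    case base
    show ?case by (rule M1)
  next
    case (step1 i)
    then show ?case using shift[of i] by blast
  next
    case (step2 i)
    then show ?case using shift[of "i - 1"] by simp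
  qed
  have D: "\<forall>r s. ?\<psi> (hill_monodromy $ r $ s) = hill_monodromy $ r $ s"
    unfolding forall_3
    using E.superpoly_eval_one E.superpoly_eval_zero E.superpoly_eval_uminus[of 1]
      \<open>\<And>f. \<ominus>\<^bsub>grassmann_algebra\<^esub> f = - f\<close> by simp
  have kill: "?\<psi> ((M i - hill_monodromy) $ r $ s) = \<zero>\<^bsub>grassmann_algebra\<^esub>" for i r s
  proof -
    have "?\<psi> ((M i - hill_monodromy) $ r $ s)
      = ?\<psi> (M i $ r $ s) \<ominus>\<^bsub>grassmann_algebra\<^esub> ?\<psi> (hill_monodromy $ r $ s)"
      using P.psi_diff[OF P.monodromy_in hill_monodromy_in] by simp
    then show ?thesis
      unfolding point_monodromy[OF point] all D[rule_format]
      using \<open>\<And>f. \<ominus>\<^bsub>grassmann_algebra\<^esub> f = - f\<close> by (simp add: a_minus_def)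
  qed
  show ?thesis
  proof (rule that[OF point])
    show "?\<psi> f = 0" if "f \<in> I" for f
      using point_factors[OF point kill that] by simp
    show "?\<psi> (even_var i) = gconst (s i)" if "i \<in> {1..<m}" for i
      using that by (simp add: E.superpoly_eval_even_var a'_def a1_def a0_def n_eq)
    show "?\<psi> (odd_var i) = gvar i" if "i \<in> {1..m}" for i
      using that by (simp add: E.superpoly_eval_odd_var b'_def b0_def n_eq)
    show "?\<psi> f \<in> grassmann_part False" if "f \<in> grassmann_part False" for f
      using E.superpoly_eval_part[OF that] by simp
    show "?\<psi> (gconst (Poly_Mapping.single 0 c)) = gconst c" for c
      using E.superpoly_eval_scalar[of c] by simp
  qed
qed

end


section \<open>Algebraic dependence and chains of primes\<close>

text \<open>A homogeneous linear system with more unknowns than equations: the equation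
  \<open>b\<close> is used to eliminate an unknown \<open>e0\<close> with nonzero coefficient, which
  leaves one equation and one unknown less.\<close>

lemma nontrivial_relation:
  fixes f :: "'e \<Rightarrow> 'b \<Rightarrow> 'k::field"
  assumes "finite M" "finite E" "card M < card E"
  shows "\<exists>c. (\<exists>e\<in>E. c e \<noteq> 0) \<and> (\<forall>b\<in>M. (\<Sum>e\<in>E. c e * f e b) = 0)"
  using assms
proof (induction M arbitrary: E f rule: finite_induct)
  case empty
  then obtain e where "e \<in> E" by fastforce
  then show ?case by (intro exI[of _ "\<lambda>_. 1"]) auto
next
  case (insert b M)
  show ?case
  proof (cases "\<forall>e\<in>E. f e b = 0")
    case True
    obtain c where "\<exists>e\<in>E. c e \<noteq> 0" "\<forall>b\<in>M. (\<Sum>e\<in>E. c e * f e b) = 0"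
      using insert.IH[of E f] insert.prems insert.hyps by auto
    moreover have "(\<Sum>e\<in>E. c e * f e b) = 0" using True by simp
    ultimately show ?thesis by blast
  next
    case False
    then obtain e0 where e0: "e0 \<in> E" "f e0 b \<noteq> 0" by blast
    define E' where "E' = E - {e0}"
    define q where "q e = f e b / f e0 b" for e
    have fin: "finite E'" and notin: "e0 \<notin> E'" and E: "E = insert e0 E'"
      using insert.prems e0 by (auto simp: E'_def)
    have "card M < card E'" using insert.prems insert.hyps e0 by (simp add: E'_def)
    then obtain c where c: "\<exists>e\<in>E'. c e \<noteq> 0"
      "\<forall>x\<in>M. (\<Sum>e\<in>E'. c e * (f e x - q e * f e0 x)) = 0"
      using insert.IH[of E' "\<lambda>e x. f e x - q e * f e0 x"] fin by blast
    define d where "d e = (if e = e0 then - (\<Sum>e\<in>E'. c e * q e) else c e)" for e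
    have sum: "(\<Sum>e\<in>E. d e * f e x) = (\<Sum>e\<in>E'. c e * (f e x - q e * f e0 x))" for x
    proof -
      have "(\<Sum>e\<in>E. d e * f e x) = d e0 * f e0 x + (\<Sum>e\<in>E'. d e * f e x)"
        unfolding E using fin notin by simp
      also have "(\<Sum>e\<in>E'. d e * f e x) = (\<Sum>e\<in>E'. c e * f e x)"
        by (rule sum.cong) (use notin in \<open>auto simp: d_def\<close>)
      finally show ?thesis
        by (simp add: d_def right_diff_distrib sum_subtractf sum_distrib_right mult.assoc)
    qed
    have "(\<Sum>e\<in>E. d e * f e x) = 0" if "x \<in> insert b M" for x
    proof (cases "x = b")
      case True
      then show ?thesis unfolding sum using e0(2) by (simp add: q_def)
    next
      case False
      then show ?thesis unfolding sum using c(2) that by blast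
    qed
    moreover have "\<exists>e\<in>E. d e \<noteq> 0" using c(1) notin by (auto simp: E d_def)
    ultimately show ?thesis by blast
  qed
qed

definition exponent_lists :: "nat \<Rightarrow> nat \<Rightarrow> nat list set" where
  "exponent_lists N l = {e. set e \<subseteq> {..N} \<and> length e = l}"

fun power_product :: "'a::comm_ring_1 list \<Rightarrow> nat list \<Rightarrow> 'a" where
  "power_product (y # ys) (j # e) = y ^ j * power_product ys e"
| "power_product _ _ = 1"

text \<open>A polynomial with coefficients \<open>c\<close> evaluated at a list, nested by powers of
  the first entry so that an induction along a chain of primes can remove one element at a
  time.\<close>

fun poly_combination :: "nat \<Rightarrow> ((nat \<Rightarrow>\<^sub>0 nat) \<Rightarrow>\<^sub>0 'k::field) list \<Rightarrow> (nat list \<Rightarrow> 'k) \<Rightarrow> (nat \<Rightarrow>\<^sub>0 nat) \<Rightarrow>\<^sub>0 'k" where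
  "poly_combination N [] c = Poly_Mapping.single 0 (c [])"
| "poly_combination N (y # ys) c = (\<Sum>j\<le>N. y ^ j * poly_combination N ys (\<lambda>e. c (j # e)))"

lemma exponent_lists_Suc: "exponent_lists N (Suc l) = (\<lambda>(j, e). j # e) ` ({..N} \<times> exponent_lists N l)"
proof
  show "exponent_lists N (Suc l) \<subseteq> (\<lambda>(j, e). j # e) ` ({..N} \<times> exponent_lists N l)"
  proof
    fix e assume "e \<in> exponent_lists N (Suc l)"
    then show "e \<in> (\<lambda>(j, e). j # e) ` ({..N} \<times> exponent_lists N l)"
      by (cases e) (auto simp: exponent_lists_def)
  qed
qed (auto simp: exponent_lists_def)

lemma finite_exponent_lists: "finite (exponent_lists N l)"
  and card_exponent_lists: "card (exponent_lists N l) = Suc N ^ l"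
  using finite_lists_length_eq[of "{..N}" l] card_lists_length_eq[of "{..N}" l]
  by (simp_all add: exponent_lists_def)

lemma poly_combination_sum:
  "poly_combination N ys c
    = (\<Sum>e\<in>exponent_lists N (length ys). Poly_Mapping.single 0 (c e) * power_product ys e)"
proof (induction ys arbitrary: c)
  case Nil
  have "exponent_lists N 0 = {[]}" by (auto simp: exponent_lists_def)
  then show ?case by simp
next
  case (Cons y ys)
  have "(\<Sum>e\<in>exponent_lists N (Suc (length ys)). Poly_Mapping.single 0 (c e) * power_product (y # ys) e)
    = (\<Sum>(j, e)\<in>{..N} \<times> exponent_lists N (length ys). Poly_Mapping.single 0 (c (j # e)) * power_product (y # ys) (j # e))"
    unfolding exponent_lists_Suc
    by (subst sum.reindex) (auto simp: inj_on_def case_prod_beta)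
  also have "\<dots> = (\<Sum>j\<le>N. \<Sum>e\<in>exponent_lists N (length ys). y ^ j * (Poly_Mapping.single 0 (c (j # e)) * power_product ys e))"
    by (simp add: sum.cartesian_product mult_ac)
  finally show ?case by (simp add: Cons sum_distrib_left)
qed

lemma lookup_single_0_times: "Poly_Mapping.lookup (Poly_Mapping.single 0 c * p) \<mu> = c * Poly_Mapping.lookup p \<mu>"
  for p :: "(nat \<Rightarrow>\<^sub>0 nat) \<Rightarrow>\<^sub>0 'k::field"
  unfolding mult_map_scale_conv_mult[symmetric] by (simp add: map.rep_eq when_def)

text \<open>Each exponent is bounded separately, rather than the total degree, so that the exponents
  allowed form a box and are counted by a power.\<close>

definition bounded_polys :: "nat set \<Rightarrow> nat \<Rightarrow> ((nat \<Rightarrow>\<^sub>0 nat) \<Rightarrow>\<^sub>0 'k::zero) set" where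
  "bounded_polys V d = {p \<in> polys_in V. \<forall>\<mu>\<in>Poly_Mapping.keys p. \<forall>i. Poly_Mapping.lookup \<mu> i \<le> d}"

lemma bounded_polys_mult:
  assumes "p \<in> bounded_polys V d" "q \<in> bounded_polys V d'"
  shows "p * q \<in> bounded_polys V (d + d')"
  unfolding bounded_polys_def
proof safe
  show "p * q \<in> polys_in V" using assms by (auto simp: bounded_polys_def intro: polys_in_mult)
  fix \<mu> i assume "\<mu> \<in> Poly_Mapping.keys (p * q)"
  then obtain a b where "\<mu> = a + b" "a \<in> Poly_Mapping.keys p" "b \<in> Poly_Mapping.keys q"
    using keys_mult[of p q] by blast
  then show "Poly_Mapping.lookup \<mu> i \<le> d + d'"
    using assms by (simp add: bounded_polys_def lookup_add add_mono)
qed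

lemma polys_in_1 [simp]: "(1 :: (nat \<Rightarrow>\<^sub>0 nat) \<Rightarrow>\<^sub>0 'k::zero_neq_one) \<in> polys_in V"
  by (auto simp: polys_in_def)

lemma bounded_polys_1: "(1 :: (nat \<Rightarrow>\<^sub>0 nat) \<Rightarrow>\<^sub>0 'k::comm_ring_1) \<in> bounded_polys V d"
  by (auto simp: bounded_polys_def polys_in_def)

lemma bounded_polys_power:
  "p \<in> bounded_polys V d \<Longrightarrow> p ^ k \<in> bounded_polys V (k * d)"
  for p :: "(nat \<Rightarrow>\<^sub>0 nat) \<Rightarrow>\<^sub>0 'k::comm_ring_1"
  by (induction k) (auto simp: bounded_polys_1 intro: bounded_polys_mult)

lemma bounded_polys_mono: "d \<le> d' \<Longrightarrow> bounded_polys V d \<subseteq> bounded_polys V d'"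
  by (auto simp: bounded_polys_def intro: order.trans)

lemma bounded_polys_power_product:
  fixes ys :: "((nat \<Rightarrow>\<^sub>0 nat) \<Rightarrow>\<^sub>0 'k::comm_ring_1) list"
  assumes "set ys \<subseteq> bounded_polys V d" "e \<in> exponent_lists N (length ys)"
  shows "power_product ys e \<in> bounded_polys V (length ys * (N * d))"
  using assms
proof (induction ys arbitrary: e)
  case (Cons y ys)
  then obtain j e' where e: "e = j # e'" "j \<le> N" "e' \<in> exponent_lists N (length ys)"
    by (auto simp: exponent_lists_Suc)
  have "y ^ j \<in> bounded_polys V (N * d)"
    using bounded_polys_power[of y V d j] bounded_polys_mono[of "j * d" "N * d" V] Cons.prems e by auto
  then show ?case
    using Cons e by (auto intro: bounded_polys_mult)
qed (simp add: bounded_polys_1)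

lemma exists_bound:
  assumes "finite Y" "Y \<subseteq> polys_in V"
  obtains d where "Y \<subseteq> bounded_polys V d"
proof -
  let ?S = "\<Union>p\<in>Y. \<Union>\<mu>\<in>Poly_Mapping.keys p. Poly_Mapping.lookup \<mu> ` Poly_Mapping.keys \<mu>"
  have fin: "finite ?S" using assms(1) by simp
  have "Poly_Mapping.lookup \<mu> i \<le> Max (insert 0 ?S)" if "p \<in> Y" "\<mu> \<in> Poly_Mapping.keys p" for p \<mu> i
  proof (cases "i \<in> Poly_Mapping.keys \<mu>")
    case True
    then have "Poly_Mapping.lookup \<mu> i \<in> ?S" using that by blast
    then show ?thesis using fin by (intro Max_ge) auto
  next
    case False
    then show ?thesis by (simp add: in_keys_iff)
  qed
  then have "Y \<subseteq> bounded_polys V (Max (insert 0 ?S))"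
    using assms(2) unfolding bounded_polys_def by blast
  with that show ?thesis by blast
qed

lemma card_bounded_exponents:
  fixes d :: nat
  assumes "finite V"
  defines "M \<equiv> {\<mu> :: nat \<Rightarrow>\<^sub>0 nat. Poly_Mapping.keys \<mu> \<subseteq> V \<and> (\<forall>i. Poly_Mapping.lookup \<mu> i \<le> d)}"
  shows "finite M" "card M \<le> Suc d ^ card V"
proof -
  let ?r = "\<lambda>\<mu>. restrict (Poly_Mapping.lookup \<mu>) V"
  have inj: "inj_on ?r M"
  proof (rule inj_onI, rule poly_mapping_eqI)
    fix \<mu> \<nu> i assume *: "\<mu> \<in> M" "\<nu> \<in> M" "?r \<mu> = ?r \<nu>"
    show "Poly_Mapping.lookup \<mu> i = Poly_Mapping.lookup \<nu> i"
    proof (cases "i \<in> V")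
      case True
      then show ?thesis using fun_cong[OF *(3), of i] by simp
    next
      case False
      then have "i \<notin> Poly_Mapping.keys \<mu>" "i \<notin> Poly_Mapping.keys \<nu>" using * by (auto simp: M_def)
      then show ?thesis by (simp add: in_keys_iff)
    qed
  qed
  have sub: "?r ` M \<subseteq> V \<rightarrow>\<^sub>E {..d}" by (auto simp: M_def)
  have fin: "finite (V \<rightarrow>\<^sub>E {..d})" using assms(1) by (intro finite_PiE) auto
  show "finite M" using inj sub fin by (meson finite_imageD finite_subset)
  have "card M = card (?r ` M)" by (rule card_image[OF inj, symmetric])
  also have "\<dots> \<le> card (V \<rightarrow>\<^sub>E {..d})" by (rule card_mono[OF fin sub])
  also have "\<dots> = Suc d ^ card V" using assms(1) by (simp add: card_PiE)
  finally show "card M \<le> Suc d ^ card V" .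
qed

lemma algebraic_dependence:
  fixes ys :: "((nat \<Rightarrow>\<^sub>0 nat) \<Rightarrow>\<^sub>0 'k::field) list"
  assumes "set ys \<subseteq> polys_in V" "finite V" "card V < length ys"
  obtains N c e where "e \<in> exponent_lists N (length ys)" "c e \<noteq> 0" "poly_combination N ys c = 0"
proof -
  obtain d where d: "set ys \<subseteq> bounded_polys V d" using exists_bound[OF _ assms(1)] by blast
  \<comment> \<open>There are \<open>Suc N ^ length ys\<close> power products but at most \<open>Suc (N * D) ^ card V\<close> monomials in them.\<close>
  define D where "D = length ys * d"
  \<comment> \<open>With this choice \<open>(Suc N * Suc D) ^ card V\<close> equals
    \<open>Suc N ^ card V * N\<close>, which is still below
    \<open>Suc N ^ Suc (card V)\<close>.\<close>
  define N where "N = Suc D ^ card V"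
  let ?E = "exponent_lists N (length ys)"
  let ?M = "{\<mu> :: nat \<Rightarrow>\<^sub>0 nat. Poly_Mapping.keys \<mu> \<subseteq> V \<and> (\<forall>i. Poly_Mapping.lookup \<mu> i \<le> N * D)}"
  note M = card_bounded_exponents[OF assms(2), of "N * D"]
  have "card ?M \<le> Suc (N * D) ^ card V" by (rule M(2))
  also have "\<dots> \<le> (Suc N * Suc D) ^ card V" by (rule power_mono) auto
  also have "\<dots> = Suc N ^ card V * Suc D ^ card V" by (rule power_mult_distrib)
  also have "\<dots> = Suc N ^ card V * N" by (simp only: N_def)
  also have "\<dots> < Suc N ^ card V * Suc N" by simp
  also have "\<dots> = Suc N ^ Suc (card V)" by simp
  also have "\<dots> \<le> Suc N ^ length ys" by (rule power_increasing) (use assms(3) in auto)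
  also have "\<dots> = card ?E" by (simp add: card_exponent_lists)
  finally have "card ?M < card ?E" .
  from nontrivial_relation[OF M(1) finite_exponent_lists this, of "\<lambda>e. Poly_Mapping.lookup (power_product ys e)"]
  obtain c where c: "\<exists>e\<in>?E. c e \<noteq> 0"
    "\<forall>\<mu>\<in>?M. (\<Sum>e\<in>?E. c e * Poly_Mapping.lookup (power_product ys e) \<mu>) = 0"
    by blast
  have "poly_combination N ys c = 0"
  proof (rule poly_mapping_eqI)
    fix \<mu>
    have "Poly_Mapping.lookup (poly_combination N ys c) \<mu> = (\<Sum>e\<in>?E. c e * Poly_Mapping.lookup (power_product ys e) \<mu>)"
      by (simp add: poly_combination_sum Poly_Mapping.lookup_sum lookup_single_0_times)
    also have "\<dots> = 0"
    proof (cases "\<mu> \<in> ?M")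
      case True
      then show ?thesis using c(2) by blast
    next
      case False
      have "Poly_Mapping.lookup (power_product ys e) \<mu> = 0" if "e \<in> ?E" for e
      proof -
        have "power_product ys e \<in> bounded_polys V (N * D)"
          using bounded_polys_power_product[OF d that] by (simp add: D_def mult_ac)
        then have "\<mu> \<notin> Poly_Mapping.keys (power_product ys e)"
          using False by (auto simp: bounded_polys_def polys_in_def)
        then show ?thesis by (simp add: in_keys_iff)
      qed
      then show ?thesis by simp
    qed
    finally show "Poly_Mapping.lookup (poly_combination N ys c) \<mu> = Poly_Mapping.lookup 0 \<mu>" by simp
  qed
  then show ?thesis using c(1) that by blast
qed

section \<open>Chains of primes in a polynomial ring\<close>

definition poly_prime :: "nat set \<Rightarrow> ((nat \<Rightarrow>\<^sub>0 nat) \<Rightarrow>\<^sub>0 'k::field) set \<Rightarrow> bool" where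
  "poly_prime V P \<longleftrightarrow> 0 \<in> P \<and> 1 \<notin> P \<and> (\<forall>p\<in>P. \<forall>q\<in>P. p - q \<in> P)
    \<and> (\<forall>p\<in>polys_in V. \<forall>q\<in>P. p * q \<in> P)
    \<and> (\<forall>p\<in>polys_in V. \<forall>q\<in>polys_in V. p * q \<in> P \<longrightarrow> p \<in> P \<or> q \<in> P)"

lemma poly_combination_in:
  "set ys \<subseteq> polys_in V \<Longrightarrow> poly_combination N ys c \<in> polys_in V"
proof (induction ys arbitrary: c)
  case (Cons y ys)
  have "y ^ j \<in> polys_in V" for j
    using Cons.prems by (induction j) (auto intro: polys_in_mult)
  then show ?case using Cons by (auto intro!: polys_in_sum polys_in_mult)
qed (simp add: polys_in_single)

lemma poly_combination_zero:
  assumes "\<And>e. e \<in> exponent_lists N (length ys) \<Longrightarrow> c e = 0"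
  shows "poly_combination N ys c = 0"
  unfolding poly_combination_sum by (rule sum.neutral) (simp add: assms)

text \<open>
  An element \<open>y\<close> outside \<open>P\<close> can be cancelled modulo \<open>P\<close>; if it lies in \<open>P'\<close>, then what
  remains modulo \<open>P'\<close> is the lowest coefficient.
\<close>

lemma lowest_coefficient:
  assumes P: "poly_prime V P" and P': "poly_prime V P'" and "P \<subseteq> P'"
    and y: "y \<in> P'" "y \<notin> P" "y \<in> polys_in V"
    and F: "\<And>j. j \<le> N \<Longrightarrow> F j \<in> polys_in V" "\<And>j. j \<le> N \<Longrightarrow> F j = 0 \<or> F j \<notin> P'"
    and "(\<Sum>j\<le>N. y ^ j * F j) \<in> P" "j \<le> N"
  shows "F j = 0"
  using assms(7-)
proof (induction N arbitrary: F j)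
  case 0
  then have "F 0 \<in> P'" using \<open>P \<subseteq> P'\<close> by auto
  then show ?case using 0 by auto
next
  case (Suc N)
  have ypow: "y ^ j \<in> polys_in V" for j
    using y(3) by (induction j) (auto intro: polys_in_mult)
  let ?R = "\<Sum>j\<le>N. y ^ j * F (Suc j)"
  have R: "?R \<in> polys_in V" using Suc.prems(1) ypow by (intro polys_in_sum polys_in_mult) auto
  have split: "(\<Sum>j\<le>Suc N. y ^ j * F j) = F 0 + ?R * y"
    by (subst sum.atMost_Suc_shift) (simp add: sum_distrib_left sum_distrib_right mult_ac)
  then have "F 0 + ?R * y \<in> P'" using Suc.prems(3) \<open>P \<subseteq> P'\<close> by auto
  moreover have "?R * y \<in> P'" using P' R y(1) by (simp add: poly_prime_def)
  ultimately have "F 0 + ?R * y - ?R * y \<in> P'" using P' unfolding poly_prime_def by blast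
  then have F0: "F 0 = 0" using Suc.prems(2)[of 0] by auto
  then have "?R * y \<in> P" using split Suc.prems(3) by simp
  then have "?R \<in> P" using P R y unfolding poly_prime_def by blast
  then have "F (Suc j) = 0" if "j \<le> N" for j
    using Suc.IH[of "\<lambda>j. F (Suc j)" j] Suc.prems that by auto
  then show ?case using F0 Suc.prems(4) by (cases j) auto
qed

text \<open>Induction along the chain, with one element of \<open>ys\<close> from each gap. The
  coefficient of a power of the first element is a combination of the others, hence zero or outside
  the next prime, and \<open>lowest_coefficient\<close> applies. In particular these elements are
  algebraically independent.\<close>

lemma poly_combination_not_in:
  assumes "\<And>j. j \<le> length ys \<Longrightarrow> poly_prime V (P (i + j))"
    and "\<And>j. j < length ys \<Longrightarrow> P (i + j) \<subseteq> P (Suc (i + j))"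
    and "\<And>j. j < length ys \<Longrightarrow> ys ! j \<in> P (Suc (i + j)) \<and> ys ! j \<notin> P (i + j)"
    and "set ys \<subseteq> polys_in V"
    and "e \<in> exponent_lists N (length ys)" "c e \<noteq> 0"
  shows "poly_combination N ys c \<notin> P i"
  using assms
proof (induction ys arbitrary: i c e)
  case Nil
  then have "c [] \<noteq> 0" by (simp add: exponent_lists_def)
  show ?case
  proof
    assume "poly_combination N [] c \<in> P i"
    moreover have "poly_prime V (P i)" using Nil.prems(1)[of 0] by simp
    moreover have "Poly_Mapping.single 0 (inverse (c [])) \<in> polys_in V" by (simp add: polys_in_single)
    ultimately have "Poly_Mapping.single 0 (inverse (c [])) * poly_combination N [] c \<in> P i"
      unfolding poly_prime_def by blast
    then have "1 \<in> P i" using \<open>c [] \<noteq> 0\<close> by (simp add: mult_single)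
    then show False using \<open>poly_prime V (P i)\<close> by (simp add: poly_prime_def)
  qed
next
  case (Cons y ys)
  let ?F = "\<lambda>j. poly_combination N ys (\<lambda>e. c (j # e))"
  have prime: "poly_prime V (P i)" "poly_prime V (P (Suc i))"
    using Cons.prems(1)[of 0] Cons.prems(1)[of "Suc 0"] by simp_all
  have IH: "?F j \<notin> P (Suc i)" if "e' \<in> exponent_lists N (length ys)" "c (j # e') \<noteq> 0" for j e'
  proof (rule Cons.IH[where c = "\<lambda>e. c (j # e)", OF _ _ _ _ that])
    show "poly_prime V (P (Suc i + k))" if "k \<le> length ys" for k
      using Cons.prems(1)[of "Suc k"] that by simp
    show "P (Suc i + k) \<subseteq> P (Suc (Suc i + k))" if "k < length ys" for k
      using Cons.prems(2)[of "Suc k"] that by simp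
    show "ys ! k \<in> P (Suc (Suc i + k)) \<and> ys ! k \<notin> P (Suc i + k)" if "k < length ys" for k
      using Cons.prems(3)[of "Suc k"] that by simp
  qed (use Cons.prems in auto)
  obtain j e' where e: "e = j # e'" "j \<le> N" "e' \<in> exponent_lists N (length ys)"
    using Cons.prems(5) by (auto simp: exponent_lists_Suc)
  show ?case
  proof
    assume "poly_combination N (y # ys) c \<in> P i"
    then have mem: "(\<Sum>j\<le>N. y ^ j * ?F j) \<in> P i" by simp
    have "?F j = 0"
    proof (rule lowest_coefficient[OF prime _ _ _ _ _ _ mem e(2)])
      show "P i \<subseteq> P (Suc i)" using Cons.prems(2)[of 0] by simp
      show "y \<in> P (Suc i)" "y \<notin> P i" using Cons.prems(3)[of 0] by simp_all
      show "y \<in> polys_in V" using Cons.prems(4) by simp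
      show "?F k \<in> polys_in V" for k using Cons.prems(4) by (intro poly_combination_in) simp
      show "?F k = 0 \<or> ?F k \<notin> P (Suc i)" for k
        using IH[of _ k] poly_combination_zero[of N ys "\<lambda>e. c (k # e)"] by blast
    qed
    moreover have "?F j \<notin> P (Suc i)" using IH[of e' j] e Cons.prems(6) by simp
    ultimately show False using prime(2) by (simp add: poly_prime_def)
  qed
qed

text \<open>Choosing one element from each gap turns a chain that is too long into algebraically
  independent elements, more of them than there are variables.\<close>

lemma poly_prime_chain_length:
  assumes "finite V" "\<And>i. i \<le> l \<Longrightarrow> poly_prime V (P i)"
    and "\<And>i. i \<le> l \<Longrightarrow> P i \<subseteq> polys_in V"
    and "\<And>i. i < l \<Longrightarrow> P i \<subset> P (Suc i)"
  shows "l \<le> card V"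
proof (rule ccontr)
  assume "\<not> l \<le> card V"
  have "\<forall>i\<in>{..<l}. \<exists>y. y \<in> P (Suc i) \<and> y \<notin> P i" using assms(4) by blast
  then obtain y where y: "\<And>i. i < l \<Longrightarrow> y i \<in> P (Suc i) \<and> y i \<notin> P i" by (metis lessThan_iff)
  define ys where "ys = map y [0..<l]"
  have "y i \<in> polys_in V" if "i < l" for i using y[OF that] assms(3)[of "Suc i"] that by auto
  then have sub: "set ys \<subseteq> polys_in V" by (auto simp: ys_def)
  have mono: "P j \<subseteq> P (Suc j)" if "j < l" for j using assms(4)[OF that] by (rule psubset_imp_subset)
  have len: "card V < length ys" using \<open>\<not> l \<le> card V\<close> by (simp add: ys_def)
  obtain N c e where e: "e \<in> exponent_lists N (length ys)" "c e \<noteq> 0" "poly_combination N ys c = 0"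
    by (rule algebraic_dependence[OF sub assms(1) len])
  have "poly_combination N ys c \<notin> P 0"
    by (rule poly_combination_not_in[where c = c, OF _ _ _ sub e(1,2)]) (use assms(2) y mono in \<open>simp_all add: ys_def\<close>)
  moreover have "0 \<in> P 0" using assms(2)[of 0] by (simp add: poly_prime_def)
  ultimately show False using e(3) by simp
qed

lemma poly_prime_zero: "poly_prime V {0}"
  by (simp add: poly_prime_def)


section \<open>The Krull dimension\<close>

lemma gconst_uminus: "gconst (- c) = - (gconst c :: 'c::comm_ring_1 grassmann)"
  by (rule gcoeff_eqI) (simp add: gconst.rep_eq)

lemma continuant_of_int: "continuant (\<lambda>i. of_int (t i)) k = of_int (continuant t k)"
  by (induction t k rule: continuant.induct) simp_all

text \<open>A supply of sequences with nonzero continuant: with entries at least 2 the continuants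
  grow strictly from 1.\<close>

lemma continuant_increasing:
  fixes t :: "nat \<Rightarrow> int"
  assumes "\<And>i. t i \<ge> 2"
  shows "continuant t (Suc k) \<ge> continuant t k + 1 \<and> continuant t k \<ge> 1"
proof (induction k)
  case 0
  then show ?case using assms[of 1] by simp
next
  case (Suc k)
  have "continuant t (Suc (Suc k)) = t (Suc (Suc k)) * continuant t (Suc k) - continuant t k" by simp
  moreover have "t (Suc (Suc k)) * continuant t (Suc k) \<ge> 2 * continuant t (Suc k)"
    using Suc assms[of "Suc (Suc k)"] by (intro mult_right_mono) auto
  ultimately show ?case using Suc by linarith
qed

lemma continuant_cong:
  "(\<And>j. 1 \<le> j \<Longrightarrow> j \<le> k \<Longrightarrow> t j = t' j) \<Longrightarrow> continuant t k = continuant t' k"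
  by (induction t k rule: continuant.induct) auto

lemma continuant_two: "continuant (\<lambda>_. 2) k = of_nat (Suc k)"
proof -
  have "continuant (\<lambda>_. 2 :: 'a) k = of_nat (Suc k) \<and> continuant (\<lambda>_. 2 :: 'a) (Suc k) = of_nat (Suc (Suc k))"
  proof (induction k)
    case (Suc k)
    then show ?case by (simp add: algebra_simps)
  qed simp
  then show ?thesis by blast
qed

text \<open>A quotient \<open>p / g ^ N\<close> with the denominator cleared. Nothing is asked at
  the zeros of \<open>g\<close>, because there the function of interest has no meaningful
  value.\<close>

definition rational_on :: "'k::field poly \<Rightarrow> ('k \<Rightarrow> 'k) \<Rightarrow> bool" where
  "rational_on g h \<longleftrightarrow> (\<exists>N p. \<forall>u. poly g u \<noteq> 0 \<longrightarrow> poly g u ^ N * h u = poly p u)"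

lemma rational_on_poly: "(\<And>u. poly g u \<noteq> 0 \<Longrightarrow> h u = poly p u) \<Longrightarrow> rational_on g h"
  unfolding rational_on_def by (intro exI[of _ 0] exI[of _ p]) simp

lemma rational_on_cong: "rational_on g h \<Longrightarrow> (\<And>u. poly g u \<noteq> 0 \<Longrightarrow> h u = h' u) \<Longrightarrow> rational_on g h'"
  unfolding rational_on_def by metis

lemma rational_on_add:
  assumes "rational_on g h" "rational_on g h'"
  shows "rational_on g (\<lambda>u. h u + h' u)"
proof -
  obtain N p N' p' where p: "\<And>u. poly g u \<noteq> 0 \<Longrightarrow> poly g u ^ N * h u = poly p u"
    "\<And>u. poly g u \<noteq> 0 \<Longrightarrow> poly g u ^ N' * h' u = poly p' u"
    using assms unfolding rational_on_def by blast
  have "poly g u ^ (N + N') * (h u + h' u) = poly (g ^ N' * p + g ^ N * p') u" if "poly g u \<noteq> 0" for u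
    using p[OF that, symmetric] by (simp add: power_add algebra_simps)
  then show ?thesis unfolding rational_on_def by blast
qed

lemma rational_on_mult:
  assumes "rational_on g h" "rational_on g h'"
  shows "rational_on g (\<lambda>u. h u * h' u)"
proof -
  obtain N p N' p' where p: "\<And>u. poly g u \<noteq> 0 \<Longrightarrow> poly g u ^ N * h u = poly p u"
    "\<And>u. poly g u \<noteq> 0 \<Longrightarrow> poly g u ^ N' * h' u = poly p' u"
    using assms unfolding rational_on_def by blast
  have "poly g u ^ (N + N') * (h u * h' u) = poly (p * p') u" if "poly g u \<noteq> 0" for u
    using p[OF that, symmetric] by (simp add: power_add algebra_simps)
  then show ?thesis unfolding rational_on_def by blast
qed

lemma rational_on_divide:
  assumes "rational_on g (\<lambda>u. poly g u * h u)"
  shows "rational_on g h"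
proof -
  obtain N p where p: "\<And>u. poly g u \<noteq> 0 \<Longrightarrow> poly g u ^ N * (poly g u * h u) = poly p u"
    using assms unfolding rational_on_def by blast
  have "poly g u ^ Suc N * h u = poly p u" if "poly g u \<noteq> 0" for u
    using p[OF that] by (simp add: mult_ac)
  then show ?thesis unfolding rational_on_def by blast
qed

text \<open>The recursion is run over polynomials, with linear polynomials as entries.\<close>

lemma continuant_line_poly:
  "\<exists>p. \<forall>u. poly p u = continuant (\<lambda>i. (1 - u) * s i + u * s' i) k" for s s' :: "nat \<Rightarrow> 'k::field"
proof -
  let ?l = "\<lambda>i. [:s i, s' i - s i:]"
  have "poly (continuant ?l k) u = continuant (\<lambda>i. (1 - u) * s i + u * s' i) k" for u
    by (induction ?l k rule: continuant.induct) (simp_all add: algebra_simps)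
  then show ?thesis by blast
qed

lemma polys_common_nonzero:
  fixes p q r :: "'k::field_char_0 poly"
  assumes "p \<noteq> 0" "q \<noteq> 0" "r \<noteq> 0"
  obtains u where "poly p u \<noteq> 0" "poly q u \<noteq> 0" "poly r u \<noteq> 0"
proof -
  have "finite {u. poly (p * q * r) u = 0}" using assms by (intro poly_roots_finite) simp
  then obtain u where "u \<notin> {u. poly (p * q * r) u = 0}"
    using ex_new_if_finite[OF infinite_UNIV_char_0] by blast
  then show ?thesis by (intro that[of u]) simp_all
qed

context hill_variety
begin

text \<open>
  By \<open>elimination\<close>, \<open>C $ 2 $ 2 = 1\<close> determines \<open>a\<^sub>m\<close> where the continuant of length \<open>m - 1\<close> is nonzero.
\<close>

definition admissible :: "nat \<Rightarrow> (nat \<Rightarrow> 'k) set" where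
  "admissible j = {s. (\<forall>i\<in>{1..j}. s i = 2) \<and> continuant s (m - 1) \<noteq> 0}"

text \<open>A chosen point for the parameters \<open>s\<close>. Its properties are available only
  when the continuant of length \<open>m - 1\<close> is nonzero; elsewhere the choice is
  arbitrary.\<close>

definition hill_pt :: "(nat \<Rightarrow> 'k) \<Rightarrow> 'k superpoly \<Rightarrow> 'k grassmann" where
  "hill_pt s = (SOME \<psi>. superpoly_point n grassmann_algebra \<psi> \<and> (\<forall>f\<in>I. \<psi> f = 0)
    \<and> (\<forall>i\<in>{1..<m}. \<psi> (even_var i) = gconst (s i)) \<and> (\<forall>i\<in>{1..m}. \<psi> (odd_var i) = gvar i)
    \<and> (\<forall>f\<in>grassmann_part False. \<psi> f \<in> grassmann_part False)
    \<and> (\<forall>c. \<psi> (gconst (Poly_Mapping.single 0 c)) = gconst c))"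

text \<open>Bodies add and multiply, so for permitted parameters this is a ring homomorphism to the
  ground field, although the point itself is Grassmann-valued.\<close>

abbreviation value_at :: "(nat \<Rightarrow> 'k) \<Rightarrow> 'k superpoly \<Rightarrow> 'k" where
  "value_at s f \<equiv> gcoeff (hill_pt s f) {}"

lemma hill_pt:
  assumes "continuant s (m - 1) \<noteq> 0"
  shows hill_pt_point: "superpoly_point n grassmann_algebra (hill_pt s)"
    and hill_pt_I: "f \<in> I \<Longrightarrow> hill_pt s f = 0"
    and hill_pt_even_var: "i \<in> {1..<m} \<Longrightarrow> hill_pt s (even_var i) = gconst (s i)"
    and hill_pt_odd_var: "i \<in> {1..m} \<Longrightarrow> hill_pt s (odd_var i) = gvar i"
    and hill_pt_odd: "f \<in> grassmann_part False \<Longrightarrow> hill_pt s f \<in> grassmann_part False"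
    and hill_pt_scalar: "hill_pt s (gconst (Poly_Mapping.single 0 c)) = gconst c"
proof -
  obtain \<psi> :: "'k superpoly \<Rightarrow> 'k grassmann" where "superpoly_point n grassmann_algebra \<psi>" "\<And>f. f \<in> I \<Longrightarrow> \<psi> f = 0"
    "\<And>i. i \<in> {1..<m} \<Longrightarrow> \<psi> (even_var i) = gconst (s i)"
    "\<And>i. i \<in> {1..m} \<Longrightarrow> \<psi> (odd_var i) = gvar i"
    "\<And>f. f \<in> grassmann_part False \<Longrightarrow> \<psi> f \<in> grassmann_part False"
    "\<And>c. \<psi> (gconst (Poly_Mapping.single 0 c)) = gconst c"
    using exists_point[OF assms] by blast
  then have "\<exists>\<psi>. superpoly_point n grassmann_algebra \<psi> \<and> (\<forall>f\<in>I. \<psi> f = 0)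
    \<and> (\<forall>i\<in>{1..<m}. \<psi> (even_var i) = gconst (s i)) \<and> (\<forall>i\<in>{1..m}. \<psi> (odd_var i) = gvar i)
    \<and> (\<forall>f\<in>grassmann_part False. \<psi> f \<in> grassmann_part False)
    \<and> (\<forall>c. \<psi> (gconst (Poly_Mapping.single 0 c)) = gconst c)"
    by (intro exI[of _ \<psi>]) simp
  from someI_ex[OF this] have *: "superpoly_point n grassmann_algebra (hill_pt s) \<and> (\<forall>f\<in>I. hill_pt s f = 0)
    \<and> (\<forall>i\<in>{1..<m}. hill_pt s (even_var i) = gconst (s i)) \<and> (\<forall>i\<in>{1..m}. hill_pt s (odd_var i) = gvar i)
    \<and> (\<forall>f\<in>grassmann_part False. hill_pt s f \<in> grassmann_part False)
    \<and> (\<forall>c. hill_pt s (gconst (Poly_Mapping.single 0 c)) = gconst c)"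
    unfolding hill_pt_def .
  show "superpoly_point n grassmann_algebra (hill_pt s)"
    "f \<in> I \<Longrightarrow> hill_pt s f = 0"
    "i \<in> {1..<m} \<Longrightarrow> hill_pt s (even_var i) = gconst (s i)"
    "i \<in> {1..m} \<Longrightarrow> hill_pt s (odd_var i) = gvar i"
    "f \<in> grassmann_part False \<Longrightarrow> hill_pt s f \<in> grassmann_part False"
    "hill_pt s (gconst (Poly_Mapping.single 0 c)) = gconst c"
    using * by blast+
qed

lemma hill_pt_add: "continuant s (m - 1) \<noteq> 0 \<Longrightarrow> f \<in> superpolys_in {1..n} \<Longrightarrow> g \<in> superpolys_in {1..n}
    \<Longrightarrow> hill_pt s (f + g) = hill_pt s f + hill_pt s g"
  and hill_pt_mult: "continuant s (m - 1) \<noteq> 0 \<Longrightarrow> f \<in> superpolys_in {1..n} \<Longrightarrow> g \<in> superpolys_in {1..n}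
    \<Longrightarrow> hill_pt s (f * g) = hill_pt s f * hill_pt s g"
  and hill_pt_one: "continuant s (m - 1) \<noteq> 0 \<Longrightarrow> hill_pt s 1 = 1"
  and hill_pt_zero: "continuant s (m - 1) \<noteq> 0 \<Longrightarrow> hill_pt s 0 = 0"
  using superpoly_point.psi_add[OF hill_pt_point, of s f g] superpoly_point.psi_mult[OF hill_pt_point, of s f g]
    superpoly_point.psi_one[OF hill_pt_point, of s] superpoly_point.psi_zero[OF hill_pt_point, of s]
  by simp_all

lemma hill_pt_diff:
  assumes "continuant s (m - 1) \<noteq> 0" "f \<in> superpolys_in {1..n}" "g \<in> superpolys_in {1..n}"
  shows "hill_pt s (f - g) = hill_pt s f - hill_pt s g"
  using hill_pt_add[OF assms(1) superpolys_in_diff[OF assms(2,3)] assms(3)] by simp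

text \<open>Identifies the coefficient of the variable \<open>a\<^sub>m\<close> in
  \<open>C $ 2 $ 2\<close>, and thereby the only denominator that occurs: the shorter product
  involves just the freely prescribed even coordinates.\<close>

lemma value_at_monodromy:
  assumes "continuant s (m - 1) \<noteq> 0"
  shows "value_at s (monodromy (hill_a n) (hill_b n) 1 (m - 1) $ 2 $ 2) = continuant s (m - 1)"
proof -
  have "value_at s (monodromy (hill_a n) (hill_b n) 1 (m - 1) $ 2 $ 2)
      = continuant (\<lambda>j. value_at s (hill_a n (int j))) (m - 1)"
    unfolding point_monodromy[OF hill_pt_point[OF assms]]
    using monodromy_continuant[of "\<lambda>j. hill_pt s (hill_b n j)" "\<lambda>j. hill_pt s (hill_a n j)" "m - 1"]
      hill_pt_odd[OF assms hill_b_odd] by blast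
  also have "\<dots> = continuant s (m - 1)"
  proof -
    have "value_at s (hill_a n (int j)) = s j" if "1 \<le> j" "j \<le> m - 1" for j
      using that hill_pt_even_var[OF assms, of j] m
      by (subst hill_a_nat) (auto simp: gconst.rep_eq n_eq)
    then show ?thesis by (rule continuant_cong)
  qed
  finally show ?thesis .
qed

text \<open>Along a line of parameters the prescribed coordinates are linear and odd variables have
  body zero. The variable \<open>a\<^sub>m\<close> is a quotient with denominator a power of
  \<open>g\<close>, and the last even variables are congruent to entries of \<open>C\<close> up to
  sign.\<close>

lemma value_at_rational:
  fixes s s' :: "nat \<Rightarrow> 'k"
  defines "\<sigma> u \<equiv> \<lambda>i. (1 - u) * s i + u * s' i"
  assumes g: "\<And>u. poly g u = continuant (\<sigma> u) (m - 1)"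
    and f: "f \<in> superpolys_in {1..n}"
  shows "rational_on g (\<lambda>u. value_at (\<sigma> u) f)"
proof -
  let ?Q = "{f \<in> superpolys_in {1..n}. rational_on g (\<lambda>u. value_at (\<sigma> u) f)}"
  have ok: "continuant (\<sigma> u) (m - 1) \<noteq> 0" if "poly g u \<noteq> 0" for u
    using that by (simp add: g)
  have add: "f1 + f2 \<in> ?Q" if "f1 \<in> ?Q" "f2 \<in> ?Q" for f1 f2
    using that rational_on_add[of g "\<lambda>u. value_at (\<sigma> u) f1" "\<lambda>u. value_at (\<sigma> u) f2"]
    by (auto intro: superpolys_in_add elim!: rational_on_cong simp: hill_pt_add ok)
  have mult: "f1 * f2 \<in> ?Q" if "f1 \<in> ?Q" "f2 \<in> ?Q" for f1 f2
    using that rational_on_mult[of g "\<lambda>u. value_at (\<sigma> u) f1" "\<lambda>u. value_at (\<sigma> u) f2"]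
    by (auto intro: superpolys_in_mult elim!: rational_on_cong simp: hill_pt_mult ok)
  have scalar: "gconst (Poly_Mapping.single 0 c) \<in> ?Q" for c
    by (auto intro!: superpolys_in_scalar rational_on_poly[of _ _ "[:c:]"] simp: hill_pt_scalar ok gconst.rep_eq)
  have one: "1 \<in> ?Q" using scalar[of 1] by simp
  have uminus: "- f \<in> ?Q" if "f \<in> ?Q" for f
    using mult[OF scalar[of "-1"] that] by (simp add: single_uminus gconst_uminus)
  have diff: "f1 - f2 \<in> ?Q" if "f1 \<in> ?Q" "f2 \<in> ?Q" for f1 f2
    using add[OF that(1) uminus[OF that(2)]] by simp
  have odd: "f \<in> ?Q" if "f \<in> superpolys_in {1..n}" "f \<in> grassmann_part False" for f
    using that gcoeff_odd_empty[OF hill_pt_odd[OF ok that(2)]]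
    by (auto intro!: rational_on_poly[of _ _ 0])
  have congI: "f \<in> ?Q" if "f \<in> superpolys_in {1..n}" "f' \<in> ?Q" "f - f' \<in> I" for f f'
  proof -
    have "value_at (\<sigma> u) f = value_at (\<sigma> u) f'" if u: "poly g u \<noteq> 0" for u
    proof -
      have "hill_pt (\<sigma> u) (f - f') = 0" by (rule hill_pt_I[OF ok[OF u] \<open>f - f' \<in> I\<close>])
      then show ?thesis
        using hill_pt_diff[OF ok[OF u], of f f'] \<open>f \<in> superpolys_in {1..n}\<close> \<open>f' \<in> ?Q\<close> by simp
    qed
    then show ?thesis using that rational_on_cong[of g "\<lambda>u. value_at (\<sigma> u) f'"] by auto
  qed
  have low: "even_var i \<in> ?Q" if i: "i \<in> {1..<m}" for i
  proof -
    have "value_at (\<sigma> u) (even_var i) = poly [:s i, s' i - s i:] u" if u: "poly g u \<noteq> 0" for u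
      unfolding hill_pt_even_var[OF ok[OF u] i] by (simp add: gconst.rep_eq \<sigma>_def algebra_simps)
    moreover have "even_var i \<in> superpolys_in {1..n}" using i by (intro superpolys_in_even_var) (auto simp: n_eq)
    ultimately show ?thesis by (blast intro: rational_on_poly)
  qed
  \<comment> \<open>Conditional on the variables up to \<open>k\<close>, because it is applied
    twice: with \<open>k = m - 1\<close> to reach the variable \<open>a\<^sub>m\<close>, then with
    \<open>k = m\<close> to reach the entries of \<open>C\<close>.\<close>
  have mono: "monodromy (hill_a n) (hill_b n) 1 k $ r $ c \<in> ?Q"
    if "\<And>i. i \<in> {1..k} \<Longrightarrow> even_var i \<in> ?Q" "k \<le> m" for k r c
    using that
  proof (induction k arbitrary: r)
    case 0
    have "0 \<in> ?Q" using scalar[of 0] by simp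
    then show ?case using one by (simp add: mat_def)
  next
    case (Suc k)
    have idx: "1 + int k = int (Suc k)" by simp
    have eq: "hill_a n (int (Suc k)) = (even_var (Suc k) :: 'k superpoly)"
      by (rule hill_a_nat) (use Suc.prems in \<open>auto simp: n_eq\<close>)
    have a: "hill_a n (int (Suc k)) \<in> ?Q" unfolding eq by (rule Suc.prems(1)) simp
    have b: "hill_b n (int (Suc k)) \<in> ?Q" by (rule odd[OF hill_b_in[OF n] hill_b_odd])
    have IH: "monodromy (hill_a n) (hill_b n) 1 k $ r $ c \<in> ?Q" for r
      by (rule Suc.IH) (rule Suc.prems(1), use Suc.prems(2) in auto)
    have "\<forall>r. monodromy (hill_a n) (hill_b n) 1 (Suc k) $ r $ c \<in> ?Q"
      unfolding forall_3 monodromy_Suc idx by (intro conjI diff add mult a b IH)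
    then show ?case by blast
  qed
  \<comment> \<open>Modulo \<open>I\<close> the equation \<open>C $ 2 $ 2 = 1\<close> says that
    \<open>even_var m\<close> times an element of value \<open>g\<close> equals an expression
    already known to be rational; dividing by \<open>g\<close> is allowed in
    \<open>rational_on\<close>.\<close>
  have mid: "even_var m \<in> ?Q"
  proof -
    let ?C = "monodromy (hill_a n) (hill_b n) 1 (m - 1) :: 'k superpoly ^ 3 ^ 3"
    have C: "?C $ r $ c \<in> ?Q" for r c
      by (rule mono) (use low m in auto)
    have am: "(even_var m :: 'k superpoly) \<in> superpolys_in {1..n}" using m by (intro superpolys_in_even_var) (auto simp: n_eq)
    have "hill_a n (int m) = (even_var m :: 'k superpoly)" using m by (intro hill_a_nat) (auto simp: n_eq)
    moreover have "1 + int (m - 1) = int m" "Suc (m - 1) = m" using m by auto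
    ultimately have C22: "C $ 2 $ 2 = even_var m * ?C $ 2 $ 2 - ?C $ 1 $ 2 - hill_b n (int m) * ?C $ 3 $ 2"
      using monodromy_Suc(2)[of "hill_a n :: int \<Rightarrow> 'k superpoly" "hill_b n" 1 "m - 1" 2] by (simp only:)
    let ?f = "1 + ?C $ 1 $ 2 + hill_b n (int m) * ?C $ 3 $ 2"
    have f: "?f \<in> ?Q" by (intro add one C mult odd[OF hill_b_in[OF n] hill_b_odd])
    have Cin: "?C $ 2 $ 2 \<in> superpolys_in {1..n}" using C[of 2 2] by simp
    have "even_var m * ?C $ 2 $ 2 - ?f \<in> I"
      using elimination(1) unfolding C22 by (simp add: algebra_simps)
    then have "even_var m * ?C $ 2 $ 2 \<in> ?Q"
      by (rule congI[OF superpolys_in_mult[OF am Cin] f])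
    then have "rational_on g (\<lambda>u. value_at (\<sigma> u) (even_var m * ?C $ 2 $ 2))" by simp
    then have "rational_on g (\<lambda>u. poly g u * value_at (\<sigma> u) (even_var m))"
    proof (rule rational_on_cong)
      fix u assume u: "poly g u \<noteq> 0"
      show "value_at (\<sigma> u) (even_var m * ?C $ 2 $ 2) = poly g u * value_at (\<sigma> u) (even_var m)"
        using hill_pt_mult[OF ok[OF u] am Cin] value_at_monodromy[OF ok[OF u]] by (simp add: g mult.commute)
    qed
    then have "rational_on g (\<lambda>u. value_at (\<sigma> u) (even_var m))" by (rule rational_on_divide)
    then show ?thesis using am by simp
  qed
  have lowm: "even_var i \<in> ?Q" if "i \<in> {1..m}" for i
    using low[of i] mid that by (cases "i = m") auto
  have C: "C $ r $ c \<in> ?Q" for r c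
    by (rule mono) (use lowm in auto)
  have "f \<in> ?Q"
    using f
  proof (rule superpoly_generated)
    fix i assume i: "i \<in> {1..n}"
    show "odd_var i \<in> ?Q" by (rule odd[OF superpolys_in_odd_var[OF i] odd_var_odd])
    have "i \<in> {1..m} \<or> i = Suc m \<or> i = n" using i by (auto simp: n_eq)
    then show "even_var i \<in> ?Q"
    proof (elim disjE)
      assume "i = Suc m"
      then show ?thesis using congI[OF last_even_var(1) C elimination(5)] by (simp only:)
    next
      assume "i = n"
      moreover have "even_var n - (- C $ 2 $ 1) \<in> I" using elimination(2) by simp
      ultimately show ?thesis using congI[OF last_even_var(2) uminus[OF C]] by (simp only:)
    qed (rule lowm)
  qed (rule scalar add mult; assumption)+
  then show ?thesis by blast
qed

end


lemma (in supercommutative_superalgebra) even_annihilator_ideal: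
  assumes y: "y \<in> carrier A"
  shows "ideal (even_annihilator A y) (even_ring A)"
proof -
  interpret E: cring "even_ring A" by (rule cring_even_ring)
  have inv: "\<ominus>\<^bsub>even_ring A\<^esub> x = \<ominus> x" if "x \<in> even_part A" for x
    using E.minus_equality[of "\<ominus> x" x] that even_a_inv[OF that] even_subset[OF that] by (simp add: l_neg)
  show ?thesis
  proof (rule idealI[OF E.ring_axioms])
    show "subgroup (even_annihilator A y) (add_monoid (even_ring A))"
    proof (rule subgroup.intro)
      show "inv\<^bsub>add_monoid (even_ring A)\<^esub> x \<in> even_annihilator A y" if "x \<in> even_annihilator A y" for x
      proof -
        have x: "x \<in> even_part A" "x \<otimes> y = \<zero>" using that by (simp_all add: even_annihilator_def)
        then have "\<ominus> x \<in> even_annihilator A y"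
          using y even_subset[OF x(1)] by (simp add: even_annihilator_def even_a_inv l_minus)
        then show ?thesis using inv[OF x(1)] by (simp add: a_inv_def)
      qed
    qed (use y in \<open>auto simp: even_annihilator_def even_add even_zero l_distr even_subset\<close>)
  next
    fix a x assume a: "a \<in> even_annihilator A y" and x: "x \<in> carrier (even_ring A)"
    then have *: "a \<in> even_part A" "a \<otimes> y = \<zero>" "x \<in> even_part A" "a \<in> carrier A" "x \<in> carrier A"
      by (simp_all add: even_annihilator_def even_subset)
    then have "x \<otimes> a \<in> even_annihilator A y" using y by (simp add: even_annihilator_def even_even m_assoc)
    moreover have "a \<otimes> x = x \<otimes> a" using * even_central by blast
    ultimately show "x \<otimes>\<^bsub>even_ring A\<^esub> a \<in> even_annihilator A y" "a \<otimes>\<^bsub>even_ring A\<^esub> x \<in> even_annihilator A y"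
      by simp_all
  qed
qed

text \<open>For odd elements whose product is zero: the annihilator is then the whole even part, and
  the zero ring left over has no Krull dimension, so they are not odd parameters.\<close>

lemma no_prime_in_trivial_quotient:
  assumes "cring R" "primeideal P (R Quot carrier R)"
  shows False
proof -
  interpret R: cring R by (rule assms(1))
  interpret P: primeideal P "R Quot carrier R" by (rule assms(2))
  have "ideal (carrier R) R" by (rule R.oneideal)
  then have "carrier R +>\<^bsub>R\<^esub> x = carrier R" if "x \<in> carrier R" for x
    using R.a_rcos_zero that by blast
  then have "carrier (R Quot carrier R) \<subseteq> {carrier R}"
    by (auto simp: FactRing_def A_RCOSETS_def')
  moreover have "carrier R \<in> P" using additive_subgroup.zero_closed[OF P.additive_subgroup_axioms] by (simp add: FactRing_def)
  moreover have "P \<subseteq> carrier (R Quot carrier R)" by (rule P.a_subset)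
  ultimately have "carrier (R Quot carrier R) = P" by blast
  then show False using P.I_notcarr by simp
qed

lemma gvar_product:
  "sorted_wrt (<) xs \<Longrightarrow> foldr (*) (map gvar xs) 1 = gmono (set xs) (1 :: 'c::comm_ring_1)"
proof (induction xs)
  case Nil
  show ?case by (simp add: gmono_empty)
next
  case (Cons x xs)
  have "gvar x * gmono (set xs) 1 = gmono (insert x (set xs)) (shuffle_sign {x} (set xs) :: 'c)"
    unfolding gmono_singleton[symmetric] using Cons.prems by (subst gmono_times) auto
  also have "shuffle_sign {x} (set xs) = (1 :: 'c)"
    by (rule shuffle_sign_singleton_less) (use Cons.prems in auto)
  finally show ?case using Cons by simp
qed

lemma gcoeff_times_gmono:
  assumes "finite S"
  shows "gcoeff (f * gmono S 1) S = gcoeff f {}"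
proof -
  have "gcoeff (f * gmono S 1) S = (\<Sum>T\<in>{{}}. shuffle_sign T (S - T) * gcoeff f T * gcoeff (gmono S 1) (S - T))"
    unfolding gcoeff_times by (rule sum.mono_neutral_right) (use assms in \<open>auto simp: gmono.rep_eq\<close>)
  then show ?thesis using assms by (simp add: gmono.rep_eq)
qed

text \<open>Every odd factor contributes at least one generator, and the contributions are
  disjoint.\<close>

lemma gcoeff_odd_product_card:
  assumes "set gs \<subseteq> grassmann_part False" "gcoeff (foldr (*) gs 1) S \<noteq> 0"
  shows "length gs \<le> card S"
  using assms
proof (induction gs arbitrary: S)
  case (Cons g gs)
  obtain T where T: "T \<subseteq> S" "gcoeff g T \<noteq> 0" "gcoeff (foldr (*) gs 1) (S - T) \<noteq> 0" "finite S"
    using Cons.prems(2) by (auto elim: gcoeff_times_nonzero)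
  have "odd (card T)" using T(2) Cons.prems(1) by (auto simp: grassmann_part_def)
  then have "card T \<ge> 1" by (cases "card T") auto
  moreover have "card S = card T + card (S - T)"
    using T by (metis Diff_disjoint Un_Diff_cancel card_Un_disjoint finite_Diff finite_subset sup.absorb2)
  ultimately show ?case using Cons.IH[OF _ T(3)] Cons.prems(1) by simp
qed simp

context hill_variety
begin

section \<open>The primes of points and the bound on chains\<close>

abbreviation E :: "'k superpoly ring" where "E \<equiv> even_ring B"

lemma E_cring: "cring E"
  by (rule B.cring_even_ring)

lemma E_minus_one: "- 1 \<in> carrier E"
  by (simp add: superpolys_in_uminus grassmann_part_uminus one_even)

lemma E_a_inv: "f \<in> carrier E \<Longrightarrow> \<ominus>\<^bsub>E\<^esub> f = - f"
proof -
  interpret E: cring E by (rule E_cring)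
  assume "f \<in> carrier E"
  then show ?thesis
    using E.minus_equality[of "- f" f] by (simp add: superpolys_in_uminus grassmann_part_uminus)
qed

text \<open>Increasing \<open>j\<close> fixes one more coordinate at 2, which shrinks the family of
  points and enlarges the ideal. The value 2 leaves admissible points for every \<open>j\<close>, by
  \<open>continuant_increasing\<close>.\<close>

definition hill_prime :: "nat \<Rightarrow> 'k superpoly set" where
  "hill_prime j = {f \<in> carrier E. \<forall>s\<in>admissible j. value_at s f = 0}"

lemma of_int_admissible:
  assumes "\<And>i. t i \<ge> 2" "\<And>i. i \<in> {1..j} \<Longrightarrow> t i = 2"
  shows "(\<lambda>i. of_int (t i)) \<in> admissible j"
proof -
  have "continuant t (m - 1) \<noteq> 0" using continuant_increasing[of t "m - 1"] assms(1) by force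
  then show ?thesis using assms(2) by (simp add: admissible_def continuant_of_int)
qed

lemma admissible_ok: "s \<in> admissible j \<Longrightarrow> continuant s (m - 1) \<noteq> 0"
  by (simp add: admissible_def)

lemma hill_prime_ideal: "ideal (hill_prime j) E"
proof -
  interpret E: cring E by (rule E_cring)
  show ?thesis
  proof (rule idealI[OF E.ring_axioms])
    show "subgroup (hill_prime j) (add_monoid E)"
    proof (rule subgroup.intro)
      show "hill_prime j \<subseteq> carrier (add_monoid E)" by (auto simp: hill_prime_def)
      show "\<one>\<^bsub>add_monoid E\<^esub> \<in> hill_prime j"
        by (auto simp: hill_prime_def hill_pt_zero[OF admissible_ok])
      show "f \<otimes>\<^bsub>add_monoid E\<^esub> g \<in> hill_prime j" if "f \<in> hill_prime j" "g \<in> hill_prime j" for f g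
        using that by (auto simp: hill_prime_def superpolys_in_add grassmann_part_add hill_pt_add[OF admissible_ok])
      show "inv\<^bsub>add_monoid E\<^esub> f \<in> hill_prime j" if "f \<in> hill_prime j" for f
      proof -
        have f: "f \<in> carrier E" using that by (simp add: hill_prime_def)
        have "value_at s (0 - f) = 0" if "s \<in> admissible j" for s
          using hill_pt_diff[OF admissible_ok[OF that], of 0 f] hill_pt_zero[OF admissible_ok[OF that]] f
            \<open>f \<in> hill_prime j\<close> that by (simp add: hill_prime_def)
        then have "- f \<in> hill_prime j"
          using f by (simp add: hill_prime_def superpolys_in_uminus grassmann_part_uminus)
        then show ?thesis using E_a_inv[OF f] by (simp add: a_inv_def)
      qed
    qed
    fix f g assume f: "f \<in> hill_prime j" and g: "g \<in> carrier E"
    then have "f * g = g * f" using grassmann_part_commute[of f True g True] by (simp add: hill_prime_def)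
    moreover have "g * f \<in> hill_prime j"
      using f g grassmann_part_times[of g True f True]
      by (auto simp: hill_prime_def superpolys_in_mult hill_pt_mult[OF admissible_ok])
    ultimately show "g \<otimes>\<^bsub>E\<^esub> f \<in> hill_prime j" "f \<otimes>\<^bsub>E\<^esub> g \<in> hill_prime j" by simp_all
  qed
qed

text \<open>
  If neither of two functions vanishes on all admissible points, restrict them to the line through a
  point where the first and a point where the second is nonzero: there they are nonzero rational
  functions of one variable, hence nonzero at a common point.
\<close>

lemma hill_prime_primeideal: "primeideal (hill_prime j) E"
proof (rule primeidealI[OF hill_prime_ideal E_cring])
  show "carrier E \<noteq> hill_prime j"
  proof
    assume "carrier E = hill_prime j"
    moreover have "1 \<in> carrier E" by (simp add: one_even)
    ultimately have "1 \<in> hill_prime j" by simp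
    moreover have "(\<lambda>i. of_int 2) \<in> admissible j" by (rule of_int_admissible) auto
    ultimately have "value_at (\<lambda>i. of_int 2) 1 = 0" unfolding hill_prime_def by blast
    then show False
      using hill_pt_one[OF admissible_ok[OF \<open>(\<lambda>i. of_int 2) \<in> admissible j\<close>]] by (simp add: gcoeff_one)
  qed
next
  fix f f' assume f: "f \<in> carrier E" "f' \<in> carrier E" "f \<otimes>\<^bsub>E\<^esub> f' \<in> hill_prime j"
  show "f \<in> hill_prime j \<or> f' \<in> hill_prime j"
  proof (rule ccontr)
    assume "\<not> ?thesis"
    then obtain s s' where s: "s \<in> admissible j" "value_at s f \<noteq> 0" "s' \<in> admissible j" "value_at s' f' \<noteq> 0"
      using f by (auto simp: hill_prime_def)
    define \<sigma> where "\<sigma> u = (\<lambda>i. (1 - u) * s i + u * s' i)" for u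
    have ends: "\<sigma> 0 = s" "\<sigma> 1 = s'" by (simp_all add: \<sigma>_def)
    obtain g where g: "\<And>u. poly g u = continuant (\<sigma> u) (m - 1)"
      unfolding \<sigma>_def using continuant_line_poly[of s s' "m - 1"] by blast
    have fB: "f \<in> superpolys_in {1..n}" "f' \<in> superpolys_in {1..n}" using f by simp_all
    obtain N p where p: "\<And>u. poly g u \<noteq> 0 \<Longrightarrow> poly g u ^ N * value_at (\<sigma> u) f = poly p u"
      using value_at_rational[OF g[unfolded \<sigma>_def] fB(1)] unfolding rational_on_def \<sigma>_def by blast
    obtain N' p' where p': "\<And>u. poly g u \<noteq> 0 \<Longrightarrow> poly g u ^ N' * value_at (\<sigma> u) f' = poly p' u"
      using value_at_rational[OF g[unfolded \<sigma>_def] fB(2)] unfolding rational_on_def \<sigma>_def by blast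
    have g01: "poly g 0 \<noteq> 0" "poly g 1 \<noteq> 0" using s admissible_ok unfolding g ends by blast+
    have "poly p 0 \<noteq> 0" using p[OF g01(1)] g01(1) s(2) unfolding ends by auto
    moreover have "poly p' 1 \<noteq> 0" using p'[OF g01(2)] g01(2) s(4) unfolding ends by auto
    ultimately have "g \<noteq> 0" "p \<noteq> 0" "p' \<noteq> 0" using g01(1) by auto
    then obtain u where u: "poly g u \<noteq> 0" "poly p u \<noteq> 0" "poly p' u \<noteq> 0" by (rule polys_common_nonzero)
    \<comment> \<open>A coordinate equal to 2 at both ends is 2 on the whole line, so the line stays
      in the family wherever \<open>g\<close> is nonzero.\<close>
    have adm: "\<sigma> u \<in> admissible j"
      using s u(1) unfolding admissible_def g by (auto simp: \<sigma>_def algebra_simps)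
    have "value_at (\<sigma> u) f \<noteq> 0" "value_at (\<sigma> u) f' \<noteq> 0" using p[OF u(1)] p'[OF u(1)] u by auto
    then have "value_at (\<sigma> u) (f * f') \<noteq> 0"
      using hill_pt_mult[OF admissible_ok[OF adm] fB] by simp
    moreover have "value_at (\<sigma> u) (f * f') = 0" using f(3) adm by (simp add: hill_prime_def)
    ultimately show False by simp
  qed
qed

lemma hill_prime_chain: "prime_chain E (m - 1) hill_prime"
  unfolding prime_chain_def
proof (intro conjI allI impI)
  show "primeideal (hill_prime j) E" for j by (rule hill_prime_primeideal)
  fix j assume j: "j < m - 1"
  then have i: "Suc j \<in> {1..<m}" by auto
  have sub: "hill_prime j \<subseteq> hill_prime (Suc j)" by (auto simp: hill_prime_def admissible_def)
  let ?f = "even_var (Suc j) - gconst (Poly_Mapping.single 0 2) :: 'k superpoly"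
  have var: "(even_var (Suc j) :: 'k superpoly) \<in> superpolys_in {1..n}" using i by (intro superpolys_in_even_var) (auto simp: n_eq)
  have val: "value_at s ?f = s (Suc j) - 2" if "continuant s (m - 1) \<noteq> 0" for s
    using hill_pt_diff[OF that var superpolys_in_scalar[of 2]] hill_pt_even_var[OF that i] hill_pt_scalar[OF that, of 2]
    by (simp add: gconst.rep_eq)
  have "?f \<in> superpolys_in {1..n}" by (rule superpolys_in_diff[OF var superpolys_in_scalar])
  moreover have "?f \<in> grassmann_part True" by (rule grassmann_part_diff[OF even_var_even gconst_even])
  ultimately have fE: "?f \<in> carrier E" by simp
  have vanish: "value_at s ?f = 0" if s: "s \<in> admissible (Suc j)" for s
  proof -
    have "s (Suc j) = 2" using s by (simp add: admissible_def)
    then show ?thesis unfolding val[OF admissible_ok[OF s]] by simp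
  qed
  have mem: "?f \<in> hill_prime (Suc j)"
    unfolding hill_prime_def by (intro CollectI conjI ballI fE vanish)
  have notin: "?f \<notin> hill_prime j"
  proof
    assume f: "?f \<in> hill_prime j"
    \<comment> \<open>All entries 2 except a 3 at position \<open>j + 1\<close>: admissible for
      \<open>j\<close>, yet the separating function takes the value 1 there.\<close>
    let ?t = "\<lambda>i. if i = Suc j then 3 else 2 :: int"
    define s where "s i = (of_int (?t i) :: 'k)" for i
    have adm: "s \<in> admissible j" unfolding s_def by (rule of_int_admissible) auto
    have "\<forall>s\<in>admissible j. value_at s ?f = 0"
      using f unfolding hill_prime_def mem_Collect_eq by (rule conjunct2)
    from bspec[OF this adm] have "s (Suc j) - 2 = 0" unfolding val[OF admissible_ok[OF adm]] .
    then show False by (simp add: s_def)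
  qed
  show "hill_prime j \<subset> hill_prime (Suc j)"
  proof (rule psubsetI[OF sub], rule notI)
    assume eq: "hill_prime j = hill_prime (Suc j)"
    have "?f \<in> hill_prime j" by (subst eq) (rule mem)
    with notin show False by (rule notE)
  qed
qed

abbreviation top_odd :: "'k superpoly" where
  "top_odd \<equiv> foldr (*) (map odd_var [1..<Suc m]) 1"

text \<open>At each point \<open>top_odd\<close> becomes the monomial of \<open>{1..m}\<close>. The
  coefficient of that monomial in the value of \<open>f * top_odd\<close> is the body of the value
  of \<open>f\<close>, which therefore vanishes.\<close>

lemma annihilator_in_hill_prime:
  assumes "f \<in> carrier E" "f * top_odd \<in> I"
  shows "f \<in> hill_prime 0"
proof -
  have "value_at s f = 0" if s: "s \<in> admissible 0" for s
  proof -
    note ok = admissible_ok[OF s]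
    have prod: "(foldr (*) (map odd_var xs) 1 :: 'k superpoly) \<in> superpolys_in {1..n}
        \<and> hill_pt s (foldr (*) (map odd_var xs) 1) = foldr (*) (map gvar xs) 1" if "set xs \<subseteq> {1..m}" for xs
      using that
    proof (induction xs)
      case (Cons x xs)
      then have x: "x \<in> {1..m}" "(odd_var x :: 'k superpoly) \<in> superpolys_in {1..n}"
        by (auto intro!: superpolys_in_odd_var simp: n_eq)
      then show ?case using Cons hill_pt_odd_var[OF ok x(1)]
        by (simp add: superpolys_in_mult hill_pt_mult[OF ok])
    qed (simp add: hill_pt_one[OF ok])
    define L where "L = [1..<Suc m]"
    have L: "set L = {1..m}" "sorted_wrt (<) L" unfolding L_def by (auto simp del: upt_Suc)
    have fB: "f \<in> superpolys_in {1..n}" using assms(1) by simp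
    have "hill_pt s f * gmono {1..m} 1 = hill_pt s (f * foldr (*) (map odd_var L) 1)"
      using prod[of L] gvar_product[OF L(2), where 'c = 'k] hill_pt_mult[OF ok fB] by (simp add: L(1))
    also have "\<dots> = 0" unfolding L_def by (rule hill_pt_I[OF ok assms(2)])
    finally have "hill_pt s f * gmono {1..m} 1 = 0" .
    then show ?thesis using gcoeff_times_gmono[of "{1..m}" "hill_pt s f"] by simp
  qed
  then show ?thesis using assms(1) by (simp add: hill_prime_def)
qed

text \<open>With zero body the element would be nilpotent. But setting all even variables to 2 and
  all odd ones to 0 turns \<open>C $ 2 $ 2\<close> into the continuant \<open>m + 1\<close>, and the
  difference \<open>m\<close> is nonzero in characteristic zero.\<close>

lemma defining_equation_nontrivial: "gcoeff (C $ 2 $ 2 - 1) {} \<noteq> 0"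
proof
  assume "gcoeff (C $ 2 $ 2 - 1) {} = 0"
  then obtain k where k: "(C $ 2 $ 2 - 1) ^ k = 0" using grassmann_nilpotent by blast
  interpret E: superalg_evaluation grassmann_algebra "\<lambda>_. gconst (2 :: 'k)" "\<lambda>_. 0"
    by (rule superalg_evaluation.intro[OF grassmann_algebra_supercommutative])
      (simp add: superalg_evaluation_axioms_def gconst_even)
  let ?\<psi> = E.superpoly_eval
  have point: "superpoly_point n grassmann_algebra ?\<psi>"
    by (intro superpoly_point.intro superpoly_point_axioms.intro hill_superspace_axioms
        grassmann_algebra_supercommutative E.superpoly_eval_closed E.superpoly_eval_add
        E.superpoly_eval_mult E.superpoly_eval_one)
  have a: "?\<psi> (hill_a n j) = gconst 2" for j by (simp only: hill_a_def E.superpoly_eval_even_var)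
  have b: "?\<psi> (hill_b n j) \<in> grassmann_part False" for j
    using E.superpoly_eval_part[OF hill_b_odd, of n j] by simp
  have "gcoeff (?\<psi> (C $ 2 $ 2)) {} = continuant (\<lambda>_. 2) m"
    using monodromy_continuant[of "\<lambda>j. ?\<psi> (hill_b n j)" "\<lambda>j. ?\<psi> (hill_a n j)" m, OF b]
    unfolding point_monodromy[OF point] a by (simp add: gconst.rep_eq)
  then have "gcoeff (?\<psi> (C $ 2 $ 2)) {} = of_nat (Suc m)" by (simp only: continuant_two)
  moreover have "?\<psi> (C $ 2 $ 2) = ?\<psi> (C $ 2 $ 2 - 1) + 1"
    using E.superpoly_eval_add[of "C $ 2 $ 2 - 1" 1] E.superpoly_eval_one by simp
  ultimately have "gcoeff (?\<psi> (C $ 2 $ 2 - 1)) {} = of_nat m" by (simp add: gcoeff_one)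
  moreover have "?\<psi> (f ^ k) = ?\<psi> f ^ k" for f k
    by (induction k) (use E.superpoly_eval_one E.superpoly_eval_mult in simp_all)
  then have "gcoeff (?\<psi> (C $ 2 $ 2 - 1)) {} ^ k = 0"
    using k E.superpoly_eval_zero gcoeff_power_empty by (metis gcoeff_zero grassmann_superalg_simps(4))
  ultimately show False using m by simp
qed

text \<open>
  Modulo \<open>I\<close> and nilpotents the even part is a quotient of the polynomial ring in \<open>m\<close> variables.
  The zero ideal of that ring is put below the chain, which is possible since \<open>C $ 2 $ 2 - 1\<close> has
  nonzero body.
\<close>

lemma prime_chain_bound:
  assumes P: "prime_chain E e P" and I0: "\<And>f. f \<in> carrier E \<Longrightarrow> f \<in> I \<Longrightarrow> f \<in> P 0"
  shows "e \<le> m - 1"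
proof -
  interpret E: cring E by (rule E_cring)
  have prime: "primeideal (P i) E" if "i \<le> e" for i using P that by (simp add: prime_chain_def)
  have I: "f \<in> P i" if "f \<in> carrier E" "f \<in> I" "i \<le> e" for f i
    using that(3)
  proof (induction i)
    case (Suc i)
    then show ?case using P unfolding prime_chain_def by (metis Suc_leD Suc_le_eq psubsetD)
  qed (use I0 that in blast)
  have carr: "f \<in> carrier E" if "f \<in> P i" "i \<le> e" for f i
    using prime[OF that(2)] that(1) by (meson ideal.Icarr primeideal.axioms(1))
  have mult: "g * f \<in> P i" if "f \<in> P i" "g \<in> carrier E" "i \<le> e" for f g i
    using ideal.I_l_closed[OF primeideal.axioms(1)[OF prime[OF that(3)]] that(1,2)] by simp
  have add: "f + g \<in> P i" if "f \<in> P i" "g \<in> P i" "i \<le> e" for f g i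
    using additive_subgroup.a_closed[OF ideal.axioms(1)[OF primeideal.axioms(1)[OF prime[OF that(3)]]] that(1,2)]
    by simp
  have diff: "f - g \<in> P i" if "f \<in> P i" "g \<in> P i" "i \<le> e" for f g i
    using add[OF that(1) mult[OF that(2) E_minus_one that(3)] that(3)] by simp
  have split: "f \<in> P i \<or> g \<in> P i" if "f * g \<in> P i" "f \<in> carrier E" "g \<in> carrier E" "i \<le> e" for f g i
    using primeideal.I_prime[OF prime[OF that(4)] that(2,3)] that(1) by simp
  have one: "1 \<notin> P i" if "i \<le> e" for i
  proof
    assume "1 \<in> P i"
    then have "P i = carrier E"
      using ideal.one_imp_carrier[OF primeideal.axioms(1)[OF prime[OF that]]] by simp
    then show False using primeideal.I_notcarr[OF prime[OF that]] by simp
  qed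
  have zero: "0 \<in> P i" if "i \<le> e" for i
    using additive_subgroup.zero_closed[OF ideal.axioms(1)[OF primeideal.axioms(1)[OF prime[OF that]]]] by simp
  \<comment> \<open>An element without body is nilpotent and so lies in every prime; passing to
    bodies therefore loses nothing.\<close>
  have nil: "f \<in> P i" if f: "f \<in> carrier E" "gcoeff f {} = 0" and i: "i \<le> e" for f i
  proof -
    obtain k where k: "f ^ k = 0" using grassmann_nilpotent[OF f(2)] .
    have pow: "f ^ l \<in> carrier E" for l
      by (induction l) (use f(1) grassmann_part_times[of f True _ True] in \<open>auto simp: one_even superpolys_in_mult\<close>)
    have "f ^ l \<in> P i \<Longrightarrow> f \<in> P i" for l
    proof (induction l)
      case 0
      then show ?case using one[OF i] by simp
    next
      case (Suc l)
      then show ?case using split[of f "f ^ l" i] f(1) pow i by auto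
    qed
    then show ?thesis using k zero[OF i] by metis
  qed
  have gc: "gconst t \<in> carrier E" if "t \<in> polys_in {1..m}" for t :: "(nat \<Rightarrow>\<^sub>0 nat) \<Rightarrow>\<^sub>0 'k"
    using superpolys_in_m[OF superpolys_in_gconst[OF that]] by (simp add: gconst_even)
  define R where "R i = {t \<in> polys_in {1..m}. gconst t \<in> P i}" for i
  have R_prime: "poly_prime {1..m} (R i)" if i: "i \<le> e" for i
    unfolding poly_prime_def
  proof (intro conjI ballI impI)
    show "0 \<in> R i" using zero[OF i] by (simp add: R_def)
    show "1 \<notin> R i" using one[OF i] by (simp add: R_def)
    show "p - q \<in> R i" if "p \<in> R i" "q \<in> R i" for p q
    proof -
      have "gconst (p - q) = gconst p - gconst q"
        using gconst_add[of p "- q"] gconst_uminus[of q] by simp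
      then show ?thesis using that diff[OF _ _ i] by (auto simp: R_def intro: polys_in_diff)
    qed
    show "p * q \<in> R i" if "p \<in> polys_in {1..m}" "q \<in> R i" for p q
      using that mult[OF _ gc i] by (auto simp: R_def gconst_mult intro: polys_in_mult)
    show "p \<in> R i \<or> q \<in> R i" if "p \<in> polys_in {1..m}" "q \<in> polys_in {1..m}" "p * q \<in> R i" for p q
      using that split[OF _ gc gc i] by (auto simp: R_def gconst_mult)
  qed
  \<comment> \<open>A single polynomial \<open>t\<close>, the body of an even representative in
    \<open>m\<close> variables, works for all primes of the chain at once. Strict inclusions
    therefore survive the restriction to \<open>R\<close>.\<close>
  have reduce: "\<exists>t\<in>polys_in {1..m}. \<forall>i\<le>e. gconst t \<in> P i \<longleftrightarrow> f \<in> P i" if f: "f \<in> carrier E" for f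
  proof -
    obtain g where g: "g \<in> superpolys_in {1..m}" "g \<in> grassmann_part True" "f - g \<in> I"
      using homogeneous_representative[of f True] f by auto
    let ?t = "gcoeff g {}"
    have t: "?t \<in> polys_in {1..m}" by (rule superpolys_in_gcoeff[OF g(1)])
    have gE: "g \<in> carrier E" using g superpolys_in_m by simp
    have "f - g \<in> carrier E" "g - gconst ?t \<in> carrier E"
      using f gE gc[OF t] by (simp_all add: superpolys_in_diff grassmann_part_diff)
    moreover have "gcoeff (g - gconst ?t) {} = 0" by (simp add: gconst.rep_eq)
    ultimately have d: "f - g \<in> P i" "g - gconst ?t \<in> P i" if "i \<le> e" for i
      using I[of "f - g"] g(3) nil that by blast+
    have "gconst ?t \<in> P i \<longleftrightarrow> f \<in> P i" if i: "i \<le> e" for i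
    proof
      assume "gconst ?t \<in> P i"
      from add[OF add[OF this d(2)[OF i] i] d(1)[OF i] i] show "f \<in> P i" by simp
    next
      assume "f \<in> P i"
      from diff[OF diff[OF this d(1)[OF i] i] d(2)[OF i] i] show "gconst ?t \<in> P i" by simp
    qed
    with t show ?thesis by blast
  qed
  define S where "S i = (case i of 0 \<Rightarrow> {0} | Suc j \<Rightarrow> R j)" for i
  have "Suc e \<le> card {1..m}"
  proof (rule poly_prime_chain_length)
    show "poly_prime {1..m} (S i)" if "i \<le> Suc e" for i
      using that R_prime by (cases i) (simp_all add: S_def poly_prime_zero)
    show "S i \<subseteq> polys_in {1..m}" if "i \<le> Suc e" for i
      by (cases i) (auto simp: S_def R_def)
    show "S i \<subset> S (Suc i)" if "i < Suc e" for i
    proof (cases i)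
      case 0
      have cE: "C $ 2 $ 2 - 1 \<in> carrier E"
        using superpolys_in_m[OF C_in[of 2 2]] monodromy_grassmann_part[of 1 m "hill_a n :: int \<Rightarrow> 'k superpoly" "hill_b n" 2 2]
        by (simp add: superpolys_in_diff grassmann_part_diff one_even hill_a_even hill_b_odd)
      let ?t = "gcoeff (C $ 2 $ 2 - 1) {}"
      have t: "?t \<in> polys_in {1..m}"
        by (rule superpolys_in_gcoeff) (use C_in superpolys_in_diff superpolys_in_1 in blast)
      \<comment> \<open>The defining element lies in \<open>P 0\<close>, and so does its nilpotent
        part; hence its body gives a nonzero polynomial in \<open>R 0\<close>.\<close>
      have "C $ 2 $ 2 - 1 - gconst ?t \<in> P 0"
        by (rule nil) (use cE gc[OF t] in \<open>simp_all add: superpolys_in_diff grassmann_part_diff gconst.rep_eq\<close>)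
      then have "gconst ?t \<in> P 0"
        using diff[OF I[OF cE elimination(1)], of 0 "C $ 2 $ 2 - 1 - gconst ?t"] by simp
      then have "?t \<in> R 0" using t by (simp add: R_def)
      moreover have "0 \<in> R 0" using R_prime[of 0] by (simp add: poly_prime_def)
      ultimately have "{0} \<subset> R 0" using defining_equation_nontrivial by blast
      then show ?thesis unfolding 0 by (simp add: S_def)
    next
      case (Suc j)
      then have j: "j < e" using that by simp
      then have "P j \<subset> P (Suc j)" using P by (simp add: prime_chain_def)
      then obtain f where f: "f \<in> P (Suc j)" "f \<notin> P j" "P j \<subseteq> P (Suc j)" by blast
      then have "f \<in> carrier E" using carr[of f "Suc j"] j by simp
      then obtain t where "t \<in> polys_in {1..m}" "\<forall>i\<le>e. gconst t \<in> P i \<longleftrightarrow> f \<in> P i" using reduce by blast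
      then have "t \<in> R (Suc j)" "t \<notin> R j" using f j by (simp_all add: R_def)
      moreover have "R j \<subseteq> R (Suc j)" using f(3) by (auto simp: R_def)
      ultimately show ?thesis unfolding Suc by (auto simp: S_def)
    qed
  qed simp
  then show ?thesis by simp
qed


section \<open>The superdimension\<close>

lemma even_proj_hom: "ring_hom_ring E (even_ring Q) proj"
proof (rule ring_hom_ringI)
  show "ring E" by (rule cring.axioms(1)[OF E_cring])
  show "ring (even_ring Q)"
    by (rule cring.axioms(1)[OF supercommutative_superalgebra.cring_even_ring[OF Q_supercommutative]])
  show "proj f \<in> carrier (even_ring Q)" if "f \<in> carrier E" for f
    using that unfolding even_ring_simps Q_parts by simp
  fix f g assume "f \<in> carrier E" "g \<in> carrier E"
  then have fg: "f \<in> superpolys_in {1..n}" "g \<in> superpolys_in {1..n}" by simp_all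
  show "proj (f \<otimes>\<^bsub>E\<^esub> g) = proj f \<otimes>\<^bsub>even_ring Q\<^esub> proj g"
    unfolding even_ring_simps affine_superspace_simps by (rule proj_mult[OF fg, symmetric])
  show "proj (f \<oplus>\<^bsub>E\<^esub> g) = proj f \<oplus>\<^bsub>even_ring Q\<^esub> proj g"
    unfolding even_ring_simps affine_superspace_simps by (rule proj_add[OF fg, symmetric])
next
  show "proj \<one>\<^bsub>E\<^esub> = \<one>\<^bsub>even_ring Q\<^esub>"
    unfolding even_ring_simps affine_superspace_simps by (rule proj_one)
qed

lemma even_proj_surj: "proj ` carrier E = carrier (even_ring Q)"
  unfolding even_ring_simps Q_parts affine_superspace_simps by (rule refl)

lemma even_ring_krull_dim: "has_krull_dim (even_ring Q) (m - 1)"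
proof (rule has_krull_dim_surjective[OF E_cring _ even_proj_hom even_proj_surj hill_prime_chain])
  show "cring (even_ring Q)"
    by (rule supercommutative_superalgebra.cring_even_ring[OF Q_supercommutative])
  fix f assume f: "f \<in> carrier E" "proj f = \<zero>\<^bsub>even_ring Q\<^esub>"
  then have "f \<in> I" using proj_eq_zero_iff[of f] by simp
  then have "value_at s f = 0" if "s \<in> admissible 0" for s
    using hill_pt_I[OF admissible_ok[OF that]] by simp
  then show "f \<in> hill_prime 0" using f(1) by (simp add: hill_prime_def)
next
  fix e P assume P: "prime_chain E e P" "\<And>f. f \<in> carrier E \<Longrightarrow> proj f = \<zero>\<^bsub>even_ring Q\<^esub> \<Longrightarrow> f \<in> P 0"
  show "e \<le> m - 1"
  proof (rule prime_chain_bound[OF P(1)])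
    fix f assume f: "f \<in> carrier E" "f \<in> I"
    then have "proj f = \<zero>\<^bsub>even_ring Q\<^esub>" using proj_eq_zero_iff[of f] by simp
    then show "f \<in> P 0" using P(2) f(1) by blast
  qed
qed

lemma proj_foldr:
  assumes "set fs \<subseteq> superpolys_in {1..n}"
  shows "foldr (monoid.mult Q) (map proj fs) \<one>\<^bsub>Q\<^esub> = proj (foldr (*) fs 1) \<and> foldr (*) fs 1 \<in> superpolys_in {1..n}"
  using assms
proof (induction fs)
  case Nil
  then show ?case using proj_one by simp
next
  case (Cons f fs)
  then show ?case using proj_mult[of f "foldr (*) fs 1"] by (simp add: superpolys_in_mult)
qed

text \<open>The kernel of the composite map from \<open>E\<close> consists of the \<open>f\<close>
  with \<open>f * top_odd\<close> in \<open>I\<close>. It contains the even elements of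
  \<open>I\<close> and lies in \<open>hill_prime 0\<close>, so the chain and the bound used for the
  even part apply again.\<close>

lemma quotient_krull_dim:
  "has_krull_dim (even_ring Q Quot even_annihilator Q (proj top_odd)) (m - 1)"
proof -
  interpret Q: supercommutative_superalgebra Q by (rule Q_supercommutative)
  let ?A = "even_annihilator Q (proj top_odd)" and ?R = "even_ring Q"
  let ?h = "(\<lambda>x. ?A +>\<^bsub>?R\<^esub> x) \<circ> proj"
  have odd_in: "set (map odd_var [1..<Suc m]) \<subseteq> (superpolys_in {1..n} :: 'k superpoly set)"
    by (auto intro!: superpolys_in_odd_var simp: n_eq)
  have top: "top_odd \<in> superpolys_in {1..n}" using proj_foldr[OF odd_in] by blast
  have topQ: "proj top_odd \<in> carrier Q" unfolding Q_carrier using top by (rule imageI)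
  have ideal: "ideal ?A ?R" by (rule Q.even_annihilator_ideal[OF topQ])
  have cring: "cring (?R Quot ?A)" by (rule ideal.quotient_is_cring[OF ideal Q.cring_even_ring])
  have hom: "ring_hom_ring E (?R Quot ?A) ?h"
    by (intro ring_hom_ring.intro ring_hom_ring_axioms.intro cring.axioms(1) E_cring cring
        ring_hom_trans[OF ring_hom_ring.homh[OF even_proj_hom]] ideal.rcos_ring_hom[OF ideal])
  have surj: "?h ` carrier E = carrier (?R Quot ?A)"
    unfolding image_comp[symmetric] even_proj_surj by (auto simp: FactRing_def A_RCOSETS_def')
  have ker: "?h f = \<zero>\<^bsub>?R Quot ?A\<^esub> \<longleftrightarrow> f * top_odd \<in> I" if f: "f \<in> carrier E" for f
  proof -
    have fB: "f \<in> superpolys_in {1..n}" using f by simp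
    have pf: "proj f \<in> carrier ?R" using even_proj_surj f by blast
    have "?h f = \<zero>\<^bsub>?R Quot ?A\<^esub> \<longleftrightarrow> proj f \<in> ?A"
      using ideal.rcos_const_imp_mem[OF ideal pf] ring.a_rcos_zero[OF cring.axioms(1)[OF Q.cring_even_ring] ideal, of "proj f"]
      by (auto simp: FactRing_def)
    also have "\<dots> \<longleftrightarrow> proj f \<otimes>\<^bsub>Q\<^esub> proj top_odd = \<zero>\<^bsub>Q\<^esub>"
      using pf by (simp add: even_annihilator_def)
    also have "\<dots> \<longleftrightarrow> f * top_odd \<in> I"
      unfolding proj_mult[OF fB top] by (rule proj_eq_zero_iff[OF superpolys_in_mult[OF fB top]])
    finally show ?thesis .
  qed
  show ?thesis
  proof (rule has_krull_dim_surjective[OF E_cring cring hom surj hill_prime_chain])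
    fix f assume "f \<in> carrier E" "?h f = \<zero>\<^bsub>?R Quot ?A\<^esub>"
    then show "f \<in> hill_prime 0" using ker annihilator_in_hill_prime by blast
  next
    fix e P assume P: "prime_chain E e P" "\<And>f. f \<in> carrier E \<Longrightarrow> ?h f = \<zero>\<^bsub>?R Quot ?A\<^esub> \<Longrightarrow> f \<in> P 0"
    show "e \<le> m - 1"
      by (rule prime_chain_bound[OF P(1)]) (use P(2) ker I_mult_right[OF _ top] in blast)
  qed
qed

text \<open>Modulo \<open>I\<close> odd elements are represented in the first \<open>m\<close>
  variables, where a product of more than \<open>m\<close> odd elements is zero; the annihilator is
  then everything and no Krull dimension is left.\<close>

lemma odd_parameters_length:
  assumes "odd_parameters Q p ys"
  shows "length ys \<le> m"
proof (rule ccontr)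
  assume len: "\<not> length ys \<le> m"
  have "\<exists>g. g \<in> superpolys_in {1..m} \<and> g \<in> grassmann_part False \<and> y = proj g" if "y \<in> set ys" for y
  proof -
    have "y \<in> odd_part Q" using assms that by (auto simp: odd_parameters_def)
    then obtain f where f: "f \<in> superpolys_in {1..n}" "f \<in> grassmann_part False" "y = proj f"
      unfolding Q_parts by blast
    obtain g where g: "g \<in> superpolys_in {1..m}" "g \<in> grassmann_part False" "f - g \<in> I"
      using homogeneous_representative[OF f(1,2)] .
    have "f \<ominus>\<^bsub>B\<^esub> g \<in> I"
      using g(3) superpolys_in_m[OF g(1)] by (simp add: a_minus_def a_inv_affine_superspace)
    then have "proj f = proj g"
      using B.quotient_eq_iff_same_a_r_cos[OF ideal_I, of f g] f(1) superpolys_in_m[OF g(1)] by simp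
    with f(3) g show ?thesis by auto
  qed
  then obtain G where G: "\<And>y. y \<in> set ys \<Longrightarrow> G y \<in> superpolys_in {1..m} \<and> G y \<in> grassmann_part False \<and> y = proj (G y)"
    by metis
  let ?gs = "map G ys"
  have ys: "ys = map proj ?gs" using G by (simp add: map_idI)
  have gs: "set ?gs \<subseteq> superpolys_in {1..m}" "set ?gs \<subseteq> grassmann_part False" using G by auto
  have prod_in: "foldr (*) fs 1 \<in> superpolys_in {1..m}" if "set fs \<subseteq> superpolys_in {1..m}" for fs :: "'k superpoly list"
    using that by (induction fs) (auto intro: superpolys_in_mult)
  have "foldr (*) ?gs 1 = 0"
  proof (rule gcoeff_eqI, rule ccontr)
    fix S assume "gcoeff (foldr (*) ?gs 1) S \<noteq> gcoeff 0 S"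
    then have S: "gcoeff (foldr (*) ?gs 1) S \<noteq> 0" by simp
    then have "length ys \<le> card S" using gcoeff_odd_product_card[OF gs(2), of S] by simp
    moreover have "card S \<le> m"
      using card_mono[OF _ superpolys_in_support[OF prod_in[OF gs(1)] S]] by simp
    ultimately show False using len by simp
  qed
  moreover have gsn: "set ?gs \<subseteq> superpolys_in {1..n}" using gs(1) superpolys_in_m by blast
  ultimately have "foldr (monoid.mult Q) ys \<one>\<^bsub>Q\<^esub> = \<zero>\<^bsub>Q\<^esub>"
    using proj_foldr[OF gsn] proj_zero ys by metis
  interpret Q: supercommutative_superalgebra Q by (rule Q_supercommutative)
  have "even_annihilator Q \<zero>\<^bsub>Q\<^esub> = carrier (even_ring Q)"
    by (auto simp: even_annihilator_def Q.even_subset)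
  then have "has_krull_dim (even_ring Q Quot carrier (even_ring Q)) p"
    using assms \<open>foldr (monoid.mult Q) ys \<one>\<^bsub>Q\<^esub> = \<zero>\<^bsub>Q\<^esub>\<close> by (simp only: odd_parameters_def)
  then obtain P where "primeideal (P (0::nat)) (even_ring Q Quot carrier (even_ring Q))"
    unfolding has_krull_dim_def prime_chain_def by blast
  then show False by (rule no_prime_in_trivial_quotient[OF Q.cring_even_ring])
qed

lemma hill_superdim: "has_superdim Q (m - 1) m"
  unfolding has_superdim_def
proof (intro conjI exI allI impI)
  show "has_krull_dim (even_ring Q) (m - 1)" by (rule even_ring_krull_dim)
  have odd_in: "set (map odd_var [1..<Suc m]) \<subseteq> superpolys_in {1..n} \<inter> (grassmann_part False :: 'k superpoly set)"
    by (auto intro!: superpolys_in_odd_var simp: n_eq odd_var_odd)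
  let ?ys = "map proj (map odd_var [1..<Suc m])"
  have "set ?ys \<subseteq> odd_part Q"
    unfolding Q_parts set_map[of proj] using odd_in by (rule image_mono)
  moreover have "foldr (monoid.mult Q) ?ys \<one>\<^bsub>Q\<^esub> = proj top_odd"
    using proj_foldr[of "map odd_var [1..<Suc m]"] odd_in by blast
  ultimately show "odd_parameters Q (m - 1) ?ys"
    unfolding odd_parameters_def using quotient_krull_dim by (simp only:)
  show "length ?ys = m" by simp
qed (rule odd_parameters_length)

end

text \<open>Stated over any field of characteristic zero, so that the real and the complex case are
  instances of one argument.\<close>

lemma hill_supervariety:
  fixes k_type :: "'k::field_char_0 itself" and R :: "('k, 'r) superalg"
  assumes "n \<ge> 3"
  shows "affine_superalgebra (hill_superalg n :: ('k, 'k superpoly set) superalg)"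
    and "supercommutative_superalgebra R \<Longrightarrow>
      bij_betw (hill_potential n) (superalg_homs (hill_superalg n) R) (hill_equations n R)"
    and "has_superdim (hill_superalg n :: ('k, 'k superpoly set) superalg) (n - 3) (n - 2)"
proof -
  interpret hill_variety n k_type "n - 2"
    by (intro hill_variety.intro hill_superspace.intro hill_variety_axioms.intro) (use assms in auto)
  show "affine_superalgebra (hill_superalg n :: ('k, 'k superpoly set) superalg)" by (rule affine_Q)
  show "supercommutative_superalgebra R \<Longrightarrow>
      bij_betw (hill_potential n) (superalg_homs (hill_superalg n) R) (hill_equations n R)"
    by (rule bij_hill_potential)
  have "n - 2 - 1 = n - 3" by simp
  then show "has_superdim (hill_superalg n :: ('k, 'k superpoly set) superalg) (n - 3) (n - 2)"
    using hill_superdim by simp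
qed

theorem proposition1p4p3:
  fixes n :: nat
    and R :: "(real, 'r) superalg"
    and S :: "(complex, 's) superalg"
  assumes "n \<ge> 3"
  shows "affine_superalgebra (hill_superalg n :: (real, real superpoly set) superalg)
      \<and> (supercommutative_superalgebra R \<longrightarrow>
           bij_betw (hill_potential n) (superalg_homs (hill_superalg n) R) (hill_equations n R))
      \<and> has_superdim (hill_superalg n :: (real, real superpoly set) superalg) (n - 3) (n - 2)
      \<and> affine_superalgebra (hill_superalg n :: (complex, complex superpoly set) superalg)
      \<and> (supercommutative_superalgebra S \<longrightarrow>
           bij_betw (hill_potential n) (superalg_homs (hill_superalg n) S) (hill_equations n S))
      \<and> has_superdim (hill_superalg n :: (complex, complex superpoly set) superalg) (n - 3) (n - 2)"
proof (intro conjI impI)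
  show "affine_superalgebra (hill_superalg n :: (real, real superpoly set) superalg)"
    by (rule hill_supervariety(1)[OF assms])
  show "affine_superalgebra (hill_superalg n :: (complex, complex superpoly set) superalg)"
    by (rule hill_supervariety(1)[OF assms])
  show "has_superdim (hill_superalg n :: (real, real superpoly set) superalg) (n - 3) (n - 2)"
    by (rule hill_supervariety(3)[OF assms])
  show "has_superdim (hill_superalg n :: (complex, complex superpoly set) superalg) (n - 3) (n - 2)"
    by (rule hill_supervariety(3)[OF assms])
  show "bij_betw (hill_potential n) (superalg_homs (hill_superalg n) R) (hill_equations n R)"
    if "supercommutative_superalgebra R"
    by (rule hill_supervariety(2)[OF assms that])
  show "bij_betw (hill_potential n) (superalg_homs (hill_superalg n) S) (hill_equations n S)"
    if "supercommutative_superalgebra S"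
    by (rule hill_supervariety(2)[OF assms that])
qed

end
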